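(* An element $\tau\in B=\mathbb Q[x_1,x_2,\ldots]$ is a solution to the KP hierarchy $$\mathrm{Res}_z\big(\Gamma^*(z)\tau\otimes\Gamma(z)\tau\big)=0$$ if and only if there exists $s\ge0$ such that $\tau \in B_r\otimes_{\mathbb Z}\mathbb Q$ and $\phi_r(\tau)\in\mathcal G_r\otimes\mathbb Q$ for all $r\ge s$. Here $$\Gamma(z)=\exp\Big(\sum_{i\ge1}x_iz^i\Big)\exp\Big(-\sum_{i\ge1}\frac1{iz^i}\frac{\partial}{\partial x_i}\Big),\qquad \Gamma^*(z)=\exp\Big(-\sum_{i\ge1}x_iz^i\Big)\exp\Big(\sum_{i\ge1}\frac1{iz^i}\frac{\partial}{\partial x_i}\Big)$$ are the vertex operators $B\to B((z))$.
   Context: $\mathrm{Res}_z$ is the coefficient of $z^{-1}$ of a formal Laurent series; for Laurent series, $(\sum f_iz^i)\otimes(\sum g_jz^j)=\sum(f_i\otimes g_j)z^{i+j}$, with coefficients in $B\otimes_{\mathbb Q}B$. Let $(e_1,e_2,\ldots)$ be indeterminates, $B_\infty=\mathbb Z[e_1,e_2,\ldots]$, $E_\infty(z)=1+\sum_{i\ge1}(-1)^ie_iz^i$. The variables $x_1,x_2,\ldots$ are defined by $\exp(-\sum_{i\ge1}x_iz^i)=E_\infty(z)$, so that $B:=B_\infty\otimes_{\mathbb Z}\mathbb Q=\mathbb Q[e_1,e_2,\ldots]=\mathbb Q[x_1,x_2,\ldots]$. Set $B_r=\mathbb Z[e_1,\ldots,e_r]$, $E_r(z)=1-e_1z+\cdots+(-1)^re_rz^r$,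 and define $H_r=(h_j)_{j\in\mathbb Z}$ in $B_r$ by $\sum_jh_jz^j=1/E_r(z)$. For a partition $\lambda=(\lambda_1\ge\cdots\ge\lambda_r\ge0)$ of length at most $r$ let $\Delta_\lambda(H_r)=\det(h_{\lambda_j-j+i})_{1\le i,j\le r}$; these form a $\mathbb Z$-basis of $B_r$. $M_0$ is a free abelian group with basis $(b_0,b_1,\ldots)$. For $\lambda$ of length at most $r$ let $[\mathbf b]^r_\lambda=b_{\lambda_r}\wedge b_{1+\lambda_{r-1}}\wedge\cdots\wedge b_{r-1+\lambda_1}\in\bigwedge^rM_0$. $\phi_r$ is the isomorphism $B_r\to\bigwedge^rM_0$, $\Delta_\lambda(H_r)\mapsto[\mathbf b]^r_\lambda$, extended $\mathbb Q$-linearly to $B_r\otimes\mathbb Q\to\bigwedge^r(M_0\otimes_{\mathbb Z}\mathbb Q)$. Every $\tau\in B$ belongs to $B_r\otimes\mathbb Q=\mathbb Q[e_1,\ldots,e_r]$ for all sufficiently large $r$. $\mathcal G_r\otimes\mathbb Q$ denotes the Grassmann cone of decomposable tensors of $\bigwedge^r(M_0\otimes_{\mathbb Z}\mathbb Q)$, i.e. the set of all $m_1\wedge\cdots\wedge m_r$ with $m_i\in M_0\otimes\mathbb Q$. *)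

theory Defs
  imports
    "HOL-Library.Poly_Mapping"
    "HOL-Library.FSet"
    "HOL-Computational_Algebra.Formal_Laurent_Series"
    "Jordan_Normal_Form.Determinant"
begin

section \<open>Free rational vector spaces\<close>

text \<open>The type \<^typ>\<open>'a \<Rightarrow>\<^sub>0 rat\<close> is the rational vector space with basis
  \<open>Poly_Mapping.single a 1\<close>, \<open>a :: 'a\<close>.\<close>

definition qscale :: "rat \<Rightarrow> ('a \<Rightarrow>\<^sub>0 rat) \<Rightarrow> ('a \<Rightarrow>\<^sub>0 rat)"
  where "qscale c f = Poly_Mapping.map ((*) c) f"

lemma lookup_qscale [simp]: "Poly_Mapping.lookup (qscale c f) a = c * Poly_Mapping.lookup f a"
  by (simp add: qscale_def Poly_Mapping.map.rep_eq when_def)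

lemma vector_space_qscale: "vector_space qscale"
  by unfold_locales (auto intro!: poly_mapping_eqI simp: lookup_add algebra_simps)

global_interpretation Q: vector_space_pair
  "qscale :: rat \<Rightarrow> ('a \<Rightarrow>\<^sub>0 rat) \<Rightarrow> ('a \<Rightarrow>\<^sub>0 rat)"
  "qscale :: rat \<Rightarrow> ('b \<Rightarrow>\<^sub>0 rat) \<Rightarrow> ('b \<Rightarrow>\<^sub>0 rat)"
  by (intro vector_space_pair.intro vector_space_qscale)

definition linext :: "(rat \<Rightarrow> 'c \<Rightarrow> 'c) \<Rightarrow> ('a \<Rightarrow> 'c) \<Rightarrow> ('a \<Rightarrow>\<^sub>0 rat) \<Rightarrow> 'c::comm_monoid_add"
  where "linext scale g p = (\<Sum>a\<in>Poly_Mapping.keys p. scale (Poly_Mapping.lookup p a) (g a))"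

lemma linext_superset:
  assumes "vector_space scale" "finite A" "Poly_Mapping.keys p \<subseteq> A"
  shows "linext scale g p = (\<Sum>a\<in>A. scale (Poly_Mapping.lookup p a) (g a))"
proof -
  interpret vector_space scale by fact
  show ?thesis unfolding linext_def
    using assms(2,3) by (intro sum.mono_neutral_left) (auto simp: in_keys_iff)
qed

lemma linext_single:
  assumes "vector_space scale"
  shows "linext scale g (Poly_Mapping.single a c) = scale c (g a)"
proof -
  interpret vector_space scale by fact
  show ?thesis by (simp add: linext_def)
qed

lemma linext_add:
  assumes "vector_space scale"
  shows "linext scale g (p + q) = linext scale g p + linext scale g q"
proof -
  interpret vector_space scale by fact
  let ?A = "Poly_Mapping.keys p \<union> Poly_Mapping.keys q"
  have "Poly_Mapping.keys (p + q) \<subseteq> ?A" by (rule Poly_Mapping.keys_add)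
  then show ?thesis
    by (simp add: linext_superset[OF assms, of ?A] lookup_add scale_left_distrib sum.distrib)
qed

lemma linext_qscale:
  assumes "vector_space scale"
  shows "linext scale g (qscale c p) = scale c (linext scale g p)"
proof -
  interpret vector_space scale by fact
  have "Poly_Mapping.keys (qscale c p) \<subseteq> Poly_Mapping.keys p" by (auto simp: in_keys_iff)
  then show ?thesis
    by (simp add: linext_superset[OF assms, of "Poly_Mapping.keys p"] scale_sum_right)
qed

lemma linear_linext:
  assumes "vector_space scale"
  shows "Vector_Spaces.linear qscale scale (linext scale g)"
  using assms vector_space_qscale
  by (simp add: Vector_Spaces.linear_iff linext_add linext_qscale)

lemma linext_id: "linext qscale (\<lambda>a. Poly_Mapping.single a 1) p = p"
proof (rule poly_mapping_eqI)
  fix b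
  show "Poly_Mapping.lookup (linext qscale (\<lambda>a. Poly_Mapping.single a 1) p) b = Poly_Mapping.lookup p b"
    by (simp add: linext_def lookup_sum lookup_single when_def if_distrib in_keys_iff cong: if_cong)
qed

lemma qspan_single:
  assumes "Poly_Mapping.keys p \<subseteq> A"
  shows "p \<in> Q.vs1.span ((\<lambda>a. Poly_Mapping.single a 1) ` A)"
proof -
  have "linext qscale (\<lambda>a. Poly_Mapping.single a 1) p
      \<in> Q.vs1.span ((\<lambda>a. Poly_Mapping.single a 1) ` A)"
    unfolding linext_def using assms
    by (intro Q.vs1.span_sum Q.vs1.span_scale Q.vs1.span_base) auto
  then show ?thesis by (simp add: linext_id)
qed

section \<open>Tensor products\<close>

text \<open>The tensor product of the free vector spaces on \<open>'a\<close> and \<open>'b\<close> is realised as the free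
  vector space on \<open>'a \<times> 'b\<close>; the lemmas below establish its universal property.\<close>

definition tensor :: "('a \<Rightarrow>\<^sub>0 rat) \<Rightarrow> ('b \<Rightarrow>\<^sub>0 rat) \<Rightarrow> ('a \<times> 'b \<Rightarrow>\<^sub>0 rat)"  (infixl \<open>\<otimes>\<^sub>Q\<close> 70)
  where "f \<otimes>\<^sub>Q g = (\<Sum>a\<in>Poly_Mapping.keys f. \<Sum>b\<in>Poly_Mapping.keys g. Poly_Mapping.single (a, b) (Poly_Mapping.lookup f a * Poly_Mapping.lookup g b))"

lemma lookup_tensor: "Poly_Mapping.lookup (f \<otimes>\<^sub>Q g) (a, b) = Poly_Mapping.lookup f a * Poly_Mapping.lookup g b"
proof -
  have "Poly_Mapping.lookup (f \<otimes>\<^sub>Q g) (a, b) = (\<Sum>a'\<in>Poly_Mapping.keys f. \<Sum>b'\<in>Poly_Mapping.keys g.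
      if a' = a then if b' = b then Poly_Mapping.lookup f a' * Poly_Mapping.lookup g b' else 0 else 0)"
    unfolding tensor_def lookup_sum lookup_single by (intro sum.cong refl) (auto simp: when_def)
  also have "\<dots> = (\<Sum>a'\<in>Poly_Mapping.keys f. if a' = a then Poly_Mapping.lookup f a' * Poly_Mapping.lookup g b else 0)"
    by (intro sum.cong refl) (auto simp: in_keys_iff)
  also have "\<dots> = Poly_Mapping.lookup f a * Poly_Mapping.lookup g b"
    by (auto simp: in_keys_iff)
  finally show ?thesis .
qed

lemma tensor_bilinear:
  "(f + f') \<otimes>\<^sub>Q g = f \<otimes>\<^sub>Q g + f' \<otimes>\<^sub>Q g" "f \<otimes>\<^sub>Q (g + g') = f \<otimes>\<^sub>Q g + f \<otimes>\<^sub>Q g'"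
  "qscale c f \<otimes>\<^sub>Q g = qscale c (f \<otimes>\<^sub>Q g)" "f \<otimes>\<^sub>Q qscale c g = qscale c (f \<otimes>\<^sub>Q g)"
  by (rule poly_mapping_eqI, clarify, simp add: lookup_tensor lookup_add algebra_simps)+

lemma tensor_span: "Q.vs1.span {f \<otimes>\<^sub>Q g | f g. True} = (UNIV :: ('a \<times> 'b \<Rightarrow>\<^sub>0 rat) set)"
proof -
  have "Poly_Mapping.single (a, b) 1 = Poly_Mapping.single a 1 \<otimes>\<^sub>Q Poly_Mapping.single b 1"
    for a :: 'a and b :: 'b
    by (auto intro!: poly_mapping_eqI simp: lookup_tensor lookup_single when_def)
  then have *: "range (\<lambda>x :: 'a \<times> 'b. Poly_Mapping.single x 1) \<subseteq> {f \<otimes>\<^sub>Q g | f g. True}"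
    by (auto intro!: exI)
  have "x \<in> Q.vs1.span {f \<otimes>\<^sub>Q g | f g. True}" for x :: "'a \<times> 'b \<Rightarrow>\<^sub>0 rat"
    using Q.vs1.span_mono[OF *] qspan_single[of x UNIV] by (rule subsetD) simp
  then show ?thesis by (intro UNIV_eq_I[symmetric])
qed

lemma tensor_universal:
  fixes \<beta> :: "('a \<Rightarrow>\<^sub>0 rat) \<Rightarrow> ('b \<Rightarrow>\<^sub>0 rat) \<Rightarrow> 'c::ab_group_add"
  assumes vs: "vector_space scale"
    and l: "\<And>g. Vector_Spaces.linear qscale scale (\<lambda>f. \<beta> f g)"
    and r: "\<And>f. Vector_Spaces.linear qscale scale (\<beta> f)"
  shows "\<exists>!L. Vector_Spaces.linear qscale scale L \<and> (\<forall>f g. L (f \<otimes>\<^sub>Q g) = \<beta> f g)"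
proof -
  interpret V: vector_space scale by fact
  interpret QV: vector_space_pair "qscale :: rat \<Rightarrow> ('a \<times> 'b \<Rightarrow>\<^sub>0 rat) \<Rightarrow> _" scale
    by (intro vector_space_pair.intro vector_space_qscale vs)
  define L where "L = linext scale (\<lambda>(a, b). \<beta> (Poly_Mapping.single a 1) (Poly_Mapping.single b 1))"
  have L: "Vector_Spaces.linear qscale scale L"
    unfolding L_def by (rule linear_linext[OF vs])
  have eq: "linext scale (\<lambda>a. h (Poly_Mapping.single a 1)) p = h p"
    if h: "Vector_Spaces.linear qscale scale h" for h :: "('d \<Rightarrow>\<^sub>0 rat) \<Rightarrow> 'c" and p
  proof -
    interpret h: Vector_Spaces.linear qscale scale h by fact
    have "h p = h (linext qscale (\<lambda>a. Poly_Mapping.single a 1) p)" by (simp add: linext_id)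
    also have "\<dots> = linext scale (\<lambda>a. h (Poly_Mapping.single a 1)) p"
      by (simp add: linext_def h.sum h.scale)
    finally show ?thesis ..
  qed
  have "L (f \<otimes>\<^sub>Q g) = \<beta> f g" for f g
  proof -
    interpret L: Vector_Spaces.linear qscale scale L by (rule L)
    have "L (f \<otimes>\<^sub>Q g) = linext scale (\<lambda>a. linext scale (\<lambda>b. \<beta> (Poly_Mapping.single a 1) (Poly_Mapping.single b 1)) g) f"
      unfolding tensor_def L.sum
      by (simp add: L_def linext_single[OF vs]) (simp add: linext_def V.scale_sum_right)
    also have "\<dots> = \<beta> f g"
      by (simp add: eq[OF r] eq[OF l])
    finally show ?thesis .
  qed
  moreover have "L' = L''"
    if "Vector_Spaces.linear qscale scale L'" "\<forall>f g. L' (f \<otimes>\<^sub>Q g) = \<beta> f g"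
       "Vector_Spaces.linear qscale scale L''" "\<forall>f g. L'' (f \<otimes>\<^sub>Q g) = \<beta> f g" for L' L''
  proof
    fix x
    show "L' x = L'' x"
      using that tensor_span[where 'a = 'a and 'b = 'b]
      by (intro QV.linear_eq_on[OF that(1,3), of x "{f \<otimes>\<^sub>Q g | f g. True}"]) auto
  qed
  ultimately show ?thesis using L by metis
qed

section \<open>Exterior powers\<close>

text \<open>\<open>M = M\<^sub>0 \<otimes> \<rat>\<close> has the basis \<open>b\<^sub>0, b\<^sub>1, \<dots>\<close>. Its exterior algebra is realised as the free
  vector space on the finite subsets \<open>{i\<^sub>1 < \<dots> < i\<^sub>r}\<close> of the naturals, which stand for
  \<open>b\<^bsub>i\<^sub>1\<^esub> \<and> \<dots> \<and> b\<^bsub>i\<^sub>r\<^esub>\<close>; the lemmas below establish the universal property of the \<open>r\<close>-th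
  exterior power for alternating multilinear maps.\<close>

type_synonym vec0 = "nat \<Rightarrow>\<^sub>0 rat"
type_synonym ext = "nat fset \<Rightarrow>\<^sub>0 rat"

definition bvec :: "nat \<Rightarrow> vec0"
  where "bvec i = Poly_Mapping.single i 1"

text \<open>\<open>b\<^sub>i \<and> b\<^bsub>i\<^sub>1\<^esub> \<and> \<dots> \<and> b\<^bsub>i\<^sub>r\<^esub>\<close>: moving \<open>b\<^sub>i\<close> to its place costs one sign for each
  \<open>i\<^sub>k < i\<close>.\<close>

definition bwedge :: "nat \<Rightarrow> nat fset \<Rightarrow> ext"
  where "bwedge i S = (if i |\<in>| S then 0
    else Poly_Mapping.single (finsert i S) ((-1) ^ fcard (ffilter (\<lambda>s. s < i) S)))"

definition wedge1 :: "vec0 \<Rightarrow> ext \<Rightarrow> ext"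
  where "wedge1 v w = linext qscale (\<lambda>i. linext qscale (bwedge i) w) v"

definition wedge :: "vec0 list \<Rightarrow> ext"
  where "wedge ms = foldr wedge1 ms (Poly_Mapping.single {||} 1)"

definition ext_power :: "nat \<Rightarrow> ext set"
  where "ext_power r = {w. \<forall>S\<in>Poly_Mapping.keys w. fcard S = r}"

lemma wedge_Nil [simp]: "wedge [] = Poly_Mapping.single {||} 1"
  and wedge_Cons [simp]: "wedge (m # ms) = wedge1 m (wedge ms)"
  by (simp_all add: wedge_def)

lemmas qlinext_simps [simp] =
  linext_add[OF vector_space_qscale] linext_qscale[OF vector_space_qscale]
  linext_single[OF vector_space_qscale]

lemma linext_zero [simp]: "linext scale g 0 = 0"
  by (simp add: linext_def)

lemma qscale_single [simp]: "qscale c (Poly_Mapping.single a d) = Poly_Mapping.single a (c * d)"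
  by (auto intro!: poly_mapping_eqI simp: lookup_single when_def)

lemma linear_wedge1_left: "Vector_Spaces.linear qscale qscale (\<lambda>v. wedge1 v w)"
  unfolding wedge1_def by (rule linear_linext[OF vector_space_qscale])

lemma wedge1_add_right: "wedge1 v (w + w') = wedge1 v w + wedge1 v w'"
  unfolding wedge1_def linext_def[of _ _ v]
  by (simp add: Q.vs1.scale_right_distrib sum.distrib)

lemma wedge1_qscale_right: "wedge1 v (qscale c w) = qscale c (wedge1 v w)"
  unfolding wedge1_def linext_def[of _ _ v]
  by (simp add: Q.vs1.scale_sum_right mult.commute)

lemma linear_wedge1_right: "Vector_Spaces.linear qscale qscale (wedge1 v)"
  by (simp add: Vector_Spaces.linear_iff vector_space_qscale wedge1_add_right wedge1_qscale_right)

lemma wedge1_zero_right [simp]: "wedge1 v 0 = 0"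
  by (simp add: wedge1_def linext_def)

lemma wedge1_bvec_left [simp]: "wedge1 (bvec i) w = linext qscale (bwedge i) w"
  by (simp add: wedge1_def bvec_def)

lemma wedge_multilinear:
  "wedge (us @ (qscale c x + y) # vs) = qscale c (wedge (us @ x # vs)) + wedge (us @ y # vs)"
proof (induction us)
  case Nil
  interpret L: Vector_Spaces.linear qscale qscale "\<lambda>v. wedge1 v (wedge vs)"
    by (rule linear_wedge1_left)
  show ?case by (simp add: L.add L.scale)
next
  case (Cons u us)
  then show ?case by (simp add: wedge1_add_right wedge1_qscale_right)
qed

lemma fcard_filter_finsert:
  assumes "j |\<notin>| S"
  shows "fcard (ffilter P (finsert j S)) = fcard (ffilter P S) + (if P j then 1 else 0)"
proof -
  have "ffilter P (finsert j S) = (if P j then finsert j (ffilter P S) else ffilter P S)"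
    by (rule fset_eqI) (simp, metis)
  then show ?thesis using assms by (simp add: fcard_finsert_disjoint)
qed

lemma bwedge_anti:
  "linext qscale (bwedge i) (bwedge j S) = - linext qscale (bwedge j) (bwedge i S)"
proof (cases "i |\<in>| S \<or> j |\<in>| S \<or> i = j")
  case True
  then show ?thesis by (auto simp: bwedge_def)
next
  case False
  then have [simp]: "i |\<notin>| S" "j |\<notin>| S" "i \<noteq> j" "j \<noteq> i" by auto
  have comm: "finsert j (finsert i S) = finsert i (finsert j S)" by (rule finsert_commute)
  have "linext qscale (bwedge i) (bwedge j S) = Poly_Mapping.single (finsert i (finsert j S))
      ((-1) ^ fcard (ffilter (\<lambda>s. s < j) S) * (-1) ^ (fcard (ffilter (\<lambda>s. s < i) S) + (if j < i then 1 else 0)))"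
    by (simp add: bwedge_def fcard_filter_finsert del: power_Suc)
  moreover have "linext qscale (bwedge j) (bwedge i S) = Poly_Mapping.single (finsert i (finsert j S))
      ((-1) ^ fcard (ffilter (\<lambda>s. s < i) S) * (-1) ^ (fcard (ffilter (\<lambda>s. s < j) S) + (if i < j then 1 else 0)))"
    by (simp add: bwedge_def fcard_filter_finsert comm del: power_Suc)
  moreover have "(if i < j then 1 else 0 :: nat) = 1 - (if j < i then 1 else 0)"
    using \<open>i \<noteq> j\<close> by auto
  ultimately show ?thesis
    by (cases "j < i") (simp_all add: mult.commute flip: single_uminus)
qed

lemma wedge1_self: "wedge1 v (wedge1 v w) = 0"
proof -
  define C where "C i j = linext qscale (bwedge i) (linext qscale (bwedge j) w)" for i j
  have lin: "linext qscale (bwedge i) (\<Sum>a\<in>A. qscale (c a) (g a))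
      = (\<Sum>a\<in>A. qscale (c a) (linext qscale (bwedge i) (g a)))"
    for i and A :: "'z set" and c g
    by (induction A rule: infinite_finite_induct) auto
  have C: "C i j = (\<Sum>S\<in>Poly_Mapping.keys w. qscale (Poly_Mapping.lookup w S)
      (linext qscale (bwedge i) (bwedge j S)))" for i j
    unfolding C_def linext_def[of _ "bwedge j"] by (rule lin)
  have anti: "C i j = - C j i" for i j
    unfolding C bwedge_anti[of i j] by (simp add: sum_negf)
  let ?X = "\<Sum>i\<in>Poly_Mapping.keys v. \<Sum>j\<in>Poly_Mapping.keys v.
    qscale (Poly_Mapping.lookup v i * Poly_Mapping.lookup v j) (C i j)"
  have X: "wedge1 v (wedge1 v w) = ?X"
    unfolding wedge1_def linext_def[of _ _ v] lin C_def
    by (simp add: Q.vs1.scale_sum_right)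
  have "?X = - ?X"
    by (subst sum.swap, subst anti) (simp add: sum_negf mult.commute)
  with X have Y: "wedge1 v (wedge1 v w) = - wedge1 v (wedge1 v w)" by metis
  show ?thesis
  proof (rule poly_mapping_eqI)
    fix S
    from arg_cong[OF Y, of "\<lambda>y. Poly_Mapping.lookup y S"]
    show "Poly_Mapping.lookup (wedge1 v (wedge1 v w)) S = Poly_Mapping.lookup 0 S"
      by (simp only: lookup_uminus lookup_zero equal_neg_zero)
  qed
qed

lemma wedge_alternating: "wedge (us @ x # x # vs) = 0"
  by (induction us) (simp_all add: wedge1_self)

lemma sum_in_ext_power:
  assumes "\<And>a. a \<in> A \<Longrightarrow> f a \<in> ext_power r"
  shows "sum f A \<in> ext_power r"
  using assms
proof (induction A rule: infinite_finite_induct)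
  case (insert a A)
  then have "f a \<in> ext_power r" "sum f A \<in> ext_power r" by auto
  then have "f a + sum f A \<in> ext_power r"
    unfolding ext_power_def using Poly_Mapping.keys_add[of "f a" "sum f A"] by auto
  with insert show ?case by simp
qed (simp_all add: ext_power_def)

lemma linext_in_ext_power:
  assumes "\<And>a. a \<in> Poly_Mapping.keys p \<Longrightarrow> f a \<in> ext_power r"
  shows "linext qscale f p \<in> ext_power r"
  unfolding linext_def using assms
  by (intro sum_in_ext_power) (fastforce simp: ext_power_def in_keys_iff)

lemma bwedge_in_ext_power: "fcard S = r \<Longrightarrow> bwedge i S \<in> ext_power (Suc r)"
  by (auto simp: bwedge_def ext_power_def fcard_finsert_disjoint)

lemma wedge_in_ext_power: "wedge ms \<in> ext_power (length ms)"
proof (induction ms)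
  case Nil
  show ?case by (simp add: ext_power_def)
next
  case (Cons m ms)
  have "linext qscale (bwedge i) (wedge ms) \<in> ext_power (Suc (length ms))" for i
    using Cons by (intro linext_in_ext_power bwedge_in_ext_power) (auto simp: ext_power_def)
  then show ?case
    by (simp add: wedge1_def linext_in_ext_power)
qed

lemma wedge_bvec_sorted:
  "sorted_wrt (<) xs \<Longrightarrow> wedge (map bvec xs) = Poly_Mapping.single (fset_of_list xs) 1"
proof (induction xs)
  case (Cons i xs)
  then have "i |\<notin>| fset_of_list xs" by (auto simp: fset_of_list_elem)
  moreover have "ffilter (\<lambda>s. s < i) (fset_of_list xs) = {||}"
    using Cons.prems by (intro fset_eqI) (auto simp: fset_of_list_elem)
  ultimately show ?case using Cons by (simp add: bwedge_def fcard.rep_eq)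
qed simp

lemma ext_power_span: "Q.vs1.span {wedge ms | ms. length ms = r} = ext_power r"
proof
  show "Q.vs1.span {wedge ms | ms. length ms = r} \<subseteq> ext_power r"
  proof (rule Q.vs1.span_minimal)
    show "{wedge ms | ms. length ms = r} \<subseteq> ext_power r"
      using wedge_in_ext_power by auto
    show "Q.vs1.subspace (ext_power r)"
      using Poly_Mapping.keys_add
      by (fastforce simp: Q.vs1.subspace_def ext_power_def in_keys_iff lookup_add)
  qed
  show "ext_power r \<subseteq> Q.vs1.span {wedge ms | ms. length ms = r}"
  proof
    fix w assume "w \<in> ext_power r"
    then have "w \<in> Q.vs1.span ((\<lambda>S. Poly_Mapping.single S 1) ` {S. fcard S = r})"
      by (intro qspan_single) (auto simp: ext_power_def)
    moreover have "(\<lambda>S. Poly_Mapping.single S 1) ` {S. fcard S = r} \<subseteq> {wedge ms | ms. length ms = r}"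
    proof (clarify)
      fix S :: "nat fset" assume r: "r = fcard S"
      let ?xs = "sorted_list_of_fset S"
      have "sorted_wrt (<) ?xs" by (simp add: sorted_list_of_fset.rep_eq)
      moreover have "fset_of_list ?xs = S" by (simp add: fset_eq_iff fset_of_list_elem sorted_list_of_fset.rep_eq)
      moreover have "length ?xs = fcard S"
        by (simp add: sorted_list_of_fset.rep_eq fcard.rep_eq)
      ultimately show "\<exists>ms. Poly_Mapping.single S (1::rat) = wedge ms \<and> length ms = fcard S"
        by (intro exI[of _ "map bvec ?xs"]) (simp add: wedge_bvec_sorted)
    qed
    ultimately show "w \<in> Q.vs1.span {wedge ms | ms. length ms = r}"
      using Q.vs1.span_mono by blast
  qed
qed

lemma ext_power_universal:
  fixes F :: "vec0 list \<Rightarrow> 'c::ab_group_add"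
  assumes vs: "vector_space scale"
    and lin: "\<And>us c x y vs. length us + length vs + 1 = r \<Longrightarrow>
      F (us @ (qscale c x + y) # vs) = scale c (F (us @ x # vs)) + F (us @ y # vs)"
    and alt: "\<And>us x vs. length us + length vs + 2 = r \<Longrightarrow> F (us @ x # x # vs) = 0"
  shows "\<exists>L. Vector_Spaces.linear qscale scale L \<and> (\<forall>ms. length ms = r \<longrightarrow> L (wedge ms) = F ms)"
    and "\<lbrakk>Vector_Spaces.linear qscale scale L; \<forall>ms. length ms = r \<longrightarrow> L (wedge ms) = F ms;
      Vector_Spaces.linear qscale scale L'; \<forall>ms. length ms = r \<longrightarrow> L' (wedge ms) = F ms;
      w \<in> ext_power r\<rbrakk> \<Longrightarrow> L w = L' w"
proof -
  interpret V: vector_space scale by fact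
  interpret QV: vector_space_pair "qscale :: rat \<Rightarrow> ext \<Rightarrow> _" scale
    by (intro vector_space_pair.intro vector_space_qscale vs)
  show "L w = L' w"
    if "Vector_Spaces.linear qscale scale L" "\<forall>ms. length ms = r \<longrightarrow> L (wedge ms) = F ms"
      "Vector_Spaces.linear qscale scale L'" "\<forall>ms. length ms = r \<longrightarrow> L' (wedge ms) = F ms"
      "w \<in> ext_power r"
    using that
    by (intro QV.linear_eq_on[OF that(1,3), of w "{wedge ms | ms. length ms = r}"])
       (auto simp: ext_power_span)
  have slot: "Vector_Spaces.linear qscale scale (\<lambda>x. F (us @ x # vs))"
    if "length us + length vs + 1 = r" for us vs
  proof -
    have 0: "F (us @ 0 # vs) = 0"
      using lin[OF that, of "-1" 0 0] by simp
    have "F (us @ (x + y) # vs) = F (us @ x # vs) + F (us @ y # vs)" for x y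
      using lin[OF that, of 1 x y] by simp
    moreover have "F (us @ qscale c x # vs) = scale c (F (us @ x # vs))" for c x
      using lin[OF that, of c x 0] by (simp add: 0)
    ultimately show ?thesis
      by (simp add: Vector_Spaces.linear_iff vector_space_qscale vs)
  qed
  have swap: "F (us @ x # y # vs) = - F (us @ y # x # vs)"
    if "length us + length vs + 2 = r" for us x y vs
  proof -
    interpret l1: Vector_Spaces.linear qscale scale "\<lambda>z. F (us @ z # (x + y) # vs)"
      using slot[of us "(x + y) # vs"] that by simp
    interpret l2: Vector_Spaces.linear qscale scale "\<lambda>z. F (us @ x # z # vs)"
      using slot[of "us @ [x]" vs] that by simp
    interpret l3: Vector_Spaces.linear qscale scale "\<lambda>z. F (us @ y # z # vs)"
      using slot[of "us @ [y]" vs] that by simp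
    have "0 = F (us @ (x + y) # (x + y) # vs)" using alt[OF that] by simp
    also have "\<dots> = F (us @ x # y # vs) + F (us @ y # x # vs)"
      using alt[OF that, of x] alt[OF that, of y] by (simp add: l1.add l2.add l3.add)
    finally show ?thesis by (metis eq_neg_iff_add_eq_0)
  qed
  define G where "G us S = F (us @ map bvec (sorted_list_of_fset S))" for us S
  have ins: "F (us @ bvec i # map bvec xs)
      = (if i \<in> set xs then 0
         else scale ((-1) ^ card {s\<in>set xs. s < i}) (F (us @ map bvec (insort i xs))))"
    if "sorted_wrt (<) xs" "length us + length xs + 1 = r" for us i xs
    using that
  proof (induction xs arbitrary: us)
    case Nil
    then show ?case by simp
  next
    case (Cons k xs)
    consider "i = k" | "i < k" | "k < i" by linarith
    then show ?case
    proof cases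
      case 1
      then show ?thesis using alt[of us "map bvec xs" "bvec k"] Cons.prems by simp
    next
      case 2
      with Cons.prems have "i \<notin> set (k # xs)" and "{s \<in> set (k # xs). s < i} = {}" by auto
      then have "i \<notin> set (k # xs)" and "card {s \<in> set (k # xs). s < i} = 0"
        by (blast, simp only: card.empty)
      with 2 show ?thesis by (simp del: card_0_eq list.set)
    next
      case 3
      have k: "k \<notin> set xs" using Cons.prems by auto
      have "{s \<in> set (k # xs). s < i} = insert k {s \<in> set xs. s < i}" using 3 by auto
      then have card: "card {s \<in> set (k # xs). s < i} = Suc (card {s \<in> set xs. s < i})"
        using k by simp
      have "F (us @ bvec i # map bvec (k # xs)) = - F (us @ bvec k # bvec i # map bvec xs)"
        using swap[of us "map bvec xs" "bvec i" "bvec k"] Cons.prems by simp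
      also have "F (us @ bvec k # bvec i # map bvec xs) = (if i \<in> set xs then 0
         else scale ((-1) ^ card {s\<in>set xs. s < i}) (F ((us @ [bvec k]) @ map bvec (insort i xs))))"
        using Cons.IH[of "us @ [bvec k]"] Cons.prems by simp
      finally show ?thesis using 3 card by simp
    qed
  qed
  have main: "F (us @ ms) = linext scale (G us) (wedge ms)" if "length us + length ms = r" for us ms
    using that
  proof (induction ms arbitrary: us)
    case Nil
    then show ?case by (simp add: linext_single[OF vs] G_def sorted_list_of_fset.rep_eq)
  next
    case (Cons m ms)
    interpret L: Vector_Spaces.linear qscale scale "linext scale (G us)"
      by (rule linear_linext[OF vs])
    interpret l: Vector_Spaces.linear qscale scale "\<lambda>z. F (us @ z # ms)"
      using slot[of us ms] Cons.prems by simp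
    have card: "fcard S = length ms" if "S \<in> Poly_Mapping.keys (wedge ms)" for S
      using that wedge_in_ext_power[of ms] by (auto simp: ext_power_def)
    have bw: "G (us @ [bvec i]) S = linext scale (G us) (bwedge i S)"
      if "S \<in> Poly_Mapping.keys (wedge ms)" for i S
    proof -
      let ?xs = "sorted_list_of_fset S"
      have "length ?xs = length ms"
        using card[OF that] by (simp add: sorted_list_of_fset.rep_eq fcard.rep_eq)
      moreover have "sorted_wrt (<) ?xs" by (simp add: sorted_list_of_fset.rep_eq)
      moreover have "insort i ?xs = sorted_list_of_fset (finsert i S)" if "i |\<notin>| S"
        using that by (simp add: sorted_list_of_fset.rep_eq sorted_list_of_set_insert)
      moreover have "card {s \<in> fset S. s < i} = fcard (ffilter (\<lambda>s. s < i) S)"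
        by (auto simp: fcard.rep_eq intro!: arg_cong[of _ _ card])
      ultimately show ?thesis
        using ins[of ?xs us i] Cons.prems
        by (auto simp: G_def bwedge_def linext_single[OF vs] sorted_list_of_fset.rep_eq)
    qed
    have "F (us @ bvec i # ms) = linext scale (G us) (linext qscale (bwedge i) (wedge ms))" for i
    proof -
      have "F (us @ bvec i # ms) = linext scale (G (us @ [bvec i])) (wedge ms)"
        using Cons.IH[of "us @ [bvec i]"] Cons.prems by simp
      also have "\<dots> = (\<Sum>S\<in>Poly_Mapping.keys (wedge ms).
          scale (Poly_Mapping.lookup (wedge ms) S) (linext scale (G us) (bwedge i S)))"
        unfolding linext_def[of _ "G (us @ [bvec i])"] by (intro sum.cong refl) (simp add: bw)
      also have "\<dots> = linext scale (G us) (linext qscale (bwedge i) (wedge ms))"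
        unfolding linext_def[of _ "bwedge i"] by (simp add: L.sum L.scale)
      finally show ?thesis .
    qed
    note basis = this
    have "F (us @ m # ms) = F (us @ linext qscale bvec m # ms)"
      using linext_id[of m] by (simp add: bvec_def[abs_def])
    also have "\<dots> = (\<Sum>i\<in>Poly_Mapping.keys m. scale (Poly_Mapping.lookup m i) (F (us @ bvec i # ms)))"
      unfolding linext_def by (simp add: l.sum l.scale)
    also have "\<dots> = linext scale (G us) (wedge (m # ms))"
      unfolding basis wedge_Cons wedge1_def linext_def[of _ _ m] by (simp add: L.sum L.scale)
    finally show ?case .
  qed
  show "\<exists>L. Vector_Spaces.linear qscale scale L \<and> (\<forall>ms. length ms = r \<longrightarrow> L (wedge ms) = F ms)"
    using main[of "[]"] linear_linext[OF vs] by (intro exI[of _ "linext scale (G [])"]) simp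
qed

definition grassmann_cone :: "nat \<Rightarrow> ext set"
  where "grassmann_cone r = {wedge ms | ms. length ms = r}"

section \<open>The polynomial ring and its subrings\<close>

text \<open>\<open>B = \<rat>[x\<^sub>1, x\<^sub>2, \<dots>]\<close>. Monomials are exponent functions; to avoid a spurious variable \<open>x\<^sub>0\<close>,
  the exponent of \<open>x\<^sub>i\<close>, \<open>i \<ge> 1\<close>, is stored at position \<open>i - 1\<close>.\<close>

type_synonym mono = "nat \<Rightarrow>\<^sub>0 nat"
type_synonym B = "mono \<Rightarrow>\<^sub>0 rat"

definition qconst :: "rat \<Rightarrow> B"
  where "qconst c = Poly_Mapping.single 0 c"

definition xvar :: "nat \<Rightarrow> B"
  where "xvar i = Poly_Mapping.single (Poly_Mapping.single (i - 1) 1) 1"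

definition pdiff :: "nat \<Rightarrow> B \<Rightarrow> B"
  where "pdiff i p = (\<Sum>m\<in>Poly_Mapping.keys p.
    Poly_Mapping.single (m - Poly_Mapping.single (i - 1) 1)
      (of_nat (Poly_Mapping.lookup m (i - 1)) * Poly_Mapping.lookup p m))"

text \<open>\<open>exp f\<close> for \<open>f \<in> z B[[z]]\<close>\<close>

definition exp_series :: "B fps \<Rightarrow> B fps"
  where "exp_series f = fps_compose (Abs_fps (\<lambda>n. qconst (1 / fact n))) f"

definition xseries :: "B fps"
  where "xseries = Abs_fps (\<lambda>i. if i = 0 then 0 else xvar i)"

text \<open>The \<open>e\<^sub>i\<close> are obtained from \<open>1 + \<Sum>\<^bsub>i\<ge>1\<^esub> (-1)\<^sup>i e\<^sub>i z\<^sup>i = exp (- \<Sum>\<^bsub>i\<ge>1\<^esub> x\<^sub>i z\<^sup>i)\<close>.\<close>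

definition evar :: "nat \<Rightarrow> B"
  where "evar i = (-1) ^ i * fps_nth (exp_series (- xseries)) i"

text \<open>\<open>B\<^sub>r \<otimes> \<rat> = \<rat>[e\<^sub>1, \<dots>, e\<^sub>r]\<close>, the subalgebra generated by \<open>e\<^sub>1, \<dots>, e\<^sub>r\<close>\<close>

inductive_set Br :: "nat \<Rightarrow> B set" for r :: nat where
  Br_const: "qconst c \<in> Br r"
| Br_evar: "1 \<le> i \<Longrightarrow> i \<le> r \<Longrightarrow> evar i \<in> Br r"
| Br_add: "p \<in> Br r \<Longrightarrow> q \<in> Br r \<Longrightarrow> p + q \<in> Br r"
| Br_mult: "p \<in> Br r \<Longrightarrow> q \<in> Br r \<Longrightarrow> p * q \<in> Br r"

definition E_ser :: "nat \<Rightarrow> B fps"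
  where "E_ser r = 1 + (\<Sum>i=1..r. fps_const ((-1) ^ i * evar i) * fps_X ^ i)"

definition hcoef :: "nat \<Rightarrow> int \<Rightarrow> B"
  where "hcoef r j = (if j < 0 then 0 else fps_nth (fps_right_inverse (E_ser r) 1) (nat j))"

lemma E_ser_mult_inverse: "E_ser r * fps_right_inverse (E_ser r) 1 = 1"
  by (rule fps_right_inverse) (simp add: E_ser_def fps_sum_nth)

section \<open>The isomorphism \<open>\<phi>\<^sub>r\<close>\<close>

definition partitions :: "nat \<Rightarrow> nat list set"
  where "partitions r = {l. length l = r \<and> sorted_wrt (\<ge>) l}"

text \<open>Here \<open>i, j\<close> run from \<open>0\<close> to \<open>r - 1\<close>, and \<open>\<lambda>\<^sub>j\<close> is \<open>\<lambda> ! (j - 1)\<close>.\<close>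

definition Delta :: "nat \<Rightarrow> nat list \<Rightarrow> B"
  where "Delta r l = det (mat r r (\<lambda>(i, j). hcoef r (int (l ! j) - int j + int i)))"

definition b_lambda :: "nat \<Rightarrow> nat list \<Rightarrow> ext"
  where "b_lambda r l = wedge (map (\<lambda>k. bvec (k + l ! (r - 1 - k))) [0..<r])"

text \<open>The linear map with \<open>\<Delta>\<^sub>\<lambda>(H\<^sub>r) \<mapsto> [b]\<^sup>r\<^sub>\<lambda>\<close>; only its values on \<^term>\<open>Br r\<close>, the span of the
  independent family \<open>\<Delta>\<^sub>\<lambda>(H\<^sub>r)\<close>, matter.\<close>

definition phi :: "nat \<Rightarrow> B \<Rightarrow> ext"
  where "phi r = Q.construct (Delta r ` partitions r)
    (\<lambda>d. b_lambda r (the_inv_into (partitions r) (Delta r) d))"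

section \<open>Vertex operators\<close>

text \<open>With \<open>w = z\<^sup>-\<^sup>1\<close>, the operator \<open>\<Sum>\<^bsub>i\<ge>1\<^esub> (w\<^sup>i / i) \<partial>/\<partial>x\<^sub>i\<close> on \<open>B[[w]]\<close>\<close>

definition dop :: "B fps \<Rightarrow> B fps"
  where "dop f = Abs_fps (\<lambda>k. \<Sum>i=1..k. qconst (1 / of_nat i) * pdiff i (fps_nth f (k - i)))"

text \<open>\<open>exp(L) f = \<Sum>\<^sub>n L\<^sup>n f / n!\<close> for an operator \<open>L\<close> which raises the order in \<open>w\<close>, so that
  only \<open>n \<le> k\<close> contributes to the coefficient of \<open>w\<^sup>k\<close>\<close>

definition exp_op :: "(B fps \<Rightarrow> B fps) \<Rightarrow> B fps \<Rightarrow> B fps"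
  where "exp_op L f = Abs_fps (\<lambda>k. \<Sum>n\<le>k. qconst (1 / fact n) * fps_nth ((L ^^ n) f) k)"

text \<open>\<open>\<Sum>\<^sub>k d\<^sub>k w\<^sup>k \<mapsto> \<Sum>\<^sub>k d\<^sub>k z\<^sup>-\<^sup>k\<close> for a polynomial \<open>\<Sum>\<^sub>k d\<^sub>k w\<^sup>k\<close>\<close>

definition at_inverse_z :: "B fps \<Rightarrow> B fls"
  where "at_inverse_z d = (\<Sum>k | fps_nth d k \<noteq> 0. fls_const (fps_nth d k) * fls_X_intpow (- int k))"

lemma exp_op_dop_terms:
  assumes "L = dop \<or> L = (\<lambda>f. - dop f)" "k < n"
  shows "fps_nth ((L ^^ n) f) k = 0"
proof -
  have L: "fps_nth (L f) k = 0" if "\<And>j. j < k \<Longrightarrow> fps_nth f j = 0" for f k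
  proof -
    have "pdiff i 0 = 0" for i by (simp add: pdiff_def)
    then show ?thesis using assms(1) that by (auto simp: dop_def intro!: sum.neutral)
  qed
  show ?thesis
    using assms(2) by (induction n arbitrary: k) (auto intro!: L)
qed

text \<open>Each \<open>\<partial>/\<partial>x\<^sub>i\<close> lowers the weighted degree (\<open>x\<^sub>i\<close> having degree \<open>i\<close>) by \<open>i\<close>, so the sums in
  \<^const>\<open>at_inverse_z\<close> are finite.\<close>

lemma finite_exp_op_dop:
  assumes "L = dop \<or> L = (\<lambda>f. - dop f)"
  shows "finite {k. fps_nth (exp_op L (fps_const \<tau>)) k \<noteq> 0}"
proof -
  define wt :: "mono \<Rightarrow> nat" where
    "wt m = (\<Sum>i\<in>Poly_Mapping.keys m. Suc i * Poly_Mapping.lookup m i)" for m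
  have wt: "wt m = (\<Sum>i\<in>A. Suc i * Poly_Mapping.lookup m i)"
    if "finite A" "Poly_Mapping.keys m \<subseteq> A" for m A
    unfolding wt_def using that by (intro sum.mono_neutral_left) (auto simp: in_keys_iff)
  have wt_minus: "wt (m - Poly_Mapping.single j 1) + Suc j = wt m"
    if "Poly_Mapping.lookup m j \<noteq> 0" for m j
  proof -
    let ?A = "Poly_Mapping.keys m" and ?m = "m - Poly_Mapping.single j 1"
    have j: "j \<in> ?A" using that by (simp add: in_keys_iff)
    have "Poly_Mapping.keys ?m \<subseteq> ?A" by (auto simp: in_keys_iff lookup_minus)
    then have "wt ?m = (\<Sum>i\<in>?A. Suc i * Poly_Mapping.lookup ?m i)"
      by (intro wt) auto
    also have "\<dots> = Suc j * (Poly_Mapping.lookup m j - 1)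
        + (\<Sum>i\<in>?A - {j}. Suc i * Poly_Mapping.lookup m i)"
      using j by (subst sum.remove[OF _ j]) (auto simp: lookup_minus lookup_single when_def intro!: sum.cong)
    finally have "wt ?m = \<dots>" .
    moreover have "wt m = Suc j * Poly_Mapping.lookup m j
        + (\<Sum>i\<in>?A - {j}. Suc i * Poly_Mapping.lookup m i)"
      unfolding wt_def using j by (subst sum.remove[OF _ j]) auto
    moreover have "Suc j * (Poly_Mapping.lookup m j - 1) + Suc j = Suc j * Poly_Mapping.lookup m j"
      using that by (cases "Poly_Mapping.lookup m j") auto
    ultimately show ?thesis by linarith
  qed
  define d where "d = (\<Sum>m\<in>Poly_Mapping.keys \<tau>. wt m)"
  define P where "P k p \<longleftrightarrow> (\<forall>m\<in>Poly_Mapping.keys p. wt m + k \<le> d)" for k and p :: B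
  have P_sum: "P k (sum f A)" if "\<And>a. a \<in> A \<Longrightarrow> P k (f a)" for k and f :: "'z \<Rightarrow> B" and A
    using that
  proof (induction A rule: infinite_finite_induct)
    case (insert a A)
    then show ?case using Poly_Mapping.keys_add[of "f a" "sum f A"] by (auto simp: P_def)
  qed (auto simp: P_def)
  have P_const: "P k (qconst c * p)" if "P k p" for k c p
    unfolding P_def
  proof
    fix m assume "m \<in> Poly_Mapping.keys (qconst c * p)"
    then obtain a m' where "a \<in> Poly_Mapping.keys (qconst c)" "m' \<in> Poly_Mapping.keys p" "m = a + m'"
      using Poly_Mapping.keys_mult[of "qconst c" p] by blast
    then have "m \<in> Poly_Mapping.keys p" by (simp add: qconst_def split: if_splits)
    with that show "wt m + k \<le> d" by (simp add: P_def)
  qed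
  have P_pdiff: "P k (pdiff i p)" if "1 \<le> i" "i \<le> k" "P (k - i) p" for i k p
    unfolding pdiff_def
  proof (rule P_sum)
    fix m assume m: "m \<in> Poly_Mapping.keys p"
    show "P k (Poly_Mapping.single (m - Poly_Mapping.single (i - 1) 1)
      (of_nat (Poly_Mapping.lookup m (i - 1)) * Poly_Mapping.lookup p m))"
    proof (cases "Poly_Mapping.lookup m (i - 1) = 0")
      case False
      from that(3) m have "wt m + (k - i) \<le> d" by (simp add: P_def)
      with wt_minus[OF False] that(1,2) have "wt (m - Poly_Mapping.single (i - 1) 1) + k \<le> d"
        by linarith
      then show ?thesis by (simp add: P_def)
    qed (simp add: P_def)
  qed
  have P_L: "P k (fps_nth (L f) k)" if "\<And>k. P k (fps_nth f k)" for f k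
  proof -
    have "P k (fps_nth (dop f) k)"
      unfolding dop_def using that by (auto intro!: P_sum P_const P_pdiff)
    then show ?thesis using assms by (auto simp: P_def)
  qed
  have "P k (fps_nth (fps_const \<tau>) k)" for k
    by (cases k) (auto simp: P_def d_def intro!: member_le_sum)
  then have "P k (fps_nth ((L ^^ n) (fps_const \<tau>)) k)" for n k
    by (induction n arbitrary: k) (auto intro: P_L)
  then have P_exp: "P k (fps_nth (exp_op L (fps_const \<tau>)) k)" for k
    by (auto simp: exp_op_def intro!: P_sum P_const)
  have "fps_nth (exp_op L (fps_const \<tau>)) k = 0" if "k > d" for k
  proof -
    have "Poly_Mapping.keys (fps_nth (exp_op L (fps_const \<tau>)) k) = {}"
      using that P_exp[of k] by (force simp: P_def)
    then show ?thesis by simp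
  qed
  then have "{k. fps_nth (exp_op L (fps_const \<tau>)) k \<noteq> 0} \<subseteq> {..d}"
    by (auto simp flip: linorder_not_less)
  then show ?thesis by (rule finite_subset) simp
qed

definition Gamma :: "B \<Rightarrow> B fls"
  where "Gamma \<tau> = fps_to_fls (exp_series xseries)
    * at_inverse_z (exp_op (\<lambda>f. - dop f) (fps_const \<tau>))"

definition Gamma_star :: "B \<Rightarrow> B fls"
  where "Gamma_star \<tau> = fps_to_fls (exp_series (- xseries))
    * at_inverse_z (exp_op dop (fps_const \<tau>))"

definition tensor_fls :: "B fls \<Rightarrow> B fls \<Rightarrow> (mono \<times> mono \<Rightarrow>\<^sub>0 rat) fls"  (infixl \<open>\<otimes>\<^sub>z\<close> 70)
  where "F \<otimes>\<^sub>z G = Abs_fls (\<lambda>n. \<Sum>i = fls_subdegree F .. n - fls_subdegree G.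
    fls_nth F i \<otimes>\<^sub>Q fls_nth G (n - i))"

lemma tensor_fls_nth:
  "fls_nth (F \<otimes>\<^sub>z G) n = (\<Sum>i = fls_subdegree F .. n - fls_subdegree G.
    fls_nth F i \<otimes>\<^sub>Q fls_nth G (n - i))"
  unfolding tensor_fls_def
  by (rule nth_Abs_fls_lower_bound[of "fls_subdegree F + fls_subdegree G"]) auto

end

theory Submission
  imports Defs
begin

text \<open>Write \<open>h\<^sub>n\<close> for the coefficients of \<open>exp (\<Sum> x\<^sub>i t\<^sup>i)\<close> and send the basis vector
  \<open>b\<^bsub>a\<^sub>r\<^esub> \<and> \<dots> \<and> b\<^bsub>a\<^sub>1\<^esub>\<close>, \<open>a\<^sub>1 > \<dots> > a\<^sub>r\<close>, of the \<open>r\<close>-th exterior power to the determinant with the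
  columns \<open>(h\<^bsub>a-r+1\<^esub>, \<dots>, h\<^sub>a)\<close>, \<open>a = a\<^sub>1, \<dots>, a\<^sub>r\<close>. Row operations show that for
  every \<open>r \<ge> 1\<close> the coefficients of \<open>\<Gamma>(z)\<close> become, up to sign, the multiplications \<open>b\<^sub>j \<and> _\<close>, and those of \<open>\<Gamma>\<^sup>*(z)\<close> the contractions with the dual basis vectors, up to terms
  of so high an order in \<open>z\<close> that they do not contribute to the residue. As this map is injective, the KP
  equation for the image of \<open>w\<close> is the system of quadratic relations \<open>\<Sum>\<^sub>j \<partial>\<^sub>j w \<otimes> (b\<^sub>j \<and> w) = 0\<close>, which
  characterises the decomposable \<open>w\<close>. Finally, every \<open>\<tau>\<close> lies in the image for all large \<open>r\<close>, and if moreover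
  \<open>\<tau> \<in> B\<^sub>r\<close>, then setting \<open>e\<^sub>i = 0\<close> for \<open>i > r\<close> identifies its preimage with \<open>\<phi>\<^sub>r(\<tau>)\<close>.\<close>

section \<open>Alternating forms\<close>

text \<open>Two series are in play: the vertex operators know only \<open>Hser\<close>, while
  \<open>Delta\<close> and \<open>phi\<close> are built from the truncated series
  \<open>Hfin r\<close>. The map \<open>bos\<close> therefore takes the series as a parameter. Its
  injectivity is proved for \<open>Hfin r\<close> by induction on r: the specialisation E_(q+1) ->
  E_q (1 - t/z) turns the image of w into a Laurent series whose coefficients, after multiplication
  by E_q, are the images of all contractions of w. This is the computation that also handles
  \<open>Gamma_star\<close>. The linear independence of the \<open>Delta r l\<close> then comes for
  free. The differential factors of the vertex operators are ring homomorphisms, so only their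
  effect on the series H has to be known. Identities between exponential series are checked on
  logarithmic derivatives t d/dt. The union of the images over all r is not visibly a ring; it is
  shown to be stable under multiplication by each h_n, hence by each x_n, and this is enough to
  reach every polynomial from 1.\<close>

text \<open>With the indices in decreasing order this is (-1) to the position of j, counted from 0:
  the sign of column j in an expansion along the first row.\<close>

definition sgn_above :: "nat \<Rightarrow> nat set \<Rightarrow> 'r::comm_ring_1"
  where "sgn_above j S = (-1) ^ card {s\<in>S. j < s}"

lemma sgn_above_square [simp]: "sgn_above j S * sgn_above j S = 1"
  by (simp add: sgn_above_def flip: power_mult_distrib)

lemma sgn_above_insert:
  assumes "finite S" "k \<notin> S"
  shows "sgn_above j (insert k S) = (if j < k then - sgn_above j S else sgn_above j S)"
proof -
  have "{s \<in> insert k S. j < s} = (if j < k then insert k {s\<in>S. j < s} else {s\<in>S. j < s})"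
    by auto
  then show ?thesis using assms by (simp add: sgn_above_def)
qed

lemma sgn_above_remove [simp]: "sgn_above j (S - {j}) = sgn_above j S"
  unfolding sgn_above_def by (rule arg_cong[of _ _ "\<lambda>A. (-1) ^ card A"]) auto

lemma sgn_above_remove2:
  assumes "finite S" "k \<in> S"
  shows "sgn_above j (S - {k}) = (if j < k then - sgn_above j S else sgn_above j S)"
  using sgn_above_insert[of "S - {k}" k j, where 'a = 'a] assms by (simp add: insert_absorb)

text \<open>Exactly one of j and k lies above the other, so removing the two in the opposite order
  changes exactly one of the signs.\<close>

lemma sgn_above_swap:
  assumes "finite S" "j \<in> S" "k \<in> S" "j \<noteq> k"
  shows "sgn_above j S * sgn_above k (S - {j}) = - (sgn_above k S * sgn_above j (S - {k}))"
  using assms by (auto simp: sgn_above_remove2)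

lemma sum_offdiag_swap:
  fixes t :: "'a \<Rightarrow> 'a \<Rightarrow> 'b::comm_monoid_add"
  assumes "finite S"
  shows "(\<Sum>j\<in>S. \<Sum>k\<in>S - {j}. t j k) = (\<Sum>k\<in>S. \<Sum>j\<in>S - {k}. t j k)"
proof -
  have "(\<Sum>j\<in>S. \<Sum>k\<in>S - {j}. t j k) = (\<Sum>j\<in>S. \<Sum>k\<in>S. if k = j then 0 else t j k)"
    using assms by (intro sum.cong refl sum.mono_neutral_cong_left) auto
  also have "\<dots> = (\<Sum>k\<in>S. \<Sum>j\<in>S. if k = j then 0 else t j k)"
    by (rule sum.swap)
  also have "\<dots> = (\<Sum>k\<in>S. \<Sum>j\<in>S - {k}. t j k)"
    using assms by (intro sum.cong refl sum.mono_neutral_cong_right) auto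
  finally show ?thesis .
qed

text \<open>The group may have 2-torsion, so it would not suffice that the sum equals its own
  negative; the terms at (j, k) and (k, j) are cancelled directly as S grows.\<close>

lemma sum_antisym_zero:
  fixes t :: "nat \<Rightarrow> nat \<Rightarrow> 'b::ab_group_add"
  assumes "finite S" "\<And>j k. j \<in> S \<Longrightarrow> k \<in> S \<Longrightarrow> j \<noteq> k \<Longrightarrow> t j k = - t k j"
  shows "(\<Sum>j\<in>S. \<Sum>k\<in>S - {j}. t j k) = 0"
  using assms(1,2)
proof (induction S)
  case (insert x S)
  note fin = insert.hyps and anti = insert.prems
  have "(\<Sum>k\<in>insert x S - {j}. t j k) = t j x + (\<Sum>k\<in>S - {j}. t j k)" if "j \<in> S" for j
  proof -
    have "insert x S - {j} = insert x (S - {j})" using fin that by auto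
    then show ?thesis using fin by simp
  qed
  moreover have "insert x S - {x} = S" using fin by auto
  moreover have "t x k + t k x = 0" if "k \<in> S" for k
    using anti[of x k] fin that by force
  then have "(\<Sum>k\<in>S. t x k) + (\<Sum>j\<in>S. t j x) = 0"
    by (simp flip: sum.distrib)
  moreover have "(\<Sum>j\<in>S. \<Sum>k\<in>S - {j}. t j k) = 0"
    by (rule insert.IH, rule anti) auto
  ultimately show ?case using fin by (simp add: sum.distrib flip: add.assoc)
qed simp

text \<open>\<open>altform [f\<^sub>1, \<dots>, f\<^sub>r] {a\<^sub>1 > \<dots> > a\<^sub>r}\<close> is the determinant of \<open>(f\<^sub>i(a\<^sub>j))\<close>, expanded along its
  first row.\<close>

fun altform :: "(nat \<Rightarrow> 'r) list \<Rightarrow> nat set \<Rightarrow> 'r::comm_ring_1" where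
  "altform [] S = (if S = {} then 1 else 0)"
| "altform (f # fs) S = (\<Sum>j\<in>S. sgn_above j S * f j * altform fs (S - {j}))"

lemma altform_swap:
  assumes "finite S"
  shows "altform (f # g # fs) S = - altform (g # f # fs) S"
proof -
  have expand: "altform (f # g # fs) S
      = (\<Sum>j\<in>S. \<Sum>k\<in>S - {j}. (sgn_above j S * sgn_above k (S - {j})) * (f j * g k * altform fs (S - {j} - {k})))" for f g
    by (simp add: sum_distrib_left mult_ac)
  have "altform (f # g # fs) S
      = (\<Sum>k\<in>S. \<Sum>j\<in>S - {k}. (sgn_above j S * sgn_above k (S - {j})) * (f j * g k * altform fs (S - {j} - {k})))"
    unfolding expand by (rule sum_offdiag_swap[OF assms])
  also have "\<dots> = (\<Sum>k\<in>S. \<Sum>j\<in>S - {k}. - ((sgn_above k S * sgn_above j (S - {k})) * (g k * f j * altform fs (S - {k} - {j}))))"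
    by (intro sum.cong refl, subst sgn_above_swap)
       (use assms in \<open>auto simp: Diff_insert2[symmetric] insert_commute mult_ac\<close>)
  also have "\<dots> = - altform (g # f # fs) S"
    unfolding expand by (simp add: sum_negf)
  finally show ?thesis .
qed

lemma altform_alternating:
  assumes "finite S"
  shows "altform (f # f # fs) S = 0"
proof -
  have expand: "altform (f # f # fs) S
      = (\<Sum>j\<in>S. \<Sum>k\<in>S - {j}. (sgn_above j S * sgn_above k (S - {j})) * (f j * f k * altform fs (S - {j} - {k})))"
    by (simp add: sum_distrib_left mult_ac)
  show ?thesis unfolding expand
    by (rule sum_antisym_zero[OF assms], subst sgn_above_swap)
       (use assms in \<open>auto simp: Diff_insert2[symmetric] insert_commute mult_ac\<close>)
qed

lemma altform_tail_cong:
  assumes "\<And>j. j \<in> S \<Longrightarrow> altform fs (S - {j}) = altform gs (S - {j})"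
  shows "altform (f # fs) S = altform (f # gs) S"
  using assms by simp

lemma altform_repeated:
  assumes "finite S" "f \<in> set fs"
  shows "altform (f # fs) S = 0"
  using assms
proof (induction fs arbitrary: S)
  case (Cons g fs)
  show ?case
  proof (cases "f = g")
    case False
    then have "altform (f # fs) (S - {j}) = 0" for j using Cons by simp
    then have "altform (g # f # fs) S = 0" by (subst altform.simps(2)) (simp del: altform.simps(2))
    then show ?thesis using altform_swap[OF Cons.prems(1), of f g fs] by simp
  qed (use Cons.prems altform_alternating in auto)
qed simp

lemma altform_diff_head: "altform ((\<lambda>a. f a - g a) # fs) S = altform (f # fs) S - altform (g # fs) S"
  by (simp add: algebra_simps sum_subtractf)

lemma altform_scale_head: "altform ((\<lambda>a. c * f a) # fs) S = c * altform (f # fs) S"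
  by (simp add: algebra_simps sum_distrib_left)

lemma altform_sum_head: "altform ((\<lambda>a. \<Sum>i\<in>I. f i a) # fs) S = (\<Sum>i\<in>I. altform (f i # fs) S)"
  by (simp add: sum_distrib_left sum_distrib_right, subst sum.swap, rule refl)

lemma altform_cong:
  assumes "list_all2 (\<lambda>f g. \<forall>a\<in>S. f a = g a) fs gs"
  shows "altform fs S = altform gs S"
  using assms
proof (induction fs arbitrary: gs S)
  case (Cons f fs)
  then obtain g gs' where gs: "gs = g # gs'" "\<forall>a\<in>S. f a = g a"
      "list_all2 (\<lambda>f g. \<forall>a\<in>S. f a = g a) fs gs'"
    by (auto simp: list_all2_Cons1)
  have "altform fs (S - {j}) = altform gs' (S - {j})" for j
    using gs(3) by (intro Cons.IH) (auto elim!: list_all2_mono)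
  then show ?case using gs(1,2) by simp
qed simp

text \<open>Each row loses c times the original row above it, not the already modified one; f is the
  row in front of the list.\<close>

fun rowop :: "'r::comm_ring_1 \<Rightarrow> (nat \<Rightarrow> 'r) \<Rightarrow> (nat \<Rightarrow> 'r) list \<Rightarrow> (nat \<Rightarrow> 'r) list" where
  "rowop c f [] = []"
| "rowop c f (g # gs) = (\<lambda>a. g a - c * f a) # rowop c g gs"

text \<open>The top pair f, g is treated while the rows below still carry their changes; the
  induction then undoes these with g as the leading row, after f has been split off by expansion
  along it.\<close>

lemma altform_rowop:
  assumes "finite S"
  shows "altform (f # rowop c f fs) S = altform (f # fs) S"
  using assms
proof (induction fs arbitrary: f S)
  case (Cons g gs)
  have "altform (f # rowop c f (g # gs)) S = - altform ((\<lambda>a. g a - c * f a) # f # rowop c g gs) S"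
    unfolding rowop.simps by (rule altform_swap) fact
  also have "\<dots> = - altform (g # f # rowop c g gs) S + c * altform (f # f # rowop c g gs) S"
    unfolding altform_diff_head altform_scale_head by simp
  also have "\<dots> = altform (f # g # rowop c g gs) S"
    unfolding altform_alternating[OF Cons.prems] altform_swap[OF Cons.prems, of g] by simp
  also have "\<dots> = altform (f # g # gs) S"
    by (rule altform_tail_cong, rule Cons.IH) (use Cons.prems in simp)
  finally show ?case .
qed simp

lemma altform_zero_column:
  assumes "finite S" "j \<in> S" "\<And>f. f \<in> set fs \<Longrightarrow> f j = 0"
  shows "altform fs S = 0"
  using assms
proof (induction fs arbitrary: S)
  case (Cons f fs)
  have "sgn_above k S * f k * altform fs (S - {k}) = 0" if "k \<in> S" for k
    using Cons.IH[of "S - {k}"] Cons.prems by (cases "k = j") fastforce+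
  then show ?case by simp
qed auto

text \<open>\<open>colins u fs S\<close> is the determinant \<open>altform fs S\<close> with the column \<open>u\<close> put in front; it is
  expanded along the first row.\<close>

fun colins :: "'r list \<Rightarrow> (nat \<Rightarrow> 'r) list \<Rightarrow> nat set \<Rightarrow> 'r::comm_ring_1" where
  "colins (x # u) (f # fs) S = x * altform fs S - (\<Sum>k\<in>S. sgn_above k S * f k * colins u fs (S - {k}))"
| "colins _ _ S = 0"

lemma colins_zero: "(\<And>x. x \<in> set u \<Longrightarrow> x = 0) \<Longrightarrow> colins u fs S = 0"
proof (induction u fs S rule: colins.induct)
  case (1 x u f fs S)
  then have "x = 0" "colins u fs (S - {k}) = 0" if "k \<in> S" for k using that by auto
  moreover have "x = 0" using 1 by simp
  ultimately show ?case by simp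
qed simp_all

text \<open>A column already present gives two equal columns; a new one has to move past the larger
  indices to its place in the decreasing order.\<close>

lemma colins_column:
  assumes "finite S"
  shows "colins (map (\<lambda>f. f j) fs) fs S = (if j \<in> S then 0 else sgn_above j S * altform fs (insert j S))"
  using assms
proof (induction fs arbitrary: S)
  case (Cons f fs)
  let ?c = "\<lambda>k. sgn_above k S * f k * colins (map (\<lambda>f. f j) fs) fs (S - {k})"
  show ?case
  proof (cases "j \<in> S")
    case True
    have "?c k = 0" if "k \<in> S" "k \<noteq> j" for k using Cons that True by simp
    then have "(\<Sum>k\<in>S. ?c k) = (\<Sum>k\<in>{j}. ?c k)"
      using True Cons.prems by (intro sum.mono_neutral_right) auto
    also have "\<dots> = (sgn_above j S * sgn_above j S) * (f j * altform fs S)"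
      using True Cons by (simp add: insert_absorb mult_ac)
    finally show ?thesis using True by simp
  next
    case False
    have "?c k = - (sgn_above j S * (sgn_above k (insert j S) * f k * altform fs (insert j S - {k})))" if "k \<in> S" for k
    proof -
      have "insert j (S - {k}) = insert j S - {k}" using that False by auto
      moreover have "k \<noteq> j" using that False by auto
      ultimately show ?thesis
        using Cons that False by (auto simp: sgn_above_insert sgn_above_remove2)
    qed
    then have "(\<Sum>k\<in>S. ?c k) = - (sgn_above j S * (\<Sum>k\<in>S. sgn_above k (insert j S) * f k * altform fs (insert j S - {k})))"
      by (simp add: sum_negf sum_distrib_left)
    moreover have "insert j S - {j} = S" "(\<Sum>k\<in>insert j S. sgn_above k (insert j S) * f k * altform fs (insert j S - {k}))
      = sgn_above j S * f j * altform fs S + (\<Sum>k\<in>S. sgn_above k (insert j S) * f k * altform fs (insert j S - {k}))"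
      using False Cons.prems by (auto simp: sgn_above_insert)
    ultimately show ?thesis using False
      by (simp add: distrib_left mult.assoc[symmetric])
  qed
qed simp

text \<open>The product rule, applied column by column. Columns are preferred to rows because the
  derivative by x_i will turn the column k into the column k - i. In \<open>colins\<close> the
  differentiated column stands in front, whence the sign.\<close>

lemma altform_derivation:
  fixes \<delta> :: "'r::comm_ring_1 \<Rightarrow> 'r"
  assumes add: "\<And>a b. \<delta> (a + b) = \<delta> a + \<delta> b" and leibniz: "\<And>a b. \<delta> (a * b) = \<delta> a * b + a * \<delta> b"
    and "finite S"
  shows "\<delta> (altform fs S) = (\<Sum>k\<in>S. sgn_above k S * colins (map (\<lambda>f. \<delta> (f k)) fs) fs (S - {k}))"
proof -
  have zero: "\<delta> 0 = 0" using add[of 0 0] by simp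
  have one: "\<delta> 1 = 0" using leibniz[of 1 1] by simp
  have neg: "\<delta> (- a) = - \<delta> a" for a using add[of a "- a"] by (simp add: zero eq_neg_iff_add_eq_0 add.commute)
  have sum: "\<delta> (sum f A) = (\<Sum>a\<in>A. \<delta> (f a))" for f and A :: "nat set"
    by (induction A rule: infinite_finite_induct) (auto simp: zero add)
  have sgn: "\<delta> (sgn_above j T * a) = sgn_above j T * \<delta> a" for j T a
    by (cases "even (card {s\<in>T. j < s})") (auto simp: sgn_above_def neg)
  have mono: "\<delta> (sgn_above j T * a * b) = sgn_above j T * (\<delta> a * b) + sgn_above j T * (a * \<delta> b)" for j T a b
    using sgn[of j T "a * b"] by (simp add: leibniz[of a b] distrib_left mult.assoc)
  show ?thesis using assms(3)
  proof (induction fs arbitrary: S)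
    case Nil
    then show ?case by (simp add: zero one)
  next
    case (Cons f fs)
    let ?u = "\<lambda>k. map (\<lambda>f. \<delta> (f k)) fs"
    have "\<delta> (altform (f # fs) S) = (\<Sum>j\<in>S. sgn_above j S * (\<delta> (f j) * altform fs (S - {j})))
        + (\<Sum>j\<in>S. sgn_above j S * (f j * \<delta> (altform fs (S - {j}))))"
      by (simp only: altform.simps sum mono sum.distrib)
    also have "(\<Sum>j\<in>S. sgn_above j S * (f j * \<delta> (altform fs (S - {j}))))
      = (\<Sum>j\<in>S. \<Sum>k\<in>S - {j}. (sgn_above j S * sgn_above k (S - {j})) * (f j * colins (?u k) fs (S - {j} - {k})))"
      using Cons by (simp add: sum_distrib_left mult_ac)
    also have "\<dots> = (\<Sum>k\<in>S. \<Sum>j\<in>S - {k}. (sgn_above j S * sgn_above k (S - {j})) * (f j * colins (?u k) fs (S - {j} - {k})))"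
      by (rule sum_offdiag_swap[OF Cons.prems])
    also have "\<dots> = (\<Sum>k\<in>S. sgn_above k S * - (\<Sum>j\<in>S - {k}. sgn_above j (S - {k}) * f j * colins (?u k) fs (S - {k} - {j})))"
      unfolding sum_distrib_left sum_negf[symmetric]
      by (intro sum.cong refl, subst sgn_above_swap)
         (use Cons.prems in \<open>auto simp: Diff_insert2[symmetric] insert_commute mult_ac\<close>)
    finally show ?case by (simp add: right_diff_distrib sum_subtractf sum_negf mult.assoc)
  qed
qed

section \<open>The Pluecker relations\<close>

text \<open>The sign convention of \<open>bwedge\<close>, whose factors are sorted increasingly. It
  differs from \<open>sgn_above\<close> by a sign that depends only on the number of the other
  indices.\<close>

definition sgn_below :: "nat \<Rightarrow> nat set \<Rightarrow> 'r::comm_ring_1"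
  where "sgn_below j S = (-1) ^ card {s\<in>S. s < j}"

lemma sgn_below_insert:
  assumes "finite S" "k \<notin> S"
  shows "sgn_below j (insert k S) = (if k < j then - sgn_below j S else sgn_below j S)"
proof -
  have "{s \<in> insert k S. s < j} = (if k < j then insert k {s\<in>S. s < j} else {s\<in>S. s < j})"
    by auto
  then show ?thesis using assms by (simp add: sgn_below_def)
qed

lemma sgn_below_remove [simp]: "sgn_below j (S - {j}) = sgn_below j S"
  unfolding sgn_below_def by (rule arg_cong[of _ _ "\<lambda>A. (-1) ^ card A"]) auto

lemma sgn_above_below:
  assumes "finite S"
  shows "sgn_above j S * sgn_below j S = (-1) ^ card (S - {j})"
proof -
  have "S - {j} = {s\<in>S. j < s} \<union> {s\<in>S. s < j}" by auto
  moreover have "card ({s\<in>S. j < s} \<union> {s\<in>S. s < j}) = card {s\<in>S. j < s} + card {s\<in>S. s < j}"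
    using assms by (intro card_Un_disjoint) auto
  ultimately have "card (S - {j}) = card {s\<in>S. j < s} + card {s\<in>S. s < j}" by simp
  then show ?thesis by (simp add: sgn_above_def sgn_below_def power_add)
qed

lemma sgn_above_conv_below:
  assumes "finite S"
  shows "sgn_above j S = (-1) ^ card (S - {j}) * sgn_below j S"
proof -
  have "sgn_below j S * sgn_below j S = (1 :: 'a)"
    by (simp add: sgn_below_def flip: power_mult_distrib)
  then show ?thesis
    unfolding sgn_above_below[OF assms, of j, symmetric] by (simp add: mult.assoc)
qed

lemma lookup_linext:
  "Poly_Mapping.lookup (linext qscale g p) b = (\<Sum>a\<in>Poly_Mapping.keys p. Poly_Mapping.lookup p a * Poly_Mapping.lookup (g a) b)"
  by (simp add: linext_def lookup_sum)

lemma lookup_bwedge: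
  "Poly_Mapping.lookup (bwedge i S) U = (if i |\<in>| U \<and> S = U |-| {|i|} then sgn_below i (fset U) else 0)"
proof (cases "i |\<in>| S")
  case False
  have "finsert i S = U \<longleftrightarrow> i |\<in>| U \<and> S = U |-| {|i|}" using False by auto
  moreover have "fcard (ffilter (\<lambda>s. s < i) S) = card {s\<in>fset U. s < i}" if "finsert i S = U"
    unfolding that[symmetric] fcard.rep_eq by (rule arg_cong[of _ _ card]) auto
  ultimately show ?thesis
    using False by (auto simp: bwedge_def lookup_single when_def sgn_below_def)
qed (auto simp: bwedge_def)

lemma lookup_wedge1:
  "Poly_Mapping.lookup (wedge1 v w) U = (\<Sum>i\<in>fset U. sgn_below i (fset U) * Poly_Mapping.lookup v i * Poly_Mapping.lookup w (U |-| {|i|}))"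
proof -
  have "Poly_Mapping.lookup (linext qscale (bwedge i) w) U
      = (if i |\<in>| U then sgn_below i (fset U) * Poly_Mapping.lookup w (U |-| {|i|}) else 0)" for i
  proof -
    have "Poly_Mapping.lookup (linext qscale (bwedge i) w) U
        = (\<Sum>S\<in>Poly_Mapping.keys w. if S = U |-| {|i|} then (if i |\<in>| U then Poly_Mapping.lookup w S * sgn_below i (fset U) else 0) else 0)"
      unfolding lookup_linext by (intro sum.cong refl) (auto simp: lookup_bwedge)
    then show ?thesis by (auto simp: in_keys_iff)
  qed
  then have "Poly_Mapping.lookup (wedge1 v w) U
      = (\<Sum>i\<in>Poly_Mapping.keys v. if i |\<in>| U then sgn_below i (fset U) * Poly_Mapping.lookup v i * Poly_Mapping.lookup w (U |-| {|i|}) else 0)"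
    unfolding wedge1_def lookup_linext by (intro sum.cong refl) simp
  also have "\<dots> = (\<Sum>i\<in>Poly_Mapping.keys v \<inter> fset U. sgn_below i (fset U) * Poly_Mapping.lookup v i * Poly_Mapping.lookup w (U |-| {|i|}))"
    by (simp add: sum.inter_restrict)
  also have "\<dots> = (\<Sum>i\<in>fset U. sgn_below i (fset U) * Poly_Mapping.lookup v i * Poly_Mapping.lookup w (U |-| {|i|}))"
    by (intro sum.mono_neutral_left) (auto simp: in_keys_iff)
  finally show ?thesis .
qed

section \<open>Exterior multiplication and contraction\<close>

text \<open>Multiplication by b_j from the right, w \<and> b_j; \<open>contr j\<close> is the
  contraction from the right. Working from the right produces \<open>sgn_above\<close>, the sign of
  the determinantal expansions.\<close>

definition ins :: "nat \<Rightarrow> ext \<Rightarrow> ext"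
  where "ins j = linext qscale (\<lambda>S. if j |\<in>| S then 0 else Poly_Mapping.single (finsert j S) (sgn_above j (fset S)))"

definition contr :: "nat \<Rightarrow> ext \<Rightarrow> ext"
  where "contr j = linext qscale (\<lambda>S. if j |\<in>| S then Poly_Mapping.single (S |-| {|j|}) (sgn_above j (fset S)) else 0)"

lemma lookup_ins:
  "Poly_Mapping.lookup (ins j w) U = (if j |\<in>| U then sgn_above j (fset U) * Poly_Mapping.lookup w (U |-| {|j|}) else 0)"
proof -
  have "Poly_Mapping.lookup (if j |\<in>| S then 0 else Poly_Mapping.single (finsert j S) (sgn_above j (fset S))) U
      = (if S = U |-| {|j|} then if j |\<in>| U then sgn_above j (fset U) else 0 else (0 :: rat))" for S
  proof -
    have "finsert j S = U \<longleftrightarrow> j |\<in>| U \<and> S = U |-| {|j|}" if "j |\<notin>| S" using that by auto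
    then show ?thesis by (auto simp: lookup_single when_def)
  qed
  then have "Poly_Mapping.lookup (ins j w) U = (\<Sum>S\<in>Poly_Mapping.keys w. if S = U |-| {|j|} then
      Poly_Mapping.lookup w S * (if j |\<in>| U then sgn_above j (fset U) else 0) else 0)"
    unfolding ins_def lookup_linext by (intro sum.cong refl) simp
  then show ?thesis by (auto simp: in_keys_iff)
qed

lemma lookup_contr:
  "Poly_Mapping.lookup (contr j w) T = (if j |\<in>| T then 0 else sgn_above j (fset T) * Poly_Mapping.lookup w (finsert j T))"
proof -
  have "Poly_Mapping.lookup (if j |\<in>| S then Poly_Mapping.single (S |-| {|j|}) (sgn_above j (fset S)) else 0) T
      = (if S = finsert j T then if j |\<in>| T then 0 else sgn_above j (fset T) else (0 :: rat))" for S
  proof -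
    have "S |-| {|j|} = T \<longleftrightarrow> j |\<notin>| T \<and> S = finsert j T" if "j |\<in>| S" using that by auto
    then show ?thesis by (auto simp: lookup_single when_def sgn_above_insert)
  qed
  then have "Poly_Mapping.lookup (contr j w) T = (\<Sum>S\<in>Poly_Mapping.keys w. if S = finsert j T then
      Poly_Mapping.lookup w S * (if j |\<in>| T then 0 else sgn_above j (fset T)) else 0)"
    unfolding contr_def lookup_linext by (intro sum.cong refl) simp
  then show ?thesis by (auto simp: in_keys_iff)
qed

lemma fcard_fminus_single: "j |\<in>| S \<Longrightarrow> fcard (S |-| {|j|}) = fcard S - 1"
  by (simp add: fcard.rep_eq)

lemma ins_in_ext_power:
  assumes "w \<in> ext_power r"
  shows "ins j w \<in> ext_power (Suc r)"
  unfolding ins_def using assms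
  by (intro linext_in_ext_power) (auto simp: ext_power_def fcard_finsert_disjoint split: if_splits)

lemma contr_in_ext_power:
  assumes "w \<in> ext_power (Suc r)"
  shows "contr j w \<in> ext_power r"
  unfolding contr_def using assms
  by (intro linext_in_ext_power) (auto simp: ext_power_def fcard_fminus_single split: if_splits)

text \<open>Coefficientwise form of the vanishing of the sum over all j of \<open>contr j w\<close>
  tensor \<open>ins j w\<close>. For j outside U the second factor has coefficient 0 at U, so
  \<open>fset U\<close> is the full range of the sum.\<close>

definition plucker :: "ext \<Rightarrow> bool"
  where "plucker w \<longleftrightarrow> (\<forall>T U. (\<Sum>j\<in>fset U. Poly_Mapping.lookup (contr j w) T * Poly_Mapping.lookup (ins j w) U) = 0)"

text \<open>Contraction is an antiderivation. It acts from the right while m is multiplied from the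
  left, so only the term pairing b_j with m carries the degree sign. For j in T the left side is 0
  and the two terms on the right cancel.\<close>

lemma lookup_contr_wedge1:
  "Poly_Mapping.lookup (contr j (wedge1 m w)) T
    = (-1) ^ fcard T * Poly_Mapping.lookup m j * Poly_Mapping.lookup w T + Poly_Mapping.lookup (wedge1 m (contr j w)) T"
proof (cases "j |\<in>| T")
  case True
  have "Poly_Mapping.lookup (wedge1 m (contr j w)) T
      = (\<Sum>i\<in>{j}. sgn_below i (fset T) * Poly_Mapping.lookup m i * Poly_Mapping.lookup (contr j w) (T |-| {|i|}))"
    unfolding lookup_wedge1 using True by (intro sum.mono_neutral_right) (auto simp: lookup_contr)
  also have "\<dots> = (sgn_above j (fset T) * sgn_below j (fset T)) * Poly_Mapping.lookup m j * Poly_Mapping.lookup w T"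
    using True by (simp add: lookup_contr finsert_absorb)
  also have "\<dots> = - ((-1) ^ fcard T * Poly_Mapping.lookup m j * Poly_Mapping.lookup w T)"
  proof -
    have "fcard T = Suc (card (fset T - {j}))"
      unfolding fcard.rep_eq using True by (intro card.remove) auto
    then have "sgn_above j (fset T) * sgn_below j (fset T) = (- ((-1) ^ fcard T) :: rat)"
      by (simp only: sgn_above_below finite_fset power_Suc mult_minus1 minus_minus)
    then show ?thesis by simp
  qed
  finally show ?thesis using True by (simp add: lookup_contr)
next
  case False
  have eq: "sgn_above j (fset T) * (sgn_below i (insert j (fset T)) * Poly_Mapping.lookup m i * Poly_Mapping.lookup w (finsert j T |-| {|i|}))
      = sgn_below i (fset T) * Poly_Mapping.lookup m i * Poly_Mapping.lookup (contr j w) (T |-| {|i|})" if "i |\<in>| T" for i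
  proof -
    have "i \<noteq> j" using False that by auto
    moreover have "finsert j T |-| {|i|} = finsert j (T |-| {|i|})" using \<open>i \<noteq> j\<close> by auto
    ultimately show ?thesis using that False
      by (auto simp: lookup_contr sgn_below_insert sgn_above_remove2)
  qed
  have "Poly_Mapping.lookup (contr j (wedge1 m w)) T
      = sgn_above j (fset T) * (sgn_below j (fset T) * Poly_Mapping.lookup m j * Poly_Mapping.lookup w T)
        + (\<Sum>i\<in>fset T. sgn_above j (fset T) * (sgn_below i (insert j (fset T)) * Poly_Mapping.lookup m i * Poly_Mapping.lookup w (finsert j T |-| {|i|})))"
    using False by (simp add: lookup_contr lookup_wedge1 sgn_below_insert distrib_left sum_distrib_left)
  also have "(\<Sum>i\<in>fset T. sgn_above j (fset T) * (sgn_below i (insert j (fset T)) * Poly_Mapping.lookup m i * Poly_Mapping.lookup w (finsert j T |-| {|i|})))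
      = Poly_Mapping.lookup (wedge1 m (contr j w)) T"
    unfolding lookup_wedge1 by (intro sum.cong refl eq) simp
  also have "sgn_above j (fset T) * (sgn_below j (fset T) * Poly_Mapping.lookup m j * Poly_Mapping.lookup w T)
      = (-1) ^ fcard T * Poly_Mapping.lookup m j * Poly_Mapping.lookup w T"
  proof -
    have "sgn_above j (fset T) * sgn_below j (fset T) = ((-1) ^ fcard T :: rat)"
      using False by (simp add: sgn_above_below fcard.rep_eq)
    then show ?thesis by (simp flip: mult.assoc)
  qed
  finally show ?thesis .
qed

lemma wedge1_swap: "wedge1 u (wedge1 v w) = - wedge1 v (wedge1 u w)"
proof -
  have add: "wedge1 (u + v) x = wedge1 u x + wedge1 v x" for x
    using linear_wedge1_left[of x] by (simp add: Vector_Spaces.linear_iff)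
  have "0 = wedge1 (u + v) (wedge1 (u + v) w)" by (simp add: wedge1_self)
  also have "\<dots> = wedge1 u (wedge1 v w) + wedge1 v (wedge1 u w)"
    by (simp add: add wedge1_add_right wedge1_self)
  finally show ?thesis by (metis eq_neg_iff_add_eq_0)
qed

lemma wedge1_wedge_member: "m \<in> set ms \<Longrightarrow> wedge1 m (wedge ms) = 0"
  by (induction ms) (auto simp: wedge1_self wedge1_swap[of m])

text \<open>The c_j are the values on the b_j of a linear functional that vanishes on every factor;
  by the antiderivation rule the contraction with it passes through all the factors.\<close>

lemma contr_wedge_zero:
  assumes "finite J" "\<And>m. m \<in> set ms \<Longrightarrow> (\<Sum>j\<in>J. c j * Poly_Mapping.lookup m j) = 0"
  shows "(\<Sum>j\<in>J. c j * Poly_Mapping.lookup (contr j (wedge ms)) T) = 0"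
  using assms(2)
proof (induction ms arbitrary: T)
  case Nil
  have "finsert j T \<noteq> {||}" for j by simp
  then show ?case by (auto simp: lookup_contr lookup_single when_def intro!: sum.neutral)
next
  case (Cons m ms)
  have "(\<Sum>j\<in>J. c j * Poly_Mapping.lookup (contr j (wedge (m # ms))) T)
      = (-1) ^ fcard T * Poly_Mapping.lookup (wedge ms) T * (\<Sum>j\<in>J. c j * Poly_Mapping.lookup m j)
        + (\<Sum>i\<in>fset T. sgn_below i (fset T) * Poly_Mapping.lookup m i * (\<Sum>j\<in>J. c j * Poly_Mapping.lookup (contr j (wedge ms)) (T |-| {|i|})))"
    unfolding wedge_Cons lookup_contr_wedge1 lookup_wedge1[of m] distrib_left sum.distrib sum_distrib_left
    by (subst (2) sum.swap) (simp add: mult_ac)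
  also have "\<dots> = 0" using Cons by simp
  finally show ?case .
qed

text \<open>For fixed U, the functional that sends b_j to the coefficient of w \<and> b_j at U sends
  a vector m to the coefficient of w \<and> m, which is 0 when m is a factor of w.\<close>

lemma plucker_wedge: "plucker (wedge ms)"
  unfolding plucker_def
proof (intro allI)
  fix T U
  let ?w = "wedge ms"
  have "(\<Sum>j\<in>fset U. Poly_Mapping.lookup (ins j ?w) U * Poly_Mapping.lookup m j) = 0" if "m \<in> set ms" for m
  proof -
    have "(\<Sum>j\<in>fset U. Poly_Mapping.lookup (ins j ?w) U * Poly_Mapping.lookup m j)
        = (-1) ^ (fcard U - 1) * Poly_Mapping.lookup (wedge1 m ?w) U"
      unfolding lookup_wedge1 sum_distrib_left
      by (intro sum.cong refl) (simp add: lookup_ins sgn_above_conv_below fcard.rep_eq)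
    then show ?thesis using that by (simp add: wedge1_wedge_member)
  qed
  then have "(\<Sum>j\<in>fset U. Poly_Mapping.lookup (ins j ?w) U * Poly_Mapping.lookup (contr j ?w) T) = 0"
    by (intro contr_wedge_zero) auto
  then show "(\<Sum>j\<in>fset U. Poly_Mapping.lookup (contr j ?w) T * Poly_Mapping.lookup (ins j ?w) U) = 0"
    by (simp add: mult.commute)
qed

text \<open>If \<open>v\<^sub>k \<and> w = 0\<close>, where \<open>v\<^sub>k = b\<^sub>k\<close> up to basis vectors outside \<open>S\<close>, then the coefficient of \<open>w\<close>
  at \<open>U\<close> is determined by coefficients at sets which are closer to \<open>S\<close>.\<close>

lemma annihilated_zero:
  assumes w: "w \<in> ext_power (fcard S)" and S: "Poly_Mapping.lookup w S = 0"
    and ann: "\<And>k. k |\<in>| S \<Longrightarrow> wedge1 (v k) w = 0"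
    and v: "\<And>k j. k |\<in>| S \<Longrightarrow> j |\<in>| S \<Longrightarrow> Poly_Mapping.lookup (v k) j = (if j = k then 1 else 0)"
  shows "w = 0"
proof -
  have "Poly_Mapping.lookup w U = 0" if "fcard U = fcard S" for U
    using that
  proof (induction "card (fset U - fset S)" arbitrary: U rule: less_induct)
    case (less U)
    show ?case
    proof (cases "U = S")
      case False
      have "\<not> fset S \<subseteq> fset U"
        using False less.prems card_subset_eq[of "fset U" "fset S"] by (auto simp: fcard.rep_eq fset_inject)
      then obtain k where k: "k |\<in>| S" "k |\<notin>| U" by auto
      let ?V = "finsert k U"
      have "sgn_below j (fset ?V) * Poly_Mapping.lookup (v k) j * Poly_Mapping.lookup w (?V |-| {|j|}) = 0" if j: "j \<in> fset ?V - {k}" for j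
      proof (cases "j |\<in>| S")
        case True
        then show ?thesis using v[OF k(1)] j by simp
      next
        case False
        have U: "j |\<in>| U" and "j \<noteq> k" using j by auto
        have "fset (?V |-| {|j|}) - fset S = (fset U - fset S) - {j}" using k by auto
        moreover have "card ((fset U - fset S) - {j}) < card (fset U - fset S)"
          using U False by (intro psubset_card_mono) auto
        moreover have "fcard (?V |-| {|j|}) = fcard S"
          using U k less.prems j by (subst fcard_fminus_single) (auto simp: fcard_finsert_disjoint)
        ultimately show ?thesis using less.hyps[of "?V |-| {|j|}"] by simp
      qed
      then have "(\<Sum>j\<in>fset ?V. sgn_below j (fset ?V) * Poly_Mapping.lookup (v k) j * Poly_Mapping.lookup w (?V |-| {|j|}))
          = (\<Sum>j\<in>{k}. sgn_below j (fset ?V) * Poly_Mapping.lookup (v k) j * Poly_Mapping.lookup w (?V |-| {|j|}))"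
        by (intro sum.mono_neutral_right) auto
      also have "\<dots> = sgn_below k (fset ?V) * Poly_Mapping.lookup w U"
        using v[OF k(1) k(1)] k(2) by simp
      finally have "sgn_below k (fset ?V) * Poly_Mapping.lookup w U = Poly_Mapping.lookup (wedge1 (v k) w) ?V"
        by (simp only: lookup_wedge1)
      also have "\<dots> = 0" using ann[OF k(1)] by simp
      finally show ?thesis by (simp add: sgn_below_def)
    qed (simp add: S)
  qed
  moreover have "Poly_Mapping.lookup w U = 0" if "fcard U \<noteq> fcard S" for U
    using that w by (auto simp: ext_power_def in_keys_iff)
  ultimately show ?thesis by (intro poly_mapping_eqI) (metis lookup_zero)
qed

lemma lookup_wedge_unitriangular:
  assumes "sorted_wrt (<) xs" "\<And>k j. k \<in> set xs \<Longrightarrow> j \<in> set xs \<Longrightarrow> Poly_Mapping.lookup (v k) j = (if j = k then 1 else 0)"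
  shows "Poly_Mapping.lookup (wedge (map v xs)) (fset_of_list xs) = 1"
  using assms
proof (induction xs)
  case (Cons x xs)
  let ?S = "fset_of_list (x # xs)"
  have "Poly_Mapping.lookup (wedge (map v (x # xs))) ?S
      = (\<Sum>j\<in>{x}. sgn_below j (fset ?S) * Poly_Mapping.lookup (v x) j * Poly_Mapping.lookup (wedge (map v xs)) (?S |-| {|j|}))"
    unfolding list.map wedge_Cons lookup_wedge1 using Cons.prems(2)[of x]
    by (intro sum.mono_neutral_right) (auto simp: fset_of_list.rep_eq)
  moreover have "{s \<in> fset ?S. s < x} = {}"
    using Cons.prems(1) by (auto simp: fset_of_list.rep_eq)
  then have "sgn_below x (fset ?S) = (1 :: rat)"
    by (simp only: sgn_below_def card.empty power_0)
  moreover have "x |\<notin>| fset_of_list xs"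
    using Cons.prems(1) by (auto simp: fset_of_list_elem)
  ultimately show ?case using Cons by simp
qed simp

text \<open>The factors are recovered from w: for a basis set S with nonzero coefficient,
  contracting w with all indices of S except k gives a vector v_k, and the relations with T = S -
  {k} say that v_k \<and> w = 0.\<close>

lemma plucker_decomposable:
  assumes w: "w \<in> ext_power r" and r: "r \<ge> 1" and pl: "plucker w"
  shows "w \<in> grassmann_cone r"
proof (cases "w = 0")
  case True
  obtain n where "r = Suc n" using r by (cases r) auto
  then have "w = wedge (replicate r 0)"
    using True by (simp add: wedge1_def)
  then show ?thesis by (auto simp: grassmann_cone_def intro!: exI[of _ "replicate r 0"])
next
  case False
  then obtain S where S: "S \<in> Poly_Mapping.keys w" by (metis keys_eq_empty ex_in_conv)
  with w have card: "fcard S = r" by (auto simp: ext_power_def)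
  define c where "c = Poly_Mapping.lookup w S"
  have c: "c \<noteq> 0" using S by (simp add: c_def in_keys_iff)
  define J where "J = (\<Union>U\<in>Poly_Mapping.keys w. fset U)"
  have J: "finite J" by (simp add: J_def)
  \<comment> \<open>Up to sign, the coefficient of w at (S - {k}) \<union> {j}, divided by c: on the
    indices in S the vector v k is b_k. The coefficients vanish outside J, which makes the sum
    finite.\<close>
  define v where "v k = (\<Sum>j\<in>J. Poly_Mapping.single j
      (Poly_Mapping.lookup (contr j w) (S |-| {|k|}) * (sgn_above k (fset S) / c)))" for k
  have lv: "Poly_Mapping.lookup (v k) j = Poly_Mapping.lookup (contr j w) (S |-| {|k|}) * (sgn_above k (fset S) / c)" for k j
  proof -
    have "Poly_Mapping.lookup (v k) j = (if j \<in> J then Poly_Mapping.lookup (contr j w) (S |-| {|k|}) * (sgn_above k (fset S) / c) else 0)"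
      unfolding v_def lookup_sum using J by (simp add: lookup_single when_def)
    moreover have "Poly_Mapping.lookup (contr j w) (S |-| {|k|}) = 0" if "j \<notin> J"
      using that by (auto simp: lookup_contr J_def in_keys_iff)
    ultimately show ?thesis by auto
  qed
  have v: "Poly_Mapping.lookup (v k) j = (if j = k then 1 else 0)" if "k |\<in>| S" "j |\<in>| S" for k j
  proof (cases "j = k")
    case True
    then have "Poly_Mapping.lookup (v k) j = (sgn_above k (fset S) * sgn_above k (fset S)) * (c / c)"
      unfolding lv using that by (simp add: lookup_contr finsert_absorb c_def)
    then show ?thesis using c True by simp
  next
    case False
    then show ?thesis unfolding lv using that by (simp add: lookup_contr)
  qed
  have vw: "wedge1 (v k) w = 0" for k
  proof (rule poly_mapping_eqI)
    fix U
    have "Poly_Mapping.lookup (wedge1 (v k) w) U = (\<Sum>j\<in>fset U. (-1) ^ (fcard U - 1) * (sgn_above k (fset S) / c)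
        * (Poly_Mapping.lookup (contr j w) (S |-| {|k|}) * Poly_Mapping.lookup (ins j w) U))"
      unfolding lookup_wedge1 lv
      by (intro sum.cong refl) (simp add: lookup_ins sgn_above_conv_below[of "fset U"] fcard.rep_eq
        flip: power_mult_distrib)
    also have "\<dots> = 0"
      unfolding sum_distrib_left[symmetric] using pl by (simp add: plucker_def)
    finally show "Poly_Mapping.lookup (wedge1 (v k) w) U = Poly_Mapping.lookup 0 U" by simp
  qed
  define xs where "xs = sorted_list_of_fset S"
  have xs: "sorted_wrt (<) xs" "set xs = fset S" "length xs = r"
    using card by (simp_all add: xs_def sorted_list_of_fset.rep_eq fcard.rep_eq)
  have fxs: "fset_of_list xs = S" using xs(2) by (simp add: fset_eq_iff fset_of_list_elem)
  define p where "p = wedge (map v xs)"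
  have pS: "Poly_Mapping.lookup p S = 1"
    unfolding p_def fxs[symmetric] using xs v by (intro lookup_wedge_unitriangular) auto
  have p: "p \<in> ext_power r"
    using wedge_in_ext_power[of "map v xs"] xs(3) by (simp add: p_def)
  \<comment> \<open>Both w and c p have the coefficient c at S and are annihilated by v k for every
    k in S, so \<open>annihilated_zero\<close> applies to their difference.\<close>
  define d where "d = w + qscale (- c) p"
  have "d = 0"
  proof (rule annihilated_zero[of _ S v])
    show "d \<in> ext_power (fcard S)"
      using w p card Poly_Mapping.keys_add[of w "qscale (- c) p"]
      by (fastforce simp: d_def ext_power_def in_keys_iff)
    show "Poly_Mapping.lookup d S = 0" unfolding d_def lookup_add lookup_qscale pS c_def by simp
    show "wedge1 (v k) d = 0" if "k |\<in>| S" for k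
    proof -
      have "wedge1 (v k) p = 0" unfolding p_def using that xs by (intro wedge1_wedge_member) auto
      then show ?thesis unfolding d_def wedge1_add_right wedge1_qscale_right vw by simp
    qed
  qed (use v in auto)
  then have "Poly_Mapping.lookup w U = c * Poly_Mapping.lookup p U" for U
    using arg_cong[of d 0 "\<lambda>x. Poly_Mapping.lookup x U"] unfolding d_def lookup_add lookup_qscale by simp
  then have wp: "w = qscale c p" by (intro poly_mapping_eqI) simp
  \<comment> \<open>As r \<ge> 1, there is a factor to absorb the scalar c.\<close>
  obtain y ys where y: "map v xs = y # ys" using xs(3) r by (cases "map v xs") auto
  have "w = wedge (qscale c y # ys)"
    unfolding wp p_def y wedge_Cons
    using linear_wedge1_left[of "wedge ys"] by (simp add: Vector_Spaces.linear_iff)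
  moreover have "length (qscale c y # ys) = r"
    using xs(3) arg_cong[OF y, of length] by simp
  ultimately show ?thesis unfolding grassmann_cone_def by (intro CollectI exI conjI)
qed

section \<open>The polynomial ring\<close>

lemma poly_mapping_add_induct [case_names zero single add]:
  assumes "P 0" "\<And>a c. P (Poly_Mapping.single a c)" "\<And>p q. P p \<Longrightarrow> P q \<Longrightarrow> P (p + q)"
  shows "P (p :: 'a \<Rightarrow>\<^sub>0 'b::comm_monoid_add)"
proof (induction p rule: Poly_Mapping.update_induct)
  case (update f a b)
  have "Poly_Mapping.update a b f = f + Poly_Mapping.single a b"
    using update(1) by (auto intro!: poly_mapping_eqI simp: lookup_update lookup_add lookup_single when_def in_keys_iff)
  then show ?case using assms(2,3) update by simp
qed (rule assms(1))

lemma comm_ring_hom_qconst: "comm_ring_hom qconst"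
  by unfold_locales (simp_all add: qconst_def single_add mult_single flip: single_one)

interpretation qconst: comm_ring_hom qconst by (rule comm_ring_hom_qconst)

lemma qscale_conv_mult: "qscale c p = qconst c * p"
  by (induction p rule: poly_mapping_add_induct)
     (simp_all add: Q.vs1.scale_right_distrib distrib_left qconst_def mult_single)

lemma B_induct [case_names const var add mult]:
  assumes const: "\<And>c. P (qconst c)" and var: "\<And>i. i \<ge> 1 \<Longrightarrow> P (xvar i)"
    and add: "\<And>p q. P p \<Longrightarrow> P q \<Longrightarrow> P (p + q)" and mult: "\<And>p q. P p \<Longrightarrow> P q \<Longrightarrow> P (p * q)"
  shows "P p"
proof -
  have power: "P (Poly_Mapping.single (Poly_Mapping.single i n) 1)" for i n
  proof (induction n)
    case 0
    show ?case using const[of 1] by (simp add: qconst_def)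
  next
    case (Suc n)
    have "Poly_Mapping.single (Poly_Mapping.single i (Suc n)) (1::rat)
        = xvar (Suc i) * Poly_Mapping.single (Poly_Mapping.single i n) 1"
      by (simp add: xvar_def mult_single flip: single_add)
    then show ?case using mult var Suc by simp
  qed
  have mono: "P (Poly_Mapping.single m 1)" for m
  proof (induction m rule: poly_mapping_add_induct)
    case zero
    show ?case using const[of 1] by (simp add: qconst_def)
  next
    case (add m m')
    then show ?case using mult[OF add] by (simp add: mult_single)
  qed (rule power)
  show ?thesis
  proof (induction p rule: poly_mapping_add_induct)
    case zero
    show ?case using const[of 0] by simp
  next
    case (single m c)
    have "Poly_Mapping.single m c = qconst c * Poly_Mapping.single m 1"
      by (simp add: qconst_def mult_single)
    then show ?case using mult const mono by simp
  qed (rule add)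
qed

lemma comm_ring_hom_comp:
  assumes "comm_ring_hom F" "comm_ring_hom G"
  shows "comm_ring_hom (\<lambda>x. F (G x))"
proof -
  interpret F: comm_ring_hom F by fact
  interpret G: comm_ring_hom G by fact
  show ?thesis by unfold_locales (simp_all add: F.hom_add F.hom_mult G.hom_add G.hom_mult)
qed

lemma monomial_eval:
  fixes y :: "nat \<Rightarrow> 'r::comm_ring_1"
  shows "(\<Prod>i\<in>Poly_Mapping.keys (m + m'). y i ^ Poly_Mapping.lookup (m + m') i)
    = (\<Prod>i\<in>Poly_Mapping.keys m. y i ^ Poly_Mapping.lookup m i) * (\<Prod>i\<in>Poly_Mapping.keys m'. y i ^ Poly_Mapping.lookup m' i)"
proof -
  let ?A = "Poly_Mapping.keys m \<union> Poly_Mapping.keys m'"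
  have *: "(\<Prod>i\<in>Poly_Mapping.keys k. y i ^ Poly_Mapping.lookup k i) = (\<Prod>i\<in>?A. y i ^ Poly_Mapping.lookup k i)"
    if "Poly_Mapping.keys k \<subseteq> ?A" for k
    using that by (intro prod.mono_neutral_left) (auto simp: in_keys_iff)
  show ?thesis
    unfolding *[OF Poly_Mapping.keys_add] *[OF Un_upper1] *[OF Un_upper2]
    by (simp add: lookup_add power_add prod.distrib)
qed

text \<open>Universal property of the polynomial ring. The homomorphism \<iota> makes the target a
  \<rat>-algebra; the targets in use are B and the Laurent series over B.\<close>

lemma B_eval_exists:
  fixes y :: "nat \<Rightarrow> 'r::comm_ring_1"
  assumes "comm_ring_hom \<iota>"
  shows "\<exists>F. comm_ring_hom F \<and> (\<forall>c. F (qconst c) = \<iota> c) \<and> (\<forall>i\<ge>1. F (xvar i) = y i)"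
proof -
  interpret \<iota>: comm_ring_hom \<iota> by fact
  define M where "M m = (\<Prod>i\<in>Poly_Mapping.keys m. y (Suc i) ^ Poly_Mapping.lookup m i)" for m :: mono
  define F where "F = linext (\<lambda>c x. \<iota> c * x) M"
  have vs: "vector_space (\<lambda>c x. \<iota> c * x)"
    by unfold_locales (simp_all add: \<iota>.hom_add \<iota>.hom_mult algebra_simps)
  have add: "F (p + q) = F p + F q" for p q
    unfolding F_def by (rule linext_add[OF vs])
  have F_single: "F (Poly_Mapping.single m c) = \<iota> c * M m" for m c
    unfolding F_def by (rule linext_single[OF vs])
  have M: "M (m + m') = M m * M m'" for m m'
    unfolding M_def by (rule monomial_eval)
  have zero: "F 0 = 0" by (simp add: F_def)
  have left_single: "F (Poly_Mapping.single m c * q) = F (Poly_Mapping.single m c) * F q" for m c q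
  proof (induction q rule: poly_mapping_add_induct)
    case (single m' c')
    show ?case by (simp add: mult_single F_single M \<iota>.hom_mult mult_ac)
  qed (simp_all add: zero distrib_left add)
  have mult: "F (p * q) = F p * F q" for p q
    by (induction p rule: poly_mapping_add_induct) (simp_all add: zero distrib_right add left_single)
  have const: "F (qconst c) = \<iota> c" for c
    by (simp add: qconst_def F_single M_def)
  have "comm_ring_hom F"
    using add mult zero const[of 1] by unfold_locales simp_all
  moreover have "F (xvar i) = y i" if "i \<ge> 1" for i
    using that by (simp add: xvar_def F_single M_def)
  ultimately show ?thesis using const by blast
qed

section \<open>The generating series\<close>

definition fps_map :: "('a \<Rightarrow> 'b) \<Rightarrow> 'a fps \<Rightarrow> 'b fps"
  where "fps_map F f = Abs_fps (\<lambda>n. F (fps_nth f n))"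

lemma fps_map_nth [simp]: "fps_nth (fps_map F f) n = F (fps_nth f n)"
  by (simp add: fps_map_def)

lemma comm_ring_hom_fps_map:
  assumes "comm_ring_hom F"
  shows "comm_ring_hom (fps_map F)"
proof -
  interpret F: comm_ring_hom F by fact
  show ?thesis
    by unfold_locales (auto intro!: fps_ext simp: F.hom_add F.hom_mult F.hom_sum fps_mult_nth fps_one_def)
qed

text \<open>The operator t d/dt; exponential series are compared through their logarithmic
  derivatives with respect to it.\<close>

definition euler :: "'a::comm_ring_1 fps \<Rightarrow> 'a fps"
  where "euler f = fps_X * fps_deriv f"

lemma euler_nth [simp]: "fps_nth (euler f) n = of_nat n * fps_nth f n"
  by (cases n) (simp_all add: euler_def)

lemma euler_mult: "euler (f * g) = euler f * g + f * euler g"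
  by (simp add: euler_def algebra_simps)

lemma hom_of_nat:
  assumes "comm_ring_hom F"
  shows "F (of_nat n) = of_nat n"
proof -
  interpret F: comm_ring_hom F by fact
  show ?thesis by (induction n) (simp_all add: F.hom_add)
qed

lemma euler_fps_map:
  assumes "comm_ring_hom F"
  shows "euler (fps_map F f) = fps_map F (euler f)"
proof -
  interpret F: comm_ring_hom F by fact
  show ?thesis by (rule fps_ext) (simp add: F.hom_mult hom_of_nat[OF assms])
qed

text \<open>As Y has no constant term, the coefficient at n expresses n p_n through p_0, ...,
  p_(n-1); \<iota> supplies the inverse of n.\<close>

lemma euler_unique:
  fixes \<iota> :: "rat \<Rightarrow> 'r::comm_ring_1" and P Q Y :: "'r fps"
  assumes \<iota>: "comm_ring_hom \<iota>"
    and P: "euler P = Y * P" and Q: "euler Q = Y * Q" and "fps_nth P 0 = fps_nth Q 0"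
    and Y: "fps_nth Y 0 = 0"
  shows "P = Q"
proof (rule fps_ext)
  interpret \<iota>: comm_ring_hom \<iota> by fact
  fix n
  show "fps_nth P n = fps_nth Q n"
  proof (induction n rule: less_induct)
    case (less n)
    show ?case
    proof (cases "n = 0")
      case False
      have "fps_nth Y i * fps_nth P (n - i) = fps_nth Y i * fps_nth Q (n - i)" for i
        using Y less False by (cases "i = 0") auto
      then have "fps_nth (euler P) n = fps_nth (euler Q) n"
        unfolding P Q by (simp add: fps_mult_nth)
      then have "\<iota> (1 / of_nat n) * (of_nat n * fps_nth P n) = \<iota> (1 / of_nat n) * (of_nat n * fps_nth Q n)"
        by simp
      moreover have "\<iota> (1 / of_nat n) * of_nat n = 1"
        using False \<iota>.hom_mult[of "1 / of_nat n" "of_nat n"] by (simp add: hom_of_nat[OF \<iota>])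
      ultimately show ?thesis by (simp flip: mult.assoc)
    qed (use assms in simp)
  qed
qed

definition Hser :: "B fps"
  where "Hser = exp_series xseries"

definition Eser :: "B fps"
  where "Eser = exp_series (- xseries)"

lemma euler_exp_series:
  assumes "fps_nth f 0 = 0"
  shows "euler (exp_series f) = euler f * exp_series f"
proof -
  let ?E = "Abs_fps (\<lambda>n. qconst (1 / fact n))"
  have "fps_deriv ?E = ?E"
  proof (rule fps_ext)
    fix n
    have "of_nat (Suc n) * qconst (1 / fact (Suc n)) = qconst (of_nat (Suc n) * (1 / fact (Suc n)))"
      unfolding qconst.hom_mult hom_of_nat[OF comm_ring_hom_qconst] ..
    also have "of_nat (Suc n) * (1 / fact (Suc n)) = (1 / fact n :: rat)"
      by (simp add: fact_Suc[of n] del: of_nat_Suc)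
    finally show "fps_nth (fps_deriv ?E) n = fps_nth ?E n" by simp
  qed
  then show ?thesis
    using fps_compose_deriv[OF assms, of ?E] by (simp add: euler_def exp_series_def mult_ac)
qed

lemma exp_series_nth_0 [simp]: "fps_nth (exp_series f) 0 = 1"
  by (simp add: exp_series_def)

lemma Hser_nth_0 [simp]: "fps_nth Hser 0 = 1" and Eser_nth_0 [simp]: "fps_nth Eser 0 = 1"
  by (simp_all add: Hser_def Eser_def)

lemma euler_Hser: "euler Hser = euler xseries * Hser"
  by (simp add: Hser_def euler_exp_series xseries_def)

lemma euler_Eser: "euler Eser = - euler xseries * Eser"
proof -
  have "euler (- xseries) = - euler xseries" by (simp add: euler_def)
  then show ?thesis by (simp add: Eser_def euler_exp_series xseries_def)
qed

lemma Eser_Hser: "Eser * Hser = 1"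
proof (rule euler_unique[OF comm_ring_hom_qconst, of _ 0])
  show "euler (Eser * Hser) = 0 * (Eser * Hser)"
    by (simp add: euler_mult euler_Hser euler_Eser algebra_simps)
qed (simp_all add: euler_def)

lemma fps_nth_Eser: "fps_nth Eser i = (-1) ^ i * evar i"
  by (simp add: evar_def Eser_def flip: mult.assoc power_mult_distrib)

lemma hom_Hser_eqI:
  fixes F :: "B \<Rightarrow> 'r::comm_ring_1"
  assumes F: "comm_ring_hom F" and "fps_nth G 0 = 1" "euler G = fps_map F (euler xseries) * G"
  shows "fps_map F Hser = G"
proof -
  interpret F: comm_ring_hom F by fact
  interpret FF: comm_ring_hom "fps_map F" by (rule comm_ring_hom_fps_map[OF F])
  show ?thesis
  proof (rule euler_unique[OF comm_ring_hom_comp[OF F comm_ring_hom_qconst]])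
    show "euler (fps_map F Hser) = fps_map F (euler xseries) * fps_map F Hser"
      by (simp add: euler_fps_map[OF F] euler_Hser FF.hom_mult)
  qed (use assms in \<open>simp_all add: xseries_def\<close>)
qed

text \<open>The h_n are free generators of B. To reach a given series, i x_i is sent to the i-th
  coefficient of its logarithmic derivative.\<close>

lemma hom_Hser_exists:
  fixes G :: "'r::comm_ring_1 fps"
  assumes \<iota>: "comm_ring_hom \<iota>" and G: "fps_nth G 0 = 1"
  shows "\<exists>F. comm_ring_hom F \<and> (\<forall>c. F (qconst c) = \<iota> c) \<and> fps_map F Hser = G"
proof -
  interpret \<iota>: comm_ring_hom \<iota> by fact
  define K where "K = fps_right_inverse G 1"
  have GK: "G * K = 1" unfolding K_def by (rule fps_right_inverse) (simp add: G)
  define Y where "Y = euler G * K"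
  obtain F where F: "comm_ring_hom F" "\<And>c. F (qconst c) = \<iota> c"
      "\<And>i. i \<ge> 1 \<Longrightarrow> F (xvar i) = \<iota> (1 / of_nat i) * fps_nth Y i"
    using B_eval_exists[OF \<iota>, of "\<lambda>i. \<iota> (1 / of_nat i) * fps_nth Y i"] by blast
  interpret F: comm_ring_hom F by fact
  have "fps_map F (euler xseries) = Y"
  proof (rule fps_ext)
    fix n
    show "fps_nth (fps_map F (euler xseries)) n = fps_nth Y n"
    proof (cases "n = 0")
      case False
      have "of_nat n * \<iota> (1 / of_nat n) = 1"
        using False \<iota>.hom_mult[of "of_nat n" "1 / of_nat n"] by (simp add: hom_of_nat[OF \<iota>])
      then show ?thesis
        using False F(3)[of n] by (simp add: xseries_def F.hom_mult hom_of_nat[OF F(1)] flip: mult.assoc)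
    qed (simp add: Y_def fps_mult_nth_0)
  qed
  then have "fps_map F Hser = G"
    using GK by (intro hom_Hser_eqI F(1) G) (simp add: Y_def mult.assoc mult.commute[of K])
  then show ?thesis using F by blast
qed

text \<open>Newton's identities, n x_n being the n-th power sum. They express x_n through x_1, ...,
  x_(n-1) and the h's, or the e's, as inductions on n require.\<close>

lemma xvar_recursion:
  assumes "n \<ge> 1"
  shows "of_nat n * xvar n = of_nat n * fps_nth Hser n - (\<Sum>i=1..<n. of_nat i * xvar i * fps_nth Hser (n - i))"
    and "of_nat n * xvar n = - (of_nat n * fps_nth Eser n) - (\<Sum>i=1..<n. of_nat i * xvar i * fps_nth Eser (n - i))"
proof -
  have split: "fps_nth (euler xseries * G) n
      = of_nat n * xvar n + (\<Sum>i=1..<n. of_nat i * xvar i * fps_nth G (n - i))" if "fps_nth G 0 = 1" for G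
  proof -
    have "fps_nth (euler xseries * G) n = (\<Sum>i=0..n. of_nat i * fps_nth xseries i * fps_nth G (n - i))"
      by (simp add: fps_mult_nth)
    also have "\<dots> = (\<Sum>i=1..<Suc n. of_nat i * fps_nth xseries i * fps_nth G (n - i))"
      by (intro sum.mono_neutral_right) (auto simp: Suc_le_eq)
    also have "\<dots> = of_nat n * xvar n + (\<Sum>i=1..<n. of_nat i * fps_nth xseries i * fps_nth G (n - i))"
      using assms that by (simp add: xseries_def)
    finally show ?thesis by (simp add: xseries_def)
  qed
  show "of_nat n * xvar n = of_nat n * fps_nth Hser n - (\<Sum>i=1..<n. of_nat i * xvar i * fps_nth Hser (n - i))"
    using arg_cong[OF euler_Hser, of "\<lambda>f. fps_nth f n"] split[of Hser] by (simp add: algebra_simps)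
  show "of_nat n * xvar n = - (of_nat n * fps_nth Eser n) - (\<Sum>i=1..<n. of_nat i * xvar i * fps_nth Eser (n - i))"
  proof -
    have "of_nat n * fps_nth Eser n = - (of_nat n * xvar n + (\<Sum>i=1..<n. of_nat i * xvar i * fps_nth Eser (n - i)))"
      unfolding split[of Eser, OF Eser_nth_0, symmetric]
      using arg_cong[OF euler_Eser, of "\<lambda>f. fps_nth f n"] by (simp only: euler_nth mult_minus_left fps_neg_nth)
    then show ?thesis by simp
  qed
qed

lemma xvar_of_nat_mult: "n \<ge> 1 \<Longrightarrow> xvar n = qconst (1 / of_nat n) * (of_nat n * xvar n)"
  using qconst.hom_mult[of "1 / of_nat n" "of_nat n"]
  by (simp add: hom_of_nat[OF comm_ring_hom_qconst] flip: mult.assoc)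

section \<open>The vertex operators as ring homomorphisms\<close>

lemma pdiff_conv_linext: "pdiff i p = linext qscale
    (\<lambda>m. Poly_Mapping.single (m - Poly_Mapping.single (i - 1) 1) (of_nat (Poly_Mapping.lookup m (i - 1)))) p"
  by (simp add: pdiff_def linext_def mult.commute)

lemma pdiff_zero [simp]: "pdiff i 0 = 0"
  and pdiff_add: "pdiff i (p + q) = pdiff i p + pdiff i q"
  and pdiff_single: "pdiff i (Poly_Mapping.single m c)
    = Poly_Mapping.single (m - Poly_Mapping.single (i - 1) 1) (c * of_nat (Poly_Mapping.lookup m (i - 1)))"
  by (simp_all add: pdiff_conv_linext)

lemma pdiff_qconst [simp]: "pdiff i (qconst c) = 0"
  by (simp add: qconst_def pdiff_single)

lemma pdiff_one [simp]: "pdiff i 1 = 0"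
  using pdiff_qconst[of i 1] by simp

lemma pdiff_mult: "pdiff i (p * q) = pdiff i p * q + p * pdiff i q"
proof (induction p rule: poly_mapping_add_induct)
  case (single m c)
  show ?case
  proof (induction q rule: poly_mapping_add_induct)
    case (single m' c')
    let ?e = "Poly_Mapping.single (i - 1) (1 :: nat)"
    have minus: "(k + l) - ?e = (k - ?e) + l" if "Poly_Mapping.lookup k (i - 1) \<noteq> 0" for k l :: mono
      using that by (auto intro!: poly_mapping_eqI simp: lookup_minus lookup_add lookup_single when_def)
    have left: "pdiff i (Poly_Mapping.single k a) * Poly_Mapping.single l b
        = Poly_Mapping.single (k + l - ?e) (a * b * of_nat (Poly_Mapping.lookup k (i - 1)))" for k l :: mono and a b
      using minus[of k l] by (cases "Poly_Mapping.lookup k (i - 1) = 0")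
        (simp_all add: pdiff_single mult_single mult.assoc mult.commute[of b])
    have "pdiff i (Poly_Mapping.single m c * Poly_Mapping.single m' c')
        = Poly_Mapping.single (m + m' - ?e) (c * c' * of_nat (Poly_Mapping.lookup m (i - 1)))
        + Poly_Mapping.single (m + m' - ?e) (c * c' * of_nat (Poly_Mapping.lookup m' (i - 1)))"
      by (simp add: mult_single pdiff_single lookup_add algebra_simps flip: single_add)
    also have "Poly_Mapping.single (m + m' - ?e) (c * c' * of_nat (Poly_Mapping.lookup m' (i - 1)))
        = Poly_Mapping.single m c * pdiff i (Poly_Mapping.single m' c')"
      unfolding mult.commute[of "Poly_Mapping.single m c"] left add.commute[of m] mult.commute[of c] ..
    also note left[symmetric]
    finally show ?case .
  qed (simp_all add: pdiff_add algebra_simps)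
qed (simp_all add: pdiff_add algebra_simps)

lemma pdiff_qconst_mult: "pdiff i (qconst c * p) = qconst c * pdiff i p"
  by (simp add: pdiff_mult)

lemma pdiff_sum: "pdiff i (sum f A) = (\<Sum>a\<in>A. pdiff i (f a))"
  by (induction A rule: infinite_finite_induct) (simp_all add: pdiff_add)

lemma pdiff_xvar:
  assumes "i \<ge> 1" "j \<ge> 1"
  shows "pdiff i (xvar j) = (if i = j then 1 else 0)"
  using assms by (simp add: xvar_def pdiff_single lookup_single when_def) linarith

lemma fps_map_pdiff_mult: "fps_map (pdiff i) (f * g) = fps_map (pdiff i) f * g + f * fps_map (pdiff i) g"
  by (rule fps_ext) (simp add: fps_mult_nth pdiff_sum pdiff_mult sum.distrib)

text \<open>The derivative of H by x_i and the series t^i H satisfy one and the same inhomogeneous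
  Euler equation. Their difference solves the homogeneous equation with constant term 0, so it is
  0.\<close>

lemma pdiff_Hser:
  assumes i: "i \<ge> 1"
  shows "pdiff i (fps_nth Hser n) = (if i \<le> n then fps_nth Hser (n - i) else 0)"
proof -
  have of_nat: "pdiff i (of_nat k * p) = of_nat k * pdiff i p" for k p
    using pdiff_qconst_mult[of i "of_nat k" p] by (simp add: hom_of_nat[OF comm_ring_hom_qconst])
  have euler: "euler (fps_map (pdiff i) f) = fps_map (pdiff i) (euler f)" for f
    by (rule fps_ext) (simp add: of_nat)
  have x: "fps_map (pdiff i) (euler xseries) = fps_const (of_nat i) * fps_X ^ i"
    by (rule fps_ext) (use i in \<open>auto simp: xseries_def of_nat pdiff_xvar\<close>)
  have X: "euler (fps_X ^ i) = fps_const (of_nat i) * fps_X ^ i"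
    by (rule fps_ext) simp
  let ?P = "fps_map (pdiff i) Hser - fps_X ^ i * Hser"
  have "euler (fps_map (pdiff i) Hser) = fps_const (of_nat i) * fps_X ^ i * Hser + euler xseries * fps_map (pdiff i) Hser"
    unfolding euler euler_Hser fps_map_pdiff_mult x ..
  moreover have "euler (fps_X ^ i * Hser) = fps_const (of_nat i) * fps_X ^ i * Hser + euler xseries * (fps_X ^ i * Hser)"
    unfolding euler_mult X euler_Hser by (simp add: algebra_simps)
  moreover have "euler (f - g) = euler f - euler g" for f g :: "B fps"
    by (simp add: euler_def algebra_simps)
  ultimately have "euler ?P = euler xseries * ?P"
    by (simp add: right_diff_distrib)
  then have "?P = 0"
    by (rule euler_unique[OF comm_ring_hom_qconst]) (use i in \<open>simp_all add: euler_def xseries_def fps_mult_nth\<close>)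
  then have "fps_nth (fps_map (pdiff i) Hser) n = fps_nth (fps_X ^ i * Hser) n" by simp
  then show ?thesis by (simp add: fps_X_power_mult_nth not_le)
qed

text \<open>One finite sum of operators that agrees with \<open>dop\<close> up to order N. It
  carries the product rule over from \<open>pdiff\<close> to \<open>dop\<close>, whose own range of
  summation varies with the coefficient.\<close>

definition dop_upto :: "nat \<Rightarrow> B fps \<Rightarrow> B fps"
  where "dop_upto N f = (\<Sum>i=1..N. fps_const (qconst (1 / of_nat i)) * fps_X ^ i * fps_map (pdiff i) f)"

lemma dop_nth:
  assumes "k \<le> N"
  shows "fps_nth (dop f) k = fps_nth (dop_upto N f) k"
proof -
  have "fps_nth (dop_upto N f) k = (\<Sum>i=1..N. if k < i then 0 else qconst (1 / of_nat i) * pdiff i (fps_nth f (k - i)))"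
    unfolding dop_upto_def fps_sum_nth by (intro sum.cong refl) (simp add: mult.assoc fps_X_power_mult_nth)
  also have "\<dots> = fps_nth (dop f) k"
    unfolding dop_def fps_nth_Abs_fps using assms by (intro sum.mono_neutral_cong_right) auto
  finally show ?thesis ..
qed

lemma dop_add: "dop (f + g) = dop f + dop g"
  by (rule fps_ext) (simp add: dop_def pdiff_add distrib_left sum.distrib)

lemma dop_mult: "dop (f * g) = dop f * g + f * dop g"
proof (rule fps_ext)
  fix k
  have "dop_upto k (f * g) = dop_upto k f * g + f * dop_upto k g"
    by (simp add: dop_upto_def fps_map_pdiff_mult sum_distrib_left sum_distrib_right sum.distrib algebra_simps)
  then have "fps_nth (dop (f * g)) k = fps_nth (dop_upto k f * g) k + fps_nth (f * dop_upto k g) k"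
    by (simp add: dop_nth[OF order_refl])
  also have "fps_nth (dop_upto k f * g) k = fps_nth (dop f * g) k"
    unfolding fps_mult_nth by (intro sum.cong refl) (simp add: dop_nth[of _ k])
  also have "fps_nth (f * dop_upto k g) k = fps_nth (f * dop g) k"
    unfolding fps_mult_nth by (intro sum.cong refl) (simp add: dop_nth[of _ k])
  finally show "fps_nth (dop (f * g)) k = fps_nth (dop f * g + f * dop g) k" by simp
qed

section \<open>Exponentials of order-raising derivations\<close>

text \<open>Covers both \<open>dop\<close> and its negative. Raising the order confines each
  coefficient of the exponential to finitely many terms.\<close>

locale raising_derivation =
  fixes L :: "B fps \<Rightarrow> B fps"
  assumes L_add: "L (f + g) = L f + L g"
    and L_mult: "L (f * g) = L f * g + f * L g"
    and L_const: "L (fps_const (qconst c)) = 0"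
    and L_raising: "(\<And>j. j < k \<Longrightarrow> fps_nth f j = 0) \<Longrightarrow> fps_nth (L f) k = 0"
begin

definition dpow :: "nat \<Rightarrow> B fps \<Rightarrow> B fps"
  where "dpow n f = fps_const (qconst (1 / fact n)) * (L ^^ n) f"

lemma L_zero [simp]: "L 0 = 0"
  using L_add[of 0 0] by simp

lemma L_uminus: "L (- f) = - L f"
  using L_add[of f "- f"] by (simp add: eq_neg_iff_add_eq_0 add.commute)

lemma L_const_mult: "L (fps_const (qconst c) * f) = fps_const (qconst c) * L f"
  by (simp add: L_mult L_const)

lemma dpow_0 [simp]: "dpow 0 f = f"
  by (simp add: dpow_def)

lemma dpow_Suc: "dpow (Suc n) f = fps_const (qconst (1 / of_nat (Suc n))) * L (dpow n f)"
proof -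
  have "1 / fact (Suc n) = 1 / of_nat (Suc n) * (1 / fact n :: rat)" by simp
  then show ?thesis unfolding dpow_def L_const_mult
    by (simp only: funpow.simps comp_def qconst.hom_mult mult.assoc flip: fps_const_mult)
qed

lemma dpow_add: "dpow n (f + g) = dpow n f + dpow n g"
  by (induction n) (simp_all add: dpow_Suc L_add distrib_left)

lemma dpow_sum: "dpow n (sum f A) = (\<Sum>a\<in>A. dpow n (f a))"
proof -
  have "dpow n 0 = 0" by (induction n) (simp_all add: dpow_Suc)
  then show ?thesis by (induction A rule: infinite_finite_induct) (simp_all add: dpow_add)
qed

lemma dpow_raising:
  assumes "\<And>j. j < k \<Longrightarrow> fps_nth f j = 0" "j < k + n"
  shows "fps_nth (dpow n f) j = 0"
  using assms(2)
proof (induction n arbitrary: j)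
  case (Suc n)
  have "fps_nth (L (dpow n f)) j = 0"
    using Suc by (intro L_raising) auto
  then show ?case by (simp add: dpow_Suc)
qed (use assms in simp)

lemma dpow_nth_eq_0: "j < n \<Longrightarrow> fps_nth (dpow n f) j = 0"
  using dpow_raising[of 0 f j n] by simp

lemma one_over_Suc: "fps_const (qconst (1 / of_nat (Suc n))) * of_nat (Suc n) = 1"
proof -
  have "qconst (1 / of_nat (Suc n)) * of_nat (Suc n) = qconst (1 / of_nat (Suc n) * of_nat (Suc n))"
    unfolding qconst.hom_mult hom_of_nat[OF comm_ring_hom_qconst] ..
  then show ?thesis by (simp add: del: of_nat_Suc flip: fps_of_nat)
qed

lemma of_nat_Suc_mult: "of_nat (Suc n) * (fps_const (qconst (1 / of_nat (Suc n))) * f) = f"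
  unfolding mult.assoc[symmetric] mult.commute[of "of_nat (Suc n)"] one_over_Suc by simp

text \<open>Both sides are the coefficients of a series in an auxiliary variable \<open>s\<close> which solves
  \<open>dP/ds = L P\<close>.\<close>

lemma dpow_mult: "dpow n (f * g) = (\<Sum>a\<le>n. dpow a f * dpow (n - a) g)"
proof -
  define F where "F h = Abs_fps (\<lambda>n. dpow n h)" for h
  have deriv: "fps_deriv (F h) = fps_map L (F h)" for h
  proof (rule fps_ext)
    fix n
    have "of_nat (Suc n) * dpow (Suc n) h = L (dpow n h)"
      unfolding dpow_Suc by (rule of_nat_Suc_mult)
    then show "fps_nth (fps_deriv (F h)) n = fps_nth (fps_map L (F h)) n"
      by (simp add: F_def del: of_nat_Suc)
  qed
  have L_sum: "L (sum h A) = (\<Sum>a\<in>A. L (h a))" for h and A :: "nat set"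
    by (induction A rule: infinite_finite_induct) (simp_all add: L_add)
  have L_map: "fps_map L (P * Q) = fps_map L P * Q + P * fps_map L Q" for P Q
    by (rule fps_ext) (simp add: fps_mult_nth L_sum L_mult sum.distrib)
  have "fps_deriv (F f * F g) = fps_map L (F f * F g)"
    unfolding fps_deriv_mult deriv L_map by (rule add.commute)
  then have "fps_nth (fps_deriv (F f * F g)) n = fps_nth (fps_map L (F f * F g)) n" for n
    by (rule arg_cong)
  then have step: "of_nat (Suc n) * fps_nth (F f * F g) (Suc n) = L (fps_nth (F f * F g) n)" for n
    by (simp only: fps_deriv_nth fps_map_nth Suc_eq_plus1)
  have "fps_nth (F f * F g) n = dpow n (f * g)"
  proof (induction n)
    case (Suc n)
    have "dpow (Suc n) (f * g) = fps_const (qconst (1 / of_nat (Suc n))) * (of_nat (Suc n) * fps_nth (F f * F g) (Suc n))"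
      unfolding dpow_Suc Suc[symmetric] step ..
    then show ?case unfolding mult.assoc[symmetric] one_over_Suc by simp
  qed (simp add: F_def)
  then show ?thesis by (simp add: F_def fps_mult_nth atLeast0AtMost)
qed

lemma dpow_dpow: "dpow n (dpow m f) = of_nat ((n + m) choose n) * dpow (n + m) f"
proof -
  have L: "(L ^^ n) (fps_const (qconst c) * h) = fps_const (qconst c) * (L ^^ n) h" for c h
    by (induction n) (simp_all add: L_const_mult)
  have "1 / fact n * (1 / fact m) = of_nat ((n + m) choose n) * (1 / fact (n + m) :: rat)"
    using binomial_fact[of n "n + m", where 'a = rat] by simp
  then have "qconst (1 / fact n) * qconst (1 / fact m) = of_nat ((n + m) choose n) * qconst (1 / fact (n + m))"
    by (simp only: flip: qconst.hom_mult hom_of_nat[OF comm_ring_hom_qconst])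
  then show ?thesis
    unfolding dpow_def L funpow_add comp_def mult.assoc[symmetric] fps_const_mult
    by (simp flip: fps_of_nat)
qed

lemma exp_op_nth:
  assumes "k \<le> N"
  shows "fps_nth (exp_op L f) k = (\<Sum>n\<le>N. fps_nth (dpow n f) k)"
proof -
  have "fps_nth (exp_op L f) k = (\<Sum>n\<le>k. fps_nth (dpow n f) k)"
    by (simp add: exp_op_def dpow_def)
  also have "\<dots> = (\<Sum>n\<le>N. fps_nth (dpow n f) k)"
    using assms by (intro sum.mono_neutral_left) (auto simp: dpow_nth_eq_0)
  finally show ?thesis .
qed

lemma exp_op_add: "exp_op L (f + g) = exp_op L f + exp_op L g"
  by (rule fps_ext) (simp add: exp_op_nth[OF order_refl] dpow_add sum.distrib)

text \<open>This is the Leibniz formula for divided powers, summed up. At the coefficient k the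
  square a, b \<le> k may be cut down to the triangle a + b \<le> k, since
  \<open>dpow a f * dpow b g\<close> has order at least a + b.\<close>

lemma exp_op_mult: "exp_op L (f * g) = exp_op L f * exp_op L g"
proof (rule fps_ext)
  fix k
  let ?t = "\<lambda>a b. fps_nth (dpow a f * dpow b g) k"
  have zero: "?t a b = 0" if "k < a + b" for a b
  proof -
    have "fps_nth (dpow a f) i * fps_nth (dpow b g) (k - i) = 0" if "i \<le> k" for i
      using dpow_nth_eq_0[of i a f] dpow_nth_eq_0[of "k - i" b g] that \<open>k < a + b\<close>
      by (cases "i < a") auto
    then show ?thesis unfolding fps_mult_nth by (intro sum.neutral) auto
  qed
  have "fps_nth (exp_op L f * exp_op L g) k
      = fps_nth ((\<Sum>a\<le>k. dpow a f) * (\<Sum>b\<le>k. dpow b g)) k"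
    unfolding fps_mult_nth by (intro sum.cong refl) (simp add: exp_op_nth[of _ k] fps_sum_nth)
  also have "\<dots> = (\<Sum>(a, b)\<in>{..k} \<times> {..k}. ?t a b)"
    by (simp add: sum_product fps_sum_nth sum.cartesian_product case_prod_beta)
  also have "\<dots> = (\<Sum>(a, b)\<in>{(a, b). a + b \<le> k}. ?t a b)"
    by (intro sum.mono_neutral_right) (auto intro: ccontr simp: zero not_le)
  also have "\<dots> = (\<Sum>n\<le>k. \<Sum>a\<le>n. ?t a (n - a))"
    by (rule sum.triangle_reindex_eq)
  also have "\<dots> = fps_nth (exp_op L (f * g)) k"
    by (simp add: exp_op_nth[OF order_refl] dpow_mult fps_sum_nth)
  finally show "fps_nth (exp_op L (f * g)) k = fps_nth (exp_op L f * exp_op L g) k" ..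
qed

lemma exp_op_eq:
  assumes "L (L f) = 0"
  shows "exp_op L f = f + L f"
proof (rule fps_ext)
  fix k
  have "(L ^^ n) 0 = 0" for n by (induction n) simp_all
  then have "dpow (Suc (Suc n)) f = 0" for n
    by (simp add: dpow_def funpow_Suc_right assms del: funpow.simps)
  then have "dpow n f = 0" if "n \<ge> 2" for n
    using that by (cases n rule: nat.exhaust; cases "n - 1" rule: nat.exhaust) auto
  then have "(\<Sum>n\<le>k + 1. fps_nth (dpow n f) k) = (\<Sum>n\<le>1. fps_nth (dpow n f) k)"
    by (intro sum.mono_neutral_right) auto
  then have "fps_nth (exp_op L f) k = (\<Sum>n\<le>1. fps_nth (dpow n f) k)"
    by (subst exp_op_nth[of k "k + 1"]) simp_all
  then show "fps_nth (exp_op L f) k = fps_nth (f + L f) k"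
    by (simp add: dpow_Suc)
qed

lemma exp_op_constant: "L f = 0 \<Longrightarrow> exp_op L f = f"
  by (simp add: exp_op_eq)

lemma raising_derivation_uminus: "raising_derivation (\<lambda>f. - L f)"
  by unfold_locales (simp_all add: L_add L_mult L_const L_raising)

text \<open>In the composition, \<open>dpow N f\<close> is multiplied by the alternating sum of the
  binomial coefficients N over n, which is 0 unless N = 0.\<close>

lemma exp_op_inverse: "exp_op (\<lambda>f. - L f) (exp_op L f) = f"
proof (rule fps_ext)
  interpret M: raising_derivation "\<lambda>f. - L f" by (rule raising_derivation_uminus)
  fix k
  have neg: "M.dpow n f = (-1) ^ n * dpow n f" for n f
  proof (induction n)
    case (Suc n)
    have "L ((-1) ^ n * dpow n f) = (-1) ^ n * L (dpow n f)"
      by (cases "even n") (simp_all add: L_uminus)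
    then show ?case using Suc by (simp add: M.dpow_Suc dpow_Suc mult.left_commute del: of_nat_Suc)
  qed simp
  \<comment> \<open>\<open>exp_op L f\<close> differs from the sum of its first k + 1 terms by a
    series of order above k, and \<open>dpow n\<close> does not lower the order.\<close>
  have cont: "fps_nth (dpow n (exp_op L f)) k = (\<Sum>m\<le>k. fps_nth (dpow n (dpow m f)) k)" for n
  proof -
    let ?s = "\<Sum>m\<le>k. dpow m f"
    have "fps_nth (dpow n (exp_op L f - ?s)) k = 0"
      by (rule dpow_raising[of "Suc k"]) (simp_all add: fps_sum_nth exp_op_nth[of _ k])
    moreover have "dpow n (exp_op L f) = dpow n (exp_op L f - ?s) + dpow n ?s"
      by (simp flip: dpow_add)
    ultimately show ?thesis by (simp add: dpow_sum fps_sum_nth)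
  qed
  let ?t = "\<lambda>n m. (-1) ^ n * of_nat ((n + m) choose n) * fps_nth (dpow (n + m) f) k"
  have "fps_nth (exp_op (\<lambda>f. - L f) (exp_op L f)) k
      = (\<Sum>n\<le>k. (-1) ^ n * (\<Sum>m\<le>k. of_nat ((n + m) choose n) * fps_nth (dpow (n + m) f) k))"
    unfolding M.exp_op_nth[OF order_refl] neg cont[symmetric] dpow_dpow[symmetric]
    by (intro sum.cong refl) (simp add: minus_one_power_iff cont dpow_dpow flip: fps_of_nat)
  also have "\<dots> = (\<Sum>(n, m)\<in>{..k} \<times> {..k}. ?t n m)"
    by (simp add: sum_distrib_left sum.cartesian_product mult.assoc)
  also have "\<dots> = (\<Sum>(n, m)\<in>{(n, m). n + m \<le> k}. ?t n m)"
    by (intro sum.mono_neutral_right) (auto intro: ccontr simp: dpow_nth_eq_0 not_le)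
  also have "\<dots> = (\<Sum>N\<le>k. \<Sum>n\<le>N. ?t n (N - n))"
    by (rule sum.triangle_reindex_eq)
  also have "\<dots> = (\<Sum>N\<le>k. (\<Sum>n\<le>N. (-1) ^ n * of_nat (N choose n)) * fps_nth (dpow N f) k)"
    by (simp add: sum_distrib_right)
  also have "\<dots> = (\<Sum>N\<in>{0}. fps_nth (dpow N f) k)"
    by (intro sum.mono_neutral_cong_right) (auto simp: choose_alternating_sum)
  finally show "fps_nth (exp_op (\<lambda>f. - L f) (exp_op L f)) k = fps_nth f k" by simp
qed

end

interpretation dop: raising_derivation dop
proof
  show "fps_nth (dop f) k = 0" if "\<And>j. j < k \<Longrightarrow> fps_nth f j = 0" for f k
    using that by (auto simp: dop_def intro!: sum.neutral)
  show "dop (fps_const (qconst c)) = 0" for c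
    by (rule fps_ext) (auto simp: dop_def intro!: sum.neutral)
qed (rule dop_add dop_mult)+

interpretation neg_dop: raising_derivation "\<lambda>f. - dop f"
  by (rule dop.raising_derivation_uminus)

lemma dop_xvar:
  assumes "i \<ge> 1"
  shows "dop (fps_const (xvar i)) = fps_const (qconst (1 / of_nat i)) * fps_X ^ i"
proof (rule fps_ext)
  fix k
  have "fps_nth (dop (fps_const (xvar i))) k = (\<Sum>j=1..k. if j = k then if i = k then qconst (1 / of_nat i) else 0 else 0)"
    unfolding dop_def fps_nth_Abs_fps using assms by (intro sum.cong refl) (auto simp: pdiff_xvar)
  then show "fps_nth (dop (fps_const (xvar i))) k = fps_nth (fps_const (qconst (1 / of_nat i)) * fps_X ^ i) k"
    using assms by auto
qed

lemma dop_X_power: "dop (fps_X ^ i) = 0"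
  by (rule fps_ext) (auto simp: dop_def fps_X_power_nth intro!: sum.neutral)

section \<open>Polynomials in the inverse variable\<close>

lemma fls_sum_nth: "fls_nth (sum f A) n = (\<Sum>a\<in>A. fls_nth (f a) n)"
  by (induction A rule: infinite_finite_induct) simp_all

lemma at_inverse_z_superset:
  assumes "finite A" "{k. fps_nth d k \<noteq> 0} \<subseteq> A"
  shows "at_inverse_z d = (\<Sum>k\<in>A. fls_const (fps_nth d k) * fls_X_intpow (- int k))"
  unfolding at_inverse_z_def using assms by (intro sum.mono_neutral_left) auto

lemma at_inverse_z_nth:
  assumes "finite {k. fps_nth d k \<noteq> 0}"
  shows "fls_nth (at_inverse_z d) n = (if n \<le> 0 then fps_nth d (nat (- n)) else 0)"
proof -
  let ?A = "insert (nat (- n)) {k. fps_nth d k \<noteq> 0}"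
  have "fls_nth (at_inverse_z d) n = (\<Sum>k\<in>?A. fls_nth (fls_const (fps_nth d k) * fls_X_intpow (- int k)) n)"
    unfolding fls_sum_nth[symmetric] using assms by (intro arg_cong2[of _ _ _ _ fls_nth] at_inverse_z_superset) auto
  also have "\<dots> = (\<Sum>k\<in>?A. if k = nat (- n) then if n \<le> 0 then fps_nth d k else 0 else 0)"
    by (intro sum.cong refl) auto
  finally show ?thesis using assms by simp
qed

lemma at_inverse_z_mult:
  assumes d: "finite {k. fps_nth d k \<noteq> 0}" and e: "finite {k. fps_nth e k \<noteq> 0}"
  shows "at_inverse_z (d * e) = at_inverse_z d * at_inverse_z e"
proof -
  have "finite ({k. fps_nth d k \<noteq> 0} \<union> {k. fps_nth e k \<noteq> 0})" using d e by simp
  then obtain N where "\<forall>k\<in>{k. fps_nth d k \<noteq> 0} \<union> {k. fps_nth e k \<noteq> 0}. k \<le> N"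
    unfolding finite_nat_set_iff_bounded_le by blast
  then have N: "fps_nth d k = 0" "fps_nth e k = 0" if "k > N" for k
    using that by force+
  let ?t = "\<lambda>a b. fls_const (fps_nth d a * fps_nth e b) * fls_X_intpow (- int (a + b))"
  have zero: "fps_nth d a * fps_nth e b = 0" if "a > N \<or> b > N" for a b
    using that N by auto
  have "fps_nth (d * e) k = 0" if "k > 2 * N" for k
    unfolding fps_mult_nth using that by (intro sum.neutral ballI zero) auto
  then have "at_inverse_z (d * e) = (\<Sum>k\<le>2 * N. fls_const (fps_nth (d * e) k) * fls_X_intpow (- int k))"
    by (intro at_inverse_z_superset) (auto simp flip: not_less)
  also have "\<dots> = (\<Sum>k\<le>2 * N. \<Sum>a\<le>k. ?t a (k - a))"
  proof (rule sum.cong[OF refl])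
    fix k
    have "fls_const (\<Sum>a\<in>A. g a) = (\<Sum>a\<in>A. fls_const (g a))" for g :: "nat \<Rightarrow> B" and A
      by (induction A rule: infinite_finite_induct) (simp_all flip: fls_plus_const)
    then show "fls_const (fps_nth (d * e) k) * fls_X_intpow (- int k) = (\<Sum>a\<le>k. ?t a (k - a))"
      by (simp add: fps_mult_nth atLeast0AtMost sum_distrib_right)
  qed
  also have "\<dots> = (\<Sum>(a, b)\<in>{(a, b). a + b \<le> 2 * N}. ?t a b)"
    by (rule sum.triangle_reindex_eq[symmetric])
  also have "\<dots> = (\<Sum>(a, b)\<in>{..N} \<times> {..N}. ?t a b)"
  proof (rule sum.mono_neutral_right)
    show "finite {(a, b). a + b \<le> 2 * N}"
      by (rule finite_subset[of _ "{..2 * N} \<times> {..2 * N}"]) auto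
    show "\<forall>p\<in>{(a, b). a + b \<le> 2 * N} - {..N} \<times> {..N}. (case p of (a, b) \<Rightarrow> ?t a b) = 0"
    proof
      fix p assume "p \<in> {(a, b). a + b \<le> 2 * N} - {..N} \<times> {..N}"
      then have "fst p > N \<or> snd p > N" by (cases p) auto
      from zero[OF this] show "(case p of (a, b) \<Rightarrow> ?t a b) = 0" by (simp add: case_prod_beta)
    qed
  qed auto
  also have "\<dots> = (\<Sum>a\<le>N. fls_const (fps_nth d a) * fls_X_intpow (- int a))
      * (\<Sum>b\<le>N. fls_const (fps_nth e b) * fls_X_intpow (- int b))"
  proof -
    have "?t a b = (fls_const (fps_nth d a) * fls_X_intpow (- int a)) * (fls_const (fps_nth e b) * fls_X_intpow (- int b))" for a b
    proof -
      have "fls_X_intpow (- int (a + b)) = (fls_X_intpow (- int a) * fls_X_intpow (- int b) :: B fls)"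
        unfolding fls_X_intpow_times_fls_X_intpow by simp
      then show ?thesis by (simp only: mult_ac flip: fls_const_mult_const)
    qed
    then show ?thesis by (simp only: sum_product sum.cartesian_product)
  qed
  also have "\<dots> = at_inverse_z d * at_inverse_z e"
    using N by (subst (1 2) at_inverse_z_superset[of "{..N}"]) (auto simp flip: not_less)
  finally show ?thesis .
qed

text \<open>The substitution x_i -> x_i + z^(-i)/i, which is the differential factor of
  \<open>Gamma_star\<close>; \<open>shift_minus\<close> plays the same role for
  \<open>Gamma\<close>.\<close>

definition shift_plus :: "B \<Rightarrow> B fls"
  where "shift_plus \<tau> = at_inverse_z (exp_op dop (fps_const \<tau>))"

definition shift_minus :: "B \<Rightarrow> B fls"
  where "shift_minus \<tau> = at_inverse_z (exp_op (\<lambda>f. - dop f) (fps_const \<tau>))"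

text \<open>Exponentials of derivations are multiplicative, and finiteness in w lets this pass to
  z^(-1). Hence the operators are determined by their values on the x_i.\<close>

lemma comm_ring_hom_at_inverse_exp_op:
  assumes "L = dop \<or> L = (\<lambda>f. - dop f)"
  shows "comm_ring_hom (\<lambda>\<tau>. at_inverse_z (exp_op L (fps_const \<tau>)))"
    and "at_inverse_z (exp_op L (fps_const (qconst c))) = fls_const (qconst c)"
proof -
  interpret raising_derivation L
    using assms dop.raising_derivation_axioms neg_dop.raising_derivation_axioms by auto
  note fin = finite_exp_op_dop[OF assms]
  have const: "at_inverse_z (exp_op L (fps_const (qconst c))) = fls_const (qconst c)" for c
    by (subst at_inverse_z_superset[of "{0}"]) (auto simp: exp_op_constant L_const)
  then show "at_inverse_z (exp_op L (fps_const (qconst c))) = fls_const (qconst c)" .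
  have add: "at_inverse_z (exp_op L (fps_const (p + q)))
      = at_inverse_z (exp_op L (fps_const p)) + at_inverse_z (exp_op L (fps_const q))" for p q
  proof (rule fls_eqI)
    fix n
    show "fls_nth (at_inverse_z (exp_op L (fps_const (p + q)))) n
        = fls_nth (at_inverse_z (exp_op L (fps_const p)) + at_inverse_z (exp_op L (fps_const q))) n"
      unfolding fls_plus_nth at_inverse_z_nth[OF fin] by (simp add: exp_op_add flip: fps_const_add)
  qed
  have mult: "at_inverse_z (exp_op L (fps_const (p * q)))
      = at_inverse_z (exp_op L (fps_const p)) * at_inverse_z (exp_op L (fps_const q))" for p q
    by (simp add: exp_op_mult at_inverse_z_mult fin flip: fps_const_mult)
  show "comm_ring_hom (\<lambda>\<tau>. at_inverse_z (exp_op L (fps_const \<tau>)))"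
    using add mult const[of 0] const[of 1] by unfold_locales simp_all
qed

lemma comm_ring_hom_shift_plus: "comm_ring_hom shift_plus"
  and shift_plus_qconst: "shift_plus (qconst c) = fls_const (qconst c)"
  and comm_ring_hom_shift_minus: "comm_ring_hom shift_minus"
  and shift_minus_qconst: "shift_minus (qconst c) = fls_const (qconst c)"
  using comm_ring_hom_at_inverse_exp_op[of dop] comm_ring_hom_at_inverse_exp_op[of "\<lambda>f. - dop f"]
  unfolding shift_plus_def[abs_def] shift_minus_def[abs_def] by auto

section \<open>Effect of the shifts on the generating series\<close>

definition zinv :: "'a::comm_ring_1 fls"
  where "zinv = fls_X_intpow (- 1)"

lemma zinv_power: "zinv ^ k = fls_X_intpow (- int k)"
  unfolding zinv_def fls_X_intpow_power by simp

lemma zinv_mult_nth [simp]: "fls_nth (zinv * f) n = fls_nth f (n + 1)"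
  unfolding zinv_def fls_X_intpow_times_conv_shift by simp

lemma shift_xvar:
  assumes "i \<ge> 1"
  shows "shift_plus (xvar i) = fls_const (xvar i) + fls_const (qconst (1 / of_nat i)) * zinv ^ i"
    and "shift_minus (xvar i) = fls_const (xvar i) - fls_const (qconst (1 / of_nat i)) * zinv ^ i"
proof -
  let ?d = "fps_const (qconst (1 / of_nat i)) * fps_X ^ i"
  \<comment> \<open>The derivative of x_i is a constant times a power of w, so the exponential stops
    after its linear term.\<close>
  have "dop ?d = 0" by (simp add: dop.L_const_mult dop_X_power)
  then have "exp_op dop (fps_const (xvar i)) = fps_const (xvar i) + ?d"
    and "exp_op (\<lambda>f. - dop f) (fps_const (xvar i)) = fps_const (xvar i) - ?d"
    using assms by (simp_all add: dop.exp_op_eq neg_dop.exp_op_eq dop_xvar dop.L_uminus)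
  moreover have "at_inverse_z (fps_const (xvar i) + fps_const c * fps_X ^ i)
      = fls_const (xvar i) + fls_const c * zinv ^ i" for c
  proof -
    have "at_inverse_z (fps_const (xvar i) + fps_const c * fps_X ^ i)
        = (\<Sum>k\<in>{0, i}. fls_const (fps_nth (fps_const (xvar i) + fps_const c * fps_X ^ i) k) * fls_X_intpow (- int k))"
      by (intro at_inverse_z_superset) auto
    then show ?thesis using assms by (simp add: zinv_power)
  qed
  from this[of "qconst (1 / of_nat i)"] this[of "- qconst (1 / of_nat i)"]
  have "at_inverse_z (fps_const (xvar i) + ?d) = fls_const (xvar i) + fls_const (qconst (1 / of_nat i)) * zinv ^ i"
    "at_inverse_z (fps_const (xvar i) - ?d) = fls_const (xvar i) - fls_const (qconst (1 / of_nat i)) * zinv ^ i"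
    by (simp_all flip: fps_const_neg)
  ultimately show "shift_plus (xvar i) = fls_const (xvar i) + fls_const (qconst (1 / of_nat i)) * zinv ^ i"
    and "shift_minus (xvar i) = fls_const (xvar i) - fls_const (qconst (1 / of_nat i)) * zinv ^ i"
    by (simp_all add: shift_plus_def shift_minus_def)
qed

lemma comm_ring_hom_fls_const: "comm_ring_hom (fls_const :: 'a::comm_ring_1 \<Rightarrow> 'a fls)"
  by unfold_locales (simp_all add: fls_plus_const)

lemma comm_ring_hom_fps_to_fls: "comm_ring_hom (fps_to_fls :: 'a::comm_ring_1 fps \<Rightarrow> 'a fls)"
  by unfold_locales (simp_all add: fls_times_fps_to_fls)

text \<open>\<open>\<Sum>\<^sub>k w\<^sup>k t\<^sup>k = 1 / (1 - w t)\<close> for \<open>w = z\<^sup>-\<^sup>1\<close>\<close>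

definition geom :: "'a::comm_ring_1 fls fps"
  where "geom = Abs_fps (\<lambda>k. zinv ^ k)"

lemma geom_nth [simp]: "fps_nth geom k = zinv ^ k"
  by (simp add: geom_def)

lemma geom_mult: "geom * (1 - fps_const zinv * fps_X) = 1"
proof (rule fps_ext)
  fix n
  have eq: "(geom :: 'a fls fps) * (1 - fps_const zinv * fps_X) = geom - fps_const zinv * (fps_X * geom)"
    by (simp add: algebra_simps)
  show "fps_nth ((geom :: 'a fls fps) * (1 - fps_const zinv * fps_X)) n = fps_nth 1 n"
    unfolding eq by (cases n) simp_all
qed

lemma geom_euler: "euler geom = (geom - 1) * geom"
proof -
  define u where "u = (1 - fps_const zinv * fps_X :: 'a fls fps)"
  have gu: "geom * u = 1" unfolding u_def by (rule geom_mult)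
  have eu: "euler u = u - 1" by (simp add: u_def euler_def)
  have "euler geom * u + geom * euler u = 0"
    unfolding euler_mult[symmetric] gu by (simp add: euler_def)
  then have h: "euler geom * u = geom * (1 - u)"
    unfolding eu by (simp add: algebra_simps)
  have "euler geom = euler geom * (geom * u)" unfolding gu by simp
  also have "\<dots> = euler geom * u * geom" by (simp only: mult_ac)
  also have "\<dots> = (geom - geom * u) * geom" unfolding h by (simp only: right_diff_distrib mult_1_right)
  finally show ?thesis unfolding gu .
qed

lemma shift_euler_xseries:
  shows "fps_map shift_plus (euler xseries) = fps_map fls_const (euler xseries) + (geom - 1)"
    and "fps_map shift_minus (euler xseries) = fps_map fls_const (euler xseries) - (geom - 1)"
proof -
  interpret P: comm_ring_hom shift_plus by (rule comm_ring_hom_shift_plus)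
  interpret M: comm_ring_hom shift_minus by (rule comm_ring_hom_shift_minus)
  interpret C: comm_ring_hom "fls_const :: B \<Rightarrow> B fls" by (rule comm_ring_hom_fls_const)
  have inv: "of_nat i * fls_const (qconst (1 / of_nat i)) = 1" if "i \<ge> 1" for i
  proof -
    have "of_nat i * fls_const (qconst (1 / of_nat i)) = fls_const (qconst (of_nat i * (1 / of_nat i)))"
      unfolding qconst.hom_mult C.hom_mult hom_of_nat[OF comm_ring_hom_qconst] hom_of_nat[OF comm_ring_hom_fls_const] ..
    then show ?thesis using that by simp
  qed
  have "shift_plus (of_nat i * fps_nth xseries i) = fls_const (of_nat i * fps_nth xseries i) + fps_nth (geom - 1) i"
    and "shift_minus (of_nat i * fps_nth xseries i) = fls_const (of_nat i * fps_nth xseries i) - fps_nth (geom - 1) i" for i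
    using inv[of i]
    by (cases "i = 0"; simp add: xseries_def shift_xvar P.hom_mult M.hom_mult C.hom_mult
      hom_of_nat[OF comm_ring_hom_shift_plus] hom_of_nat[OF comm_ring_hom_shift_minus] hom_of_nat[OF comm_ring_hom_fls_const]
      distrib_left right_diff_distrib flip: mult.assoc)+
  then show "fps_map shift_plus (euler xseries) = fps_map fls_const (euler xseries) + (geom - 1)"
    and "fps_map shift_minus (euler xseries) = fps_map fls_const (euler xseries) - (geom - 1)"
    by (auto intro!: fps_ext)
qed

text \<open>The shifts change the logarithmic derivative of H by plus or minus
  \<open>geom - 1\<close>, which is the logarithmic derivative of \<open>geom\<close>; so H is
  multiplied by \<open>geom\<close> or by its inverse.\<close>

lemma shift_Hser:
  shows "fps_map shift_plus Hser = fps_map fls_const Hser * geom"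
    and "fps_map shift_minus Hser = fps_map fls_const Hser * (1 - fps_const zinv * fps_X)"
proof -
  interpret C: comm_ring_hom "fps_map (fls_const :: B \<Rightarrow> B fls)"
    by (rule comm_ring_hom_fps_map[OF comm_ring_hom_fls_const])
  have H: "euler (fps_map fls_const Hser) = fps_map fls_const (euler xseries) * fps_map fls_const Hser"
    by (simp add: euler_fps_map[OF comm_ring_hom_fls_const] euler_Hser C.hom_mult)
  show "fps_map shift_plus Hser = fps_map fls_const Hser * geom"
  proof (rule hom_Hser_eqI[OF comm_ring_hom_shift_plus])
    show "euler (fps_map fls_const Hser * geom) = fps_map shift_plus (euler xseries) * (fps_map fls_const Hser * geom)"
      unfolding euler_mult H geom_euler shift_euler_xseries by (simp add: algebra_simps)
  qed simp
  define u where "u = (1 - fps_const zinv * fps_X :: B fls fps)"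
  have "geom * u = 1" unfolding u_def by (rule geom_mult)
  then have "(geom - 1) * u = 1 - u" by (simp add: left_diff_distrib)
  then have u: "euler u = - ((geom - 1) * u)" by (simp add: u_def euler_def)
  have "fps_map shift_minus Hser = fps_map fls_const Hser * u"
  proof (rule hom_Hser_eqI[OF comm_ring_hom_shift_minus])
    show "euler (fps_map fls_const Hser * u) = fps_map shift_minus (euler xseries) * (fps_map fls_const Hser * u)"
      unfolding euler_mult H u shift_euler_xseries by (simp add: algebra_simps)
  qed (simp add: u_def)
  then show "fps_map shift_minus Hser = fps_map fls_const Hser * (1 - fps_const zinv * fps_X)"
    unfolding u_def .
qed

section \<open>Jacobi-Trudi determinants\<close>

primrec descend :: "(nat \<Rightarrow> 'a) \<Rightarrow> nat \<Rightarrow> 'a list" where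
  "descend f 0 = []"
| "descend f (Suc r) = f r # descend f r"

lemma length_descend [simp]: "length (descend f r) = r"
  and set_descend: "set (descend f r) = f ` {..<r}"
  and map_descend: "map g (descend f r) = descend (\<lambda>i. g (f i)) r"
  by (induction r) (auto simp: lessThan_Suc)

lemma descend_cong: "(\<And>i. i < r \<Longrightarrow> f i = g i) \<Longrightarrow> descend f r = descend g r"
  by (induction r) auto

lemma list_all2_descend: "(\<And>i. i < r \<Longrightarrow> P (f i) (g i)) \<Longrightarrow> list_all2 P (descend f r) (descend g r)"
  by (induction r) auto

lemma rowop_descend: "rowop c (f r) (descend f r) = descend (\<lambda>i a. f i a - c * f (Suc i) a) r"
  by (induction r) auto

definition hrow :: "'a::comm_ring_1 fps \<Rightarrow> nat \<Rightarrow> nat \<Rightarrow> 'a"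
  where "hrow G i a = (if i \<le> a then fps_nth G (a - i) else 0)"

text \<open>The Jacobi-Trudi determinant of \<lambda>, where S = {a_1 > ... > a_r} and a_j =
  \<lambda>_j + r - j. Indexing by sets makes inserting and deleting a column set
  operations.\<close>

definition jt :: "'a::comm_ring_1 fps \<Rightarrow> nat \<Rightarrow> nat set \<Rightarrow> 'a"
  where "jt G r = altform (descend (hrow G) r)"

lemma sgn_above_hom:
  assumes "comm_ring_hom F"
  shows "F (sgn_above j S) = sgn_above j S"
proof -
  interpret F: comm_ring_hom F by fact
  show ?thesis by (simp add: sgn_above_def F.hom_power F.hom_uminus)
qed

lemma altform_hom:
  assumes "comm_ring_hom F"
  shows "F (altform fs S) = altform (map (\<lambda>f a. F (f a)) fs) S"
proof -
  interpret F: comm_ring_hom F by fact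
  show ?thesis
    by (induction fs arbitrary: S) (simp_all add: F.hom_sum F.hom_mult sgn_above_hom[OF assms])
qed

lemma jt_hom: "comm_ring_hom F \<Longrightarrow> F (jt G r S) = altform (descend (\<lambda>i a. F (hrow G i a)) r) S"
  by (simp add: jt_def altform_hom map_descend)

lemma colins_cong:
  assumes "list_all2 (\<lambda>f g. \<forall>a\<in>S. f a = g a) fs gs"
  shows "colins u fs S = colins u gs S"
  using assms
proof (induction u arbitrary: fs gs S)
  case (Cons x u)
  show ?case
  proof (cases fs)
    case (Cons f fs')
    then obtain g gs' where gs: "gs = g # gs'" "\<forall>a\<in>S. f a = g a"
        "list_all2 (\<lambda>f g. \<forall>a\<in>S. f a = g a) fs' gs'"
      using Cons.prems by (auto simp: list_all2_Cons1)
    have "colins u fs' (S - {j}) = colins u gs' (S - {j})" for j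
      using gs(3) by (intro Cons.IH) (auto elim!: list_all2_mono)
    then show ?thesis using gs altform_cong[OF gs(3)] Cons by simp
  qed (use Cons.prems in simp)
qed simp

text \<open>Only the inserted column depends on z, and the determinant is linear in it.\<close>

lemma colins_fls_nth:
  "fls_nth (colins u (map (\<lambda>f a. fls_const (f a)) fs) S) n = colins (map (\<lambda>x. fls_nth x n) u) fs S"
proof (induction u arbitrary: fs S)
  case (Cons x u)
  interpret C: comm_ring_hom "fls_const :: 'a \<Rightarrow> 'a fls" by (rule comm_ring_hom_fls_const)
  have "fls_nth (x * fls_const c) n = fls_nth x n * c" for c :: 'a
    using fls_mult_const_nth[where x = c and f = x and n = n] by (simp add: mult.commute)
  moreover have "fls_nth (sgn_above k S * fls_const c * y) n = sgn_above k S * c * fls_nth y n" for k y and c :: 'a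
  proof -
    have "sgn_above k S * fls_const c = fls_const (sgn_above k S * c)"
      by (simp only: sgn_above_hom[OF comm_ring_hom_fls_const] C.hom_mult)
    then show ?thesis by simp
  qed
  ultimately show ?case
    by (cases fs) (simp_all add: Cons.IH fls_sum_nth flip: altform_hom[OF comm_ring_hom_fls_const])
qed simp

lemma shift_minus_hrow:
  "shift_minus (hrow Hser i a) = fls_const (hrow Hser i a) - zinv * fls_const (hrow Hser (Suc i) a)"
proof (cases "i \<le> a")
  case True
  have "fps_map fls_const Hser * (1 - fps_const zinv * fps_X)
      = fps_map fls_const Hser - fps_const zinv * (fps_X * fps_map fls_const Hser)"
    by (simp add: algebra_simps)
  then have "shift_minus (fps_nth Hser (a - i)) = fls_const (fps_nth Hser (a - i))
      - zinv * (fps_nth (fps_X * fps_map fls_const Hser) (a - i))"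
    using arg_cong[OF shift_Hser(2), of "\<lambda>f. fps_nth f (a - i)"] by simp
  then show ?thesis using True by (cases "a - i") (auto simp: hrow_def diff_Suc)
next
  case False
  interpret M: comm_ring_hom shift_minus by (rule comm_ring_hom_shift_minus)
  show ?thesis using False by (simp add: hrow_def)
qed

lemma Gamma_conv_shift: "Gamma \<tau> = fps_to_fls Hser * shift_minus \<tau>"
  and Gamma_star_conv_shift: "Gamma_star \<tau> = fps_to_fls Eser * shift_plus \<tau>"
  by (simp_all add: Gamma_def Gamma_star_def shift_minus_def shift_plus_def Hser_def Eser_def)

text \<open>The column \<open>(z\<^sup>r H, \<dots>, z H, H)\<close> is a generating function of the columns of the
  \<open>(r+1)\<close>-rowed determinants; the row operations which turn the other columns into
  \<open>h\<^sub>n - z\<^sup>-\<^sup>1 h\<^bsub>n-1\<^esub>\<close> leave only its top entry.\<close>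

lemma Gamma_jt_nth:
  assumes "finite S"
  shows "fls_nth (Gamma (jt Hser r S)) n = (if n + int r \<ge> 0 \<and> nat (n + int r) \<notin> S
    then sgn_above (nat (n + int r)) S * jt Hser (Suc r) (insert (nat (n + int r)) S) else 0)"
proof -
  obtain j where j: "\<And>s. s \<in> S \<Longrightarrow> s < j"
    using assms unfolding finite_nat_set_iff_bounded by blast
  have jS: "j \<notin> S" using j[of j] by blast
  have "\<not> j < s" if "s \<in> S" for s using j[OF that] by simp
  then have "{s \<in> S. j < s} = {}" by blast
  then have sgn: "sgn_above j S = (1 :: B fls)" by (simp only: sgn_above_def card.empty power_0)
  define f where "f i a = (if a = j then fls_shift (- int i) (fps_to_fls Hser) else fls_const (hrow Hser i a))" for i a
  define g where "g i a = f i a - zinv * f (Suc i) a" for i a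
  \<comment> \<open>The entry is z^i H - z^(-1) z^(i+1) H.\<close>
  have gj: "g i j = 0" for i
    by (rule fls_eqI) (simp add: g_def f_def)
  have gS: "g i a = shift_minus (hrow Hser i a)" if "a \<in> S" for i a
    using that jS by (auto simp: g_def f_def shift_minus_hrow)
  have "altform (descend f (Suc r)) (insert j S) = altform (f r # descend g r) (insert j S)"
    using altform_rowop[of "insert j S" "f r" zinv "descend f r"] assms by (simp add: rowop_descend g_def[abs_def])
  also have "\<dots> = (\<Sum>k\<in>{j}. sgn_above k (insert j S) * f r k * altform (descend g r) (insert j S - {k}))"
    unfolding altform.simps
  proof (rule sum.mono_neutral_right)
    have "altform (descend g r) (insert j S - {k}) = 0" if "k \<in> S" for k
      using that j assms gj by (intro altform_zero_column[of _ j]) (auto simp: set_descend)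
    then show "\<forall>k\<in>insert j S - {j}. sgn_above k (insert j S) * f r k * altform (descend g r) (insert j S - {k}) = 0"
      by simp
  qed (use assms in auto)
  also have "\<dots> = f r j * altform (descend g r) S"
    using assms jS sgn by (simp add: sgn_above_insert)
  also have "altform (descend g r) S = shift_minus (jt Hser r S)"
    unfolding jt_hom[OF comm_ring_hom_shift_minus] using gS by (intro altform_cong list_all2_descend) auto
  also have "f r j = fls_shift (- int r) (fps_to_fls Hser)" by (simp add: f_def)
  finally have expand: "altform (descend f (Suc r)) (insert j S)
      = fls_shift (- int r) (fps_to_fls Hser) * shift_minus (jt Hser r S)" .
  \<comment> \<open>The same determinant, read as one with an inserted column: the coefficient of
    z^(n+r) in z^i H is h_(n+r-i), the entry of row i in the column n + r. The shift by r
    compensates the top entry z^r H.\<close>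
  let ?u = "descend (\<lambda>i. fls_shift (- int i) (fps_to_fls Hser)) (Suc r)"
  have "altform (descend f (Suc r)) (insert j S) = colins (map (\<lambda>h. h j) (descend f (Suc r))) (descend f (Suc r)) S"
    unfolding colins_column[OF assms] using jS sgn by simp
  also have "map (\<lambda>h. h j) (descend f (Suc r)) = ?u"
    unfolding map_descend by (rule descend_cong) (simp add: f_def)
  also have "colins ?u (descend f (Suc r)) S = colins ?u (map (\<lambda>f a. fls_const (f a)) (descend (hrow Hser) (Suc r))) S"
    unfolding map_descend using jS by (intro colins_cong list_all2_descend) (auto simp: f_def)
  finally have "fls_nth (altform (descend f (Suc r)) (insert j S)) (n + int r)
      = colins (map (\<lambda>x. fls_nth x (n + int r)) ?u) (descend (hrow Hser) (Suc r)) S"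
    by (simp only: colins_fls_nth)
  moreover have "fls_nth (altform (descend f (Suc r)) (insert j S)) (n + int r) = fls_nth (Gamma (jt Hser r S)) n"
    unfolding expand Gamma_conv_shift by (simp add: fls_shifted_times_simps)
  ultimately have *: "fls_nth (Gamma (jt Hser r S)) n
      = colins (map (\<lambda>x. fls_nth x (n + int r)) ?u) (descend (hrow Hser) (Suc r)) S"
    by simp
  show ?thesis
  proof (cases "n + int r \<ge> 0")
    case True
    let ?m = "nat (n + int r)"
    have "map (\<lambda>x. fls_nth x (n + int r)) ?u = map (\<lambda>f. f ?m) (descend (hrow Hser) (Suc r))"
      unfolding map_descend
    proof (rule descend_cong)
      fix i
      show "fls_nth (fls_shift (- int i) (fps_to_fls Hser)) (n + int r) = hrow Hser i ?m"
        using True by (auto simp: hrow_def nat_diff_distrib' intro!: arg_cong[of _ _ "fps_nth Hser"])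
    qed
    then show ?thesis unfolding * using True by (simp add: colins_column[OF assms] jt_def del: descend.simps)
  next
    case False
    then have "x = 0" if "x \<in> set (map (\<lambda>x. fls_nth x (n + int r)) ?u)" for x
      using that unfolding set_map set_descend by auto
    then show ?thesis unfolding * using False by (subst colins_zero) auto
  qed
qed

text \<open>\<open>g\<^sub>n = \<Sum>\<^sub>k z\<^sup>-\<^sup>k h\<^bsub>n-k\<^esub>\<close>\<close>

definition grow :: "'a::comm_ring_1 fps \<Rightarrow> nat \<Rightarrow> nat \<Rightarrow> 'a fls"
  where "grow G i a = (if i \<le> a then fps_nth (fps_map fls_const G * geom) (a - i) else 0)"

lemma fps_mult_geom_nth:
  "fps_nth (f * geom) 0 = fps_nth f 0"
  "fps_nth (f * geom) (Suc n) = fps_nth f (Suc n) + zinv * fps_nth (f * geom) n"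
proof -
  show "fps_nth (f * geom) 0 = fps_nth f 0" by simp
  have "f = (f * geom) * (1 - fps_const zinv * fps_X)"
    by (simp add: mult.assoc geom_mult)
  also have "\<dots> = f * geom - fps_const zinv * (fps_X * (f * geom))"
    by (simp add: algebra_simps)
  finally have "fps_nth f (Suc n) = fps_nth (f * geom - fps_const zinv * (fps_X * (f * geom))) (Suc n)" by (rule arg_cong)
  then show "fps_nth (f * geom) (Suc n) = fps_nth f (Suc n) + zinv * fps_nth (f * geom) n"
    by simp
qed

lemma grow_rowop: "grow G i a - zinv * grow G (Suc i) a = fls_const (hrow G i a)"
proof -
  consider "a < i" | "a = i" | k where "a - i = Suc k" "a - Suc i = k" "i < a"
    by (metis Suc_diff_Suc linorder_neqE_nat)
  then show ?thesis by cases (simp_all add: grow_def hrow_def fps_mult_geom_nth)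
qed

lemma grow_nth:
  "fls_nth (grow G i a) p = (if p \<le> 0 \<and> int a - int i + p \<ge> 0 then fps_nth G (nat (int a - int i + p)) else 0)"
proof -
  have "fls_nth (fps_nth (fps_map fls_const G * geom) n) p = (if p \<le> 0 \<and> int n + p \<ge> 0 then fps_nth G (nat (int n + p)) else 0)" for n
  proof (induction n arbitrary: p)
    case (Suc n)
    then show ?case by (auto simp: fps_mult_geom_nth nat_add_distrib intro!: arg_cong[of _ _ "fps_nth G"])
  qed (auto simp: fps_mult_geom_nth)
  then show ?thesis by (auto simp: grow_def of_nat_diff)
qed

text \<open>By row operations only the top row consists of the \<open>g\<^sub>n\<close>. Up to multiples of \<open>z\<^bsup>q+1\<^esup>\<close> and
  of the lower rows, it is \<open>(z\<^bsup>q-a\<^esup> H)\<^sub>a\<close>, and the factor \<open>E\<close> cancels \<open>H\<close>.\<close>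

lemma inverse_grow_altform_nth:
  fixes E H :: "'a::comm_ring_1 fps"
  assumes EH: "E * H = 1" and S: "finite S" and p: "p \<le> int q"
  shows "fls_nth (fps_to_fls E * altform (descend (grow H) (Suc q)) S) p
    = (if nat (int q - p) \<in> S then sgn_above (nat (int q - p)) S * jt H q (S - {nat (int q - p)}) else 0)"
proof -
  interpret C: comm_ring_hom "fls_const :: 'a \<Rightarrow> 'a fls" by (rule comm_ring_hom_fls_const)
  define F where "F = descend (\<lambda>i a. fls_const (hrow H i a)) q"
  \<comment> \<open>This is z^(q-a) H, whose part with powers \<le> 0 is \<open>grow H q a\<close>;
    M collects the powers from 1 to q, and T the higher ones.\<close>
  define A where "A a = fls_shift (int a - int q) (fps_to_fls H)" for a
  define M where "M a = (\<Sum>i<q. fls_shift (int i - int q) 1 * fls_const (hrow H i a))" for a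
  define T where "T a = fls_shift (- (int q + 1)) 1 * fps_to_fls (fps_shift (a + 1) H)" for a
  have "altform (descend (grow H) (Suc q)) S = altform (grow H q # F) S"
    using altform_rowop[OF S, of "grow H q" zinv "descend (grow H) q"] by (simp add: rowop_descend grow_rowop F_def)
  also have "grow H q = (\<lambda>a. A a - M a - T a)"
  proof (intro ext fls_eqI)
    fix a m
    have "fls_nth (M a) m = (\<Sum>i<q. if i = nat (int q - m) then if 1 \<le> m \<and> m \<le> int q then hrow H i a else 0 else 0)"
      unfolding M_def fls_sum_nth by (intro sum.cong refl) (auto simp: fls_shifted_times_simps)
    also have "\<dots> = (if 1 \<le> m \<and> m \<le> int q then hrow H (nat (int q - m)) a else 0)"
      by auto
    finally have M: "fls_nth (M a) m = \<dots>" .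
    have T: "fls_nth (T a) m = (if m \<ge> int q + 1 then fps_nth H (nat (int a - int q + m)) else 0)"
      by (auto simp: T_def fls_shifted_times_simps intro!: arg_cong[of _ _ "fps_nth H"])
    have A: "fls_nth (A a) m = (if int a - int q + m \<ge> 0 then fps_nth H (nat (int a - int q + m)) else 0)"
      by (auto simp: A_def algebra_simps)
    have h: "hrow H (nat (int q - m)) a = (if int a - int q + m \<ge> 0 then fps_nth H (nat (int a - int q + m)) else 0)" if "m \<le> int q"
      using that by (auto simp: hrow_def intro!: arg_cong[of _ _ "fps_nth H"])
    consider "m \<le> 0" | "1 \<le> m" "m \<le> int q" | "m \<ge> int q + 1" by linarith
    then show "fls_nth (grow H q a) m = fls_nth (A a - M a - T a) m"
      by cases (simp_all add: grow_nth A M T h)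
  qed
  also have "altform ((\<lambda>a. A a - M a - T a) # F) S = altform (A # F) S - altform (M # F) S - altform (T # F) S"
    unfolding altform_diff_head ..
  also have "altform (M # F) S = 0"
  proof -
    have "altform ((\<lambda>a. fls_shift (int i - int q) 1 * fls_const (hrow H i a)) # F) S = 0" if "i < q" for i
    proof -
      have "(\<lambda>a. fls_const (hrow H i a)) \<in> set F" using that by (auto simp: F_def set_descend)
      then show ?thesis unfolding altform_scale_head by (simp add: altform_repeated[OF S] del: altform.simps)
    qed
    then show ?thesis unfolding M_def altform_sum_head by simp
  qed
  finally have split: "fps_to_fls E * altform (descend (grow H) (Suc q)) S
      = fps_to_fls E * altform (A # F) S - fps_to_fls E * altform (T # F) S"
    by (simp add: right_diff_distrib del: altform.simps)
  have F: "altform F U = fls_const (jt H q U)" for U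
    unfolding F_def jt_hom[OF comm_ring_hom_fls_const] ..
  let ?j = "nat (int q - p)"
  have EA: "fps_to_fls E * A a = fls_shift (int a - int q) 1" for a
  proof -
    have "fps_to_fls E * A a = fls_shift (int a - int q) (fps_to_fls (E * H))"
      by (simp add: A_def fls_shifted_times_simps fls_times_fps_to_fls)
    then show ?thesis by (simp add: EH)
  qed
  have "fls_nth (fps_to_fls E * altform (A # F) S) p
      = (\<Sum>a\<in>S. fls_nth (fls_shift (int a - int q) (fls_const (sgn_above a S * jt H q (S - {a})))) p)"
  proof -
    have "fps_to_fls E * altform (A # F) S = (\<Sum>a\<in>S. fls_const (sgn_above a S * jt H q (S - {a})) * (fps_to_fls E * A a))"
      unfolding altform.simps F sum_distrib_left C.hom_mult sgn_above_hom[OF comm_ring_hom_fls_const]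
      by (intro sum.cong refl) (simp only: mult_ac)
    then show ?thesis
      unfolding EA by (simp add: fls_sum_nth fls_shifted_times_simps)
  qed
  also have "\<dots> = (\<Sum>a\<in>S. if a = ?j then sgn_above a S * jt H q (S - {a}) else 0)"
    using p by (intro sum.cong refl) auto
  finally have main: "fls_nth (fps_to_fls E * altform (A # F) S) p
      = (if ?j \<in> S then sgn_above ?j S * jt H q (S - {?j}) else 0)"
    using S by simp
  have "fls_const c = fps_to_fls (fps_const c)" for c :: 'a
    by (rule fls_eqI) auto
  then have "F = map (\<lambda>f a. fps_to_fls (f a)) (descend (\<lambda>i a. fps_const (hrow H i a)) q)"
    by (simp add: F_def map_descend)
  then have "altform ((\<lambda>a. fps_to_fls (fps_shift (a + 1) H)) # F) S
      = fps_to_fls (altform ((\<lambda>a. fps_shift (a + 1) H) # descend (\<lambda>i a. fps_const (hrow H i a)) q) S)"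
    by (simp only: altform_hom[OF comm_ring_hom_fps_to_fls] list.map)
  then obtain X where X: "altform ((\<lambda>a. fps_to_fls (fps_shift (a + 1) H)) # F) S = fps_to_fls X" by blast
  have "fps_to_fls E * altform (T # F) S = fls_shift (- (int q + 1)) (fps_to_fls (E * X))"
    unfolding T_def altform_scale_head X by (simp add: fls_shifted_times_simps fls_times_fps_to_fls)
  then have "fls_nth (fps_to_fls E * altform (T # F) S) p = 0"
    using p by (simp del: altform.simps)
  then show ?thesis using main split by (simp del: altform.simps)
qed

lemma shift_plus_hrow: "shift_plus (hrow Hser i a) = grow Hser i a"
proof -
  interpret P: comm_ring_hom shift_plus by (rule comm_ring_hom_shift_plus)
  show ?thesis using arg_cong[OF shift_Hser(1), of "\<lambda>f. fps_nth f (a - i)"] by (simp add: hrow_def grow_def)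
qed

section \<open>The boson-fermion correspondence\<close>

text \<open>For the series \<open>Hfin r\<close> this will be the inverse of \<open>phi r\<close>;
  for \<open>Hser\<close> it intertwines the vertex operators with \<open>ins\<close> and
  \<open>contr\<close>.\<close>

definition bos :: "B fps \<Rightarrow> nat \<Rightarrow> ext \<Rightarrow> B"
  where "bos G r = linext qscale (\<lambda>S. jt G r (fset S))"

lemma bos_zero [simp]: "bos G r 0 = 0"
  and bos_add: "bos G r (v + w) = bos G r v + bos G r w"
  and bos_qscale: "bos G r (qscale c w) = qscale c (bos G r w)"
  and bos_single: "bos G r (Poly_Mapping.single S c) = qscale c (jt G r (fset S))"
  by (simp_all add: bos_def)

lemma bos_sum: "bos G r (sum f A) = (\<Sum>a\<in>A. bos G r (f a))"
  by (induction A rule: infinite_finite_induct) (simp_all add: bos_add)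

lemma linear_bos: "Vector_Spaces.linear qscale qscale (bos G r)"
  unfolding bos_def by (rule linear_linext[OF vector_space_qscale])

lemma ins_zero [simp]: "ins j 0 = 0" and contr_zero [simp]: "contr j 0 = 0"
  and ins_add: "ins j (v + w) = ins j v + ins j w" and contr_add: "contr j (v + w) = contr j v + contr j w"
  by (simp_all add: ins_def contr_def)

lemma qscale_sgn_above: "qscale (c * sgn_above j S) p = sgn_above j S * (qconst c * p)"
  by (simp only: qscale_conv_mult qconst.hom_mult sgn_above_hom[OF comm_ring_hom_qconst] mult_ac)

lemma Gamma_bos_nth:
  "fls_nth (Gamma (bos Hser r w)) n = (if n + int r \<ge> 0 then bos Hser (Suc r) (ins (nat (n + int r)) w) else 0)"
proof -
  interpret M: comm_ring_hom shift_minus by (rule comm_ring_hom_shift_minus)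
  have Gamma: "Gamma 0 = 0" "Gamma (p + q) = Gamma p + Gamma q" "Gamma (qscale c p) = fls_const (qconst c) * Gamma p" for p q c
    by (simp_all add: Gamma_conv_shift distrib_left qscale_conv_mult M.hom_add M.hom_mult shift_minus_qconst mult.left_commute)
  show ?thesis
  proof (induction w rule: poly_mapping_add_induct)
    case (single S c)
    let ?m = "nat (n + int r)"
    have "fls_nth (Gamma (bos Hser r (Poly_Mapping.single S c))) n = qconst c * fls_nth (Gamma (jt Hser r (fset S))) n"
      by (simp add: bos_single Gamma)
    also have "\<dots> = (if n + int r \<ge> 0 then bos Hser (Suc r) (ins ?m (Poly_Mapping.single S c)) else 0)"
    proof (cases "n + int r \<ge> 0 \<and> ?m |\<notin>| S")
      case True
      then have "bos Hser (Suc r) (ins ?m (Poly_Mapping.single S c))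
          = sgn_above ?m (fset S) * (qconst c * jt Hser (Suc r) (fset (finsert ?m S)))"
        by (simp add: ins_def bos_single qscale_sgn_above)
      then show ?thesis using True by (simp add: Gamma_jt_nth mult.left_commute)
    next
      case False
      then show ?thesis by (auto simp: Gamma_jt_nth ins_def)
    qed
    finally show ?case .
  qed (simp_all add: Gamma bos_add ins_add)
qed

text \<open>Stated for general F, E, H and K because it serves twice: for the shift in
  \<open>Gamma_star\<close>, and for the specialisation of \<open>Hfin (Suc q)\<close> in the proof
  of injectivity.\<close>

lemma inverse_grow_bos_nth:
  fixes F :: "B \<Rightarrow> B fls"
  assumes F: "comm_ring_hom F" and const: "\<And>c. F (qconst c) = fls_const (qconst c)"
    and rows: "\<And>i a. F (hrow K i a) = grow H i a" and EH: "E * H = 1" and n: "n \<le> int q"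
  shows "fls_nth (fps_to_fls E * F (bos K (Suc q) w)) n = bos H q (contr (nat (int q - n)) w)"
proof -
  interpret F: comm_ring_hom F by (rule F)
  show ?thesis
  proof (induction w rule: poly_mapping_add_induct)
    case (single S c)
    let ?m = "nat (int q - n)"
    have "fls_nth (fps_to_fls E * F (bos K (Suc q) (Poly_Mapping.single S c))) n
        = fls_nth (fls_const (qconst c) * (fps_to_fls E * F (jt K (Suc q) (fset S)))) n"
      by (simp add: bos_single qscale_conv_mult F.hom_mult const mult.left_commute del: fls_mult_const_nth)
    also have "\<dots> = qconst c * fls_nth (fps_to_fls E * altform (descend (grow H) (Suc q)) (fset S)) n"
      by (simp only: jt_hom[OF F] rows fls_mult_const_nth)
    also have "\<dots> = bos H q (contr ?m (Poly_Mapping.single S c))"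
    proof (cases "?m |\<in>| S")
      case True
      then have "bos H q (contr ?m (Poly_Mapping.single S c))
          = sgn_above ?m (fset S) * (qconst c * jt H q (fset (S |-| {|?m|})))"
        by (simp add: contr_def bos_single qscale_sgn_above)
      then show ?thesis
        unfolding inverse_grow_altform_nth[OF EH finite_fset n] using True
        by (simp add: mult.left_commute)
    next
      case False
      then show ?thesis unfolding inverse_grow_altform_nth[OF EH finite_fset n] by (simp add: contr_def)
    qed
    finally show ?case .
  qed (simp_all add: distrib_left F.hom_add bos_add contr_add)
qed

lemma Gamma_star_bos_nth:
  "n \<le> int q \<Longrightarrow> fls_nth (Gamma_star (bos Hser (Suc q) w)) n = bos Hser q (contr (nat (int q - n)) w)"
  unfolding Gamma_star_conv_shift
  by (rule inverse_grow_bos_nth[OF comm_ring_hom_shift_plus shift_plus_qconst shift_plus_hrow Eser_Hser])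

lemma tensor_zero [simp]: "0 \<otimes>\<^sub>Q g = 0" "f \<otimes>\<^sub>Q 0 = 0"
  by (simp_all add: tensor_def)

lemma tensor_fls_nth_superset:
  assumes "finite I" "\<And>i. fls_nth F i \<noteq> 0 \<Longrightarrow> fls_nth G (n - i) \<noteq> 0 \<Longrightarrow> i \<in> I"
  shows "fls_nth (F \<otimes>\<^sub>z G) n = (\<Sum>i\<in>I. fls_nth F i \<otimes>\<^sub>Q fls_nth G (n - i))"
proof -
  have zero: "fls_nth F i \<otimes>\<^sub>Q fls_nth G (n - i) = 0" if "fls_nth F i = 0 \<or> fls_nth G (n - i) = 0" for i
    using that by auto
  let ?I = "{fls_subdegree F..n - fls_subdegree G}"
  have I: "i \<in> ?I" if "fls_nth F i \<noteq> 0" "fls_nth G (n - i) \<noteq> 0" for i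
    using fls_subdegree_leI[OF that(1)] fls_subdegree_leI[OF that(2)] by auto
  show ?thesis unfolding tensor_fls_nth
    using assms I by (intro sum.mono_neutral_cong) (auto intro!: zero)
qed

text \<open>The series under \<open>Gamma\<close> has no powers below z^(-q-1), so the residue meets
  \<open>Gamma_star\<close> only up to z^q, exactly where its coefficients are contractions. The
  power q - j there is paired with j - q - 1, which belongs to \<open>ins j\<close>.\<close>

lemma residue_bos:
  assumes N: "\<And>j. j \<ge> N \<Longrightarrow> contr j w = 0"
  shows "fls_residue (Gamma_star (bos Hser (Suc q) w) \<otimes>\<^sub>z Gamma (bos Hser (Suc q) w))
    = (\<Sum>j<N. bos Hser q (contr j w) \<otimes>\<^sub>Q bos Hser (Suc (Suc q)) (ins j w))"
proof -
  let ?\<tau> = "bos Hser (Suc q) w"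
  let ?I = "(\<lambda>j. int q - int j) ` {..<N}"
  have "fls_nth (Gamma_star ?\<tau> \<otimes>\<^sub>z Gamma ?\<tau>) (- 1) = (\<Sum>i\<in>?I. fls_nth (Gamma_star ?\<tau>) i \<otimes>\<^sub>Q fls_nth (Gamma ?\<tau>) (- 1 - i))"
  proof (rule tensor_fls_nth_superset)
    fix i assume i: "fls_nth (Gamma_star ?\<tau>) i \<noteq> 0" "fls_nth (Gamma ?\<tau>) (- 1 - i) \<noteq> 0"
    from i(2) have "i \<le> int q" by (simp add: Gamma_bos_nth split: if_splits)
    with i(1) have "nat (int q - i) < N"
      using N[of "nat (int q - i)"] by (auto simp: Gamma_star_bos_nth simp flip: not_le)
    then show "i \<in> ?I" using \<open>i \<le> int q\<close> by (intro image_eqI[of _ _ "nat (int q - i)"]) auto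
  qed simp
  also have "\<dots> = (\<Sum>j<N. fls_nth (Gamma_star ?\<tau>) (int q - int j) \<otimes>\<^sub>Q fls_nth (Gamma ?\<tau>) (- 1 - (int q - int j)))"
    by (subst sum.reindex) (auto simp: inj_on_def)
  also have "\<dots> = (\<Sum>j<N. bos Hser q (contr j w) \<otimes>\<^sub>Q bos Hser (Suc (Suc q)) (ins j w))"
    by (intro sum.cong refl) (simp add: Gamma_star_bos_nth Gamma_bos_nth)
  finally show ?thesis by simp
qed

section \<open>Injectivity\<close>

definition Hfin :: "nat \<Rightarrow> B fps"
  where "Hfin r = fps_right_inverse (E_ser r) 1"

lemma E_ser_Hfin: "E_ser r * Hfin r = 1"
  unfolding Hfin_def by (rule E_ser_mult_inverse)

lemma E_ser_nth: "fps_nth (E_ser r) n = (if n \<le> r then fps_nth Eser n else 0)"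
proof -
  have "fps_nth (E_ser r) n = (if n = 0 then 1 else 0) + (\<Sum>i=1..r. if i = n then (-1) ^ i * evar i else 0)"
    unfolding E_ser_def fps_add_nth fps_sum_nth by (intro arg_cong2[of _ _ _ _ "(+)"] sum.cong) auto
  then show ?thesis
    by (cases "n = 0") (simp, auto simp: fps_nth_Eser)
qed

lemma inverse_unique_comm:
  fixes a :: "'a::comm_ring_1"
  assumes "a * b = 1" "a * c = 1"
  shows "b = c"
proof -
  have "b = b * (a * c)" using assms by simp
  also have "\<dots> = (a * b) * c" by (simp only: mult_ac)
  finally show ?thesis using assms by simp
qed

text \<open>After applying F, the series \<open>Eser\<close> and \<open>E_ser r\<close> agree, and
  so do their inverses.\<close>

lemma hom_Hfin:
  fixes F :: "B \<Rightarrow> 'a::comm_ring_1"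
  assumes F: "comm_ring_hom F" and zero: "\<And>i. i > r \<Longrightarrow> F (fps_nth Eser i) = 0"
  shows "fps_map F (Hfin r) = fps_map F Hser"
proof (rule inverse_unique_comm)
  interpret FF: comm_ring_hom "fps_map F" by (rule comm_ring_hom_fps_map[OF F])
  interpret F: comm_ring_hom F by (rule F)
  have "fps_map F (E_ser r) = fps_map F Eser"
    by (rule fps_ext) (simp add: E_ser_nth zero)
  then have "fps_map F Eser * fps_map F (Hfin r) = fps_map F (E_ser r * Hfin r)"
    unfolding FF.hom_mult by simp
  then show "fps_map F Eser * fps_map F (Hfin r) = 1" by (simp add: E_ser_Hfin)
  show "fps_map F Eser * fps_map F Hser = 1"
    unfolding FF.hom_mult[symmetric] Eser_Hser by simp
qed

text \<open>In terms of symmetric functions, one of q + 1 variables is set to z^(-1). F is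
  prescribed on H as \<open>Hfin q\<close> times \<open>geom\<close>; then E goes to E_q (1 - t/z),
  of degree at most q + 1 in t, so F does not distinguish H from
  \<open>Hfin (Suc q)\<close>.\<close>

lemma grow_hom_exists:
  "\<exists>F. comm_ring_hom F \<and> (\<forall>c. F (qconst c) = fls_const (qconst c))
    \<and> (\<forall>i a. F (hrow (Hfin (Suc q)) i a) = grow (Hfin q) i a)"
proof -
  interpret C: comm_ring_hom "fps_map (fls_const :: B \<Rightarrow> B fls)"
    by (rule comm_ring_hom_fps_map[OF comm_ring_hom_fls_const])
  have Hfin0: "fps_nth (Hfin q) 0 = 1"
    using arg_cong[OF E_ser_Hfin[of q], of "\<lambda>f. fps_nth f 0"] by (simp add: E_ser_nth)
  obtain F where F: "comm_ring_hom F" "\<And>c. F (qconst c) = fls_const (qconst c)"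
      "fps_map F Hser = fps_map fls_const (Hfin q) * geom"
    using hom_Hser_exists[OF comm_ring_hom_comp[OF comm_ring_hom_fls_const comm_ring_hom_qconst],
        of "fps_map fls_const (Hfin q) * geom"] Hfin0 by auto
  interpret F: comm_ring_hom F by (rule F(1))
  interpret FF: comm_ring_hom "fps_map F" by (rule comm_ring_hom_fps_map[OF F(1)])
  define u where "u = (1 - fps_const zinv * fps_X :: B fls fps)"
  have "fps_map F Eser = fps_map fls_const (E_ser q) * u"
  proof (rule inverse_unique_comm)
    show "fps_map F Hser * fps_map F Eser = 1"
      using FF.hom_mult[of Eser Hser] by (simp add: Eser_Hser mult.commute)
    have "fps_map F Hser * (fps_map fls_const (E_ser q) * u)
        = fps_map fls_const (E_ser q * Hfin q) * (geom * u)"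
      unfolding F(3) C.hom_mult by (simp only: mult_ac)
    then show "fps_map F Hser * (fps_map fls_const (E_ser q) * u) = 1"
      unfolding u_def by (simp add: geom_mult E_ser_Hfin)
  qed
  also have "\<dots> = fps_map fls_const (E_ser q) - fps_const zinv * (fps_X * fps_map fls_const (E_ser q))"
    by (simp add: u_def algebra_simps)
  finally have E: "fps_map F Eser = \<dots>" .
  have "F (fps_nth Eser i) = 0" if "i > Suc q" for i
    using arg_cong[OF E, of "\<lambda>f. fps_nth f i"] that by (cases i) (simp_all add: E_ser_nth)
  then have "fps_map F (Hfin (Suc q)) = fps_map fls_const (Hfin q) * geom"
    using hom_Hfin[OF F(1), of "Suc q"] F(3) by simp
  then have "fps_nth (fps_map F (Hfin (Suc q))) n = fps_nth (fps_map fls_const (Hfin q) * geom) n" for n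
    by (rule arg_cong)
  then have "F (hrow (Hfin (Suc q)) i a) = grow (Hfin q) i a" for i a
    by (simp add: hrow_def grow_def)
  then show ?thesis using F by blast
qed

lemma contr_all_zero:
  assumes w: "w \<in> ext_power (Suc q)" and zero: "\<And>j. contr j w = 0"
  shows "w = 0"
proof (rule ccontr)
  assume "w \<noteq> 0"
  then obtain S where S: "S \<in> Poly_Mapping.keys w" by (metis keys_eq_empty ex_in_conv)
  with w have "fcard S = Suc q" by (auto simp: ext_power_def)
  then have "S \<noteq> {||}" by (auto simp: fcard.rep_eq)
  then obtain j where j: "j |\<in>| S" by blast
  then have "Poly_Mapping.lookup (contr j w) (S |-| {|j|}) = sgn_above j (fset S) * Poly_Mapping.lookup w S"
    by (simp add: lookup_contr finsert_absorb)
  with zero have "Poly_Mapping.lookup w S = 0" by (simp add: sgn_above_def)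
  then show False using S by (simp add: in_keys_iff)
qed

lemma jt_0 [simp]: "jt G 0 {} = 1"
  by (simp add: jt_def)

text \<open>Under the specialisation from \<open>grow_hom_exists\<close>, multiplied by E_q, the
  coefficient of z^(q-j) is the image of \<open>contr j w\<close>. So all contractions of w vanish
  by induction, and a tensor of positive degree is 0 if all its contractions are.\<close>

lemma bos_Hfin_eq_0:
  assumes "w \<in> ext_power r" "bos (Hfin r) r w = 0"
  shows "w = 0"
  using assms
proof (induction r arbitrary: w)
  case 0
  have w: "w = Poly_Mapping.single {||} (Poly_Mapping.lookup w {||})"
  proof (rule poly_mapping_eqI)
    fix S
    show "Poly_Mapping.lookup w S = Poly_Mapping.lookup (Poly_Mapping.single {||} (Poly_Mapping.lookup w {||})) S"
      using 0(1) by (cases "S = {||}") (auto simp: ext_power_def lookup_single in_keys_iff)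
  qed
  have "bos (Hfin 0) 0 w = qconst (Poly_Mapping.lookup w {||})"
    by (subst w) (simp add: bos_single qscale_conv_mult)
  then have "Poly_Mapping.lookup (qconst (Poly_Mapping.lookup w {||})) 0 = 0" using 0 by simp
  then have "Poly_Mapping.lookup w {||} = 0" by (simp add: qconst_def)
  then show ?case using w by simp
next
  case (Suc q)
  obtain F :: "B \<Rightarrow> B fls" where F: "comm_ring_hom F" "\<And>c. F (qconst c) = fls_const (qconst c)"
      "\<And>i a. F (hrow (Hfin (Suc q)) i a) = grow (Hfin q) i a"
    using grow_hom_exists[of q] by blast
  interpret F: comm_ring_hom F by (rule F(1))
  have "contr j w = 0" for j
  proof (rule Suc.IH)
    show "contr j w \<in> ext_power q" by (rule contr_in_ext_power[OF Suc.prems(1)])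
    show "bos (Hfin q) q (contr j w) = 0"
      using inverse_grow_bos_nth[OF F E_ser_Hfin, of "int q - int j" q w] Suc.prems(2) by simp
  qed
  then show ?case by (rule contr_all_zero[OF Suc.prems(1)])
qed

text \<open>The specialisation e_i -> 0 for i > r, which fixes e_i for i \<le> r. It links the
  series of the vertex operators to the one in \<open>Delta\<close> and \<open>phi\<close>.\<close>

lemma truncation_exists:
  "\<exists>F. comm_ring_hom F \<and> (\<forall>c. F (qconst c) = qconst c) \<and> fps_map F Hser = Hfin r \<and> (\<forall>p\<in>Br r. F p = p)"
proof -
  have "fps_nth (Hfin r) 0 = 1"
    using arg_cong[OF E_ser_Hfin[of r], of "\<lambda>f. fps_nth f 0"] by (simp add: E_ser_nth)
  then obtain F where F: "comm_ring_hom F" "\<And>c. F (qconst c) = qconst c" "fps_map F Hser = Hfin r"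
    using hom_Hser_exists[OF comm_ring_hom_qconst] by blast
  interpret F: comm_ring_hom F by (rule F(1))
  interpret FF: comm_ring_hom "fps_map F" by (rule comm_ring_hom_fps_map[OF F(1)])
  have E: "fps_map F Eser = E_ser r"
  proof (rule inverse_unique_comm)
    show "Hfin r * fps_map F Eser = 1"
      using FF.hom_mult[of Eser Hser] by (simp add: Eser_Hser F(3) mult.commute)
    show "Hfin r * E_ser r = 1" using E_ser_Hfin by (simp add: mult.commute)
  qed
  have evar: "F (evar i) = evar i" if "i \<le> r" for i
  proof -
    have e: "evar i = (-1) ^ i * fps_nth Eser i"
      by (simp add: fps_nth_Eser flip: mult.assoc power_mult_distrib)
    have "F (fps_nth Eser i) = fps_nth Eser i"
      using arg_cong[OF E, of "\<lambda>f. fps_nth f i"] that by (simp add: E_ser_nth)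
    then show ?thesis unfolding e by (simp add: F.hom_mult F.hom_power F.hom_uminus)
  qed
  have "F p = p" if "p \<in> Br r" for p
    using that by induction (simp_all add: F(2) evar F.hom_add F.hom_mult)
  then show ?thesis using F by blast
qed

lemma bos_hom:
  assumes "comm_ring_hom F" "\<And>c. F (qconst c) = qconst c"
  shows "F (bos G r w) = bos (fps_map F G) r w"
proof -
  interpret F: comm_ring_hom F by (rule assms(1))
  have "F (hrow G i a) = hrow (fps_map F G) i a" for i a by (simp add: hrow_def)
  then have "F (jt G r S) = jt (fps_map F G) r S" for S
    by (simp add: jt_hom[OF assms(1)]) (simp add: jt_def)
  then show ?thesis
    by (simp add: bos_def linext_def qscale_conv_mult F.hom_sum F.hom_mult assms(2))
qed

lemma bos_Hser_eq_0:
  assumes "w \<in> ext_power r" "bos Hser r w = 0"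
  shows "w = 0"
proof -
  obtain F where F: "comm_ring_hom F" "\<And>c. F (qconst c) = qconst c" "fps_map F Hser = Hfin r"
    using truncation_exists[of r] by blast
  interpret F: comm_ring_hom F by (rule F(1))
  have "bos (Hfin r) r w = 0"
    using bos_hom[OF F(1,2), of Hser r w] F(3) assms(2) by simp
  then show ?thesis by (rule bos_Hfin_eq_0[OF assms(1)])
qed

lemma bos_Br:
  assumes "bos Hser r w \<in> Br r"
  shows "bos (Hfin r) r w = bos Hser r w"
proof -
  obtain F where F: "comm_ring_hom F" "\<And>c. F (qconst c) = qconst c" "fps_map F Hser = Hfin r" "\<And>p. p \<in> Br r \<Longrightarrow> F p = p"
    using truncation_exists[of r] by blast
  show ?thesis
    using bos_hom[OF F(1,2), of Hser r w] F(3,4) assms by simp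
qed

section \<open>The KP hierarchy and the Pluecker relations\<close>

lemma qscale_in_ext_power: "w \<in> ext_power r \<Longrightarrow> qscale c w \<in> ext_power r"
  by (auto simp: ext_power_def in_keys_iff)

text \<open>For each a, the two families of sums are the coefficients of a tensor and of its image
  under the injective \<open>bos Hser r\<close>. Applied to one factor at a time, this strips both
  maps off the KP equation.\<close>

lemma bilinear_zero_cong:
  assumes \<beta>: "\<And>j. j \<in> J \<Longrightarrow> \<beta> j \<in> ext_power r"
  shows "(\<forall>a b. (\<Sum>j\<in>J. \<alpha> j a * Poly_Mapping.lookup (bos Hser r (\<beta> j)) b) = 0)
    \<longleftrightarrow> (\<forall>a b. (\<Sum>j\<in>J. \<alpha> j a * Poly_Mapping.lookup (\<beta> j) b) = 0)"
proof -
  have "(\<forall>b. (\<Sum>j\<in>J. \<alpha> j a * Poly_Mapping.lookup (bos Hser r (\<beta> j)) b) = 0)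
    \<longleftrightarrow> (\<forall>b. (\<Sum>j\<in>J. \<alpha> j a * Poly_Mapping.lookup (\<beta> j) b) = 0)" for a
  proof -
    let ?s = "\<Sum>j\<in>J. qscale (\<alpha> j a) (\<beta> j)"
    have s: "?s \<in> ext_power r" by (intro sum_in_ext_power qscale_in_ext_power \<beta>)
    have "(\<forall>b. (\<Sum>j\<in>J. \<alpha> j a * Poly_Mapping.lookup (bos Hser r (\<beta> j)) b) = 0) \<longleftrightarrow> bos Hser r ?s = 0"
      by (simp add: poly_mapping_eq_iff fun_eq_iff bos_sum bos_qscale lookup_sum)
    also have "\<dots> \<longleftrightarrow> ?s = 0" using bos_Hser_eq_0[OF s] by auto
    also have "\<dots> \<longleftrightarrow> (\<forall>b. (\<Sum>j\<in>J. \<alpha> j a * Poly_Mapping.lookup (\<beta> j) b) = 0)"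
      by (simp add: poly_mapping_eq_iff fun_eq_iff lookup_sum)
    finally show ?thesis .
  qed
  then show ?thesis by blast
qed

lemma residue_plucker:
  assumes w: "w \<in> ext_power r" and r: "r \<ge> 1"
  shows "fls_residue (Gamma_star (bos Hser r w) \<otimes>\<^sub>z Gamma (bos Hser r w)) = 0 \<longleftrightarrow> plucker w"
proof -
  obtain q where q: "r = Suc q" using r by (cases r) auto
  obtain N where N: "\<And>j S. S \<in> Poly_Mapping.keys w \<Longrightarrow> j |\<in>| S \<Longrightarrow> j < N"
  proof -
    have "finite (\<Union>S\<in>Poly_Mapping.keys w. fset S)" by simp
    then obtain N where "\<forall>j\<in>(\<Union>S\<in>Poly_Mapping.keys w. fset S). j < N"
      unfolding finite_nat_set_iff_bounded by blast
    then show ?thesis using that by blast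
  qed
  have contr: "contr j w = 0" if "j \<ge> N" for j
  proof (rule poly_mapping_eqI)
    fix T
    have "finsert j T \<notin> Poly_Mapping.keys w" using N[of "finsert j T" j] that by auto
    then show "Poly_Mapping.lookup (contr j w) T = Poly_Mapping.lookup 0 T"
      by (simp add: lookup_contr in_keys_iff)
  qed
  have w': "w \<in> ext_power (Suc q)" using w q by simp
  let ?A = "\<lambda>j. bos Hser q (contr j w)" and ?B = "\<lambda>j. bos Hser (Suc (Suc q)) (ins j w)"
  have "fls_residue (Gamma_star (bos Hser r w) \<otimes>\<^sub>z Gamma (bos Hser r w)) = 0
      \<longleftrightarrow> (\<Sum>j<N. ?A j \<otimes>\<^sub>Q ?B j) = 0"
    unfolding q by (subst residue_bos[OF contr]) auto
  also have "\<dots> \<longleftrightarrow> (\<forall>a b. (\<Sum>j<N. Poly_Mapping.lookup (?A j) a * Poly_Mapping.lookup (?B j) b) = 0)"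
    by (simp add: poly_mapping_eq_iff fun_eq_iff lookup_sum lookup_tensor)
  also have "\<dots> \<longleftrightarrow> (\<forall>a b. (\<Sum>j<N. Poly_Mapping.lookup (?A j) a * Poly_Mapping.lookup (ins j w) b) = 0)"
    by (rule bilinear_zero_cong[OF ins_in_ext_power[OF w']])
  also have "\<dots> \<longleftrightarrow> (\<forall>b a. (\<Sum>j<N. Poly_Mapping.lookup (ins j w) b * Poly_Mapping.lookup (?A j) a) = 0)"
    by (subst all_comm) (simp add: mult.commute)
  also have "\<dots> \<longleftrightarrow> (\<forall>b a. (\<Sum>j<N. Poly_Mapping.lookup (ins j w) b * Poly_Mapping.lookup (contr j w) a) = 0)"
    by (rule bilinear_zero_cong[OF contr_in_ext_power[OF w']])
  also have "\<dots> \<longleftrightarrow> plucker w"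
  proof -
    have "(\<Sum>j<N. Poly_Mapping.lookup (ins j w) U * Poly_Mapping.lookup (contr j w) T)
        = (\<Sum>j\<in>fset U. Poly_Mapping.lookup (contr j w) T * Poly_Mapping.lookup (ins j w) U)" for T U
    proof (rule sum.mono_neutral_cong)
      show "Poly_Mapping.lookup (ins j w) U * Poly_Mapping.lookup (contr j w) T = 0" if "j \<in> {..<N} - fset U" for j
        using that by (simp add: lookup_ins)
      show "Poly_Mapping.lookup (contr j w) T * Poly_Mapping.lookup (ins j w) U = 0" if "j \<in> fset U - {..<N}" for j
        using that contr[of j] by simp
    qed (simp_all add: mult.commute)
    then show ?thesis unfolding plucker_def by (simp only:) (rule all_comm)
  qed
  finally show ?thesis .
qed

section \<open>The isomorphisms \<open>\<phi>\<^sub>r\<close>\<close>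

text \<open>For a decreasing list of columns, \<open>sgn_above\<close> is (-1)^j at position j, so
  the recursion is the Laplace expansion along row 0.\<close>

lemma altform_conv_det:
  assumes "sorted_wrt (>) ys" "length fs = length ys"
  shows "altform fs (set ys) = det (mat (length ys) (length ys) (\<lambda>(i, j). (fs ! i) (ys ! j)))"
  using assms
proof (induction fs arbitrary: ys)
  case Nil
  then show ?case by simp
next
  case (Cons f fs)
  let ?r = "length ys"
  let ?A = "mat ?r ?r (\<lambda>(i, j). ((f # fs) ! i) (ys ! j))"
  have dist: "distinct ys" using Cons.prems(1) by (induction ys) auto
  have r: "?r = Suc (length fs)" using Cons.prems(2) by simp
  have minor: "altform fs (set ys - {ys ! j}) = det (mat_delete ?A 0 j)" if j: "j < ?r" for j
  proof -
    let ?ys = "take j ys @ drop (Suc j) ys"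
    have split: "ys = take j ys @ ys ! j # drop (Suc j) ys"
      using id_take_nth_drop[OF j] .
    have "distinct (take j ys @ ys ! j # drop (Suc j) ys)" using dist unfolding split[symmetric] .
    then have "ys ! j \<notin> set ?ys" by simp
    moreover have "set ys = insert (ys ! j) (set ?ys)" by (subst split) simp
    ultimately have set: "set ys - {ys ! j} = set ?ys" by simp
    have "sorted_wrt (>) (take j ys @ ys ! j # drop (Suc j) ys)"
      using Cons.prems(1) unfolding split[symmetric] .
    then have sorted: "sorted_wrt (>) ?ys" by (simp add: sorted_wrt_append)
    have len: "length ?ys = length fs" using j r by simp
    have "mat_delete ?A 0 j = mat (length ?ys) (length ?ys) (\<lambda>(i, j). (fs ! i) (?ys ! j))"
      by (rule eq_matI) (use j r in \<open>auto simp: mat_delete_def nth_append min_def\<close>)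
    then show ?thesis unfolding set using Cons.IH[OF sorted] len by simp
  qed
  have sgn: "sgn_above (ys ! j) (set ys) = ((-1) ^ j :: 'a)" if j: "j < ?r" for j
  proof -
    have "{s \<in> set ys. ys ! j < s} = (!) ys ` {..<j}"
    proof (intro equalityI subsetI)
      fix s assume "s \<in> {s \<in> set ys. ys ! j < s}"
      then obtain i where i: "i < ?r" "s = ys ! i" "ys ! j < ys ! i" by (auto simp: in_set_conv_nth)
      have "i < j"
        using i sorted_wrt_nth_less[OF Cons.prems(1), of j i] by (cases i j rule: linorder_cases) auto
      then show "s \<in> (!) ys ` {..<j}" using i by auto
    qed (use sorted_wrt_nth_less[OF Cons.prems(1)] j in auto)
    moreover have "inj_on ((!) ys) {..<j}"
      using dist j by (auto simp: inj_on_def nth_eq_iff_index_eq)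
    ultimately show ?thesis by (simp add: sgn_above_def card_image)
  qed
  have "altform (f # fs) (set ys) = (\<Sum>j<?r. sgn_above (ys ! j) (set ys) * f (ys ! j) * altform fs (set ys - {ys ! j}))"
    unfolding altform.simps by (rule sum.reindex_bij_betw[OF bij_betw_nth[OF dist], symmetric]) auto
  also have "\<dots> = (\<Sum>j<?r. ?A $$ (0, j) * cofactor ?A 0 j)"
    by (intro sum.cong refl) (use r in \<open>simp add: sgn minor cofactor_def\<close>)
  also have "\<dots> = det ?A"
    by (rule laplace_expansion_row[symmetric]) (use r in auto)
  finally show ?case .
qed

section \<open>Index sets of partitions\<close>

text \<open>Adding the staircase 0, 1, ..., r - 1 to the reversed partition gives a strictly
  increasing list, the indices of the basis vector \<open>b_lambda r l\<close>.\<close>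

definition exponents :: "nat \<Rightarrow> nat list \<Rightarrow> nat list"
  where "exponents r l = map (\<lambda>k. k + l ! (r - 1 - k)) [0..<r]"

lemma exponents_sorted:
  assumes "l \<in> partitions r"
  shows "sorted_wrt (<) (exponents r l)"
proof -
  have "l ! (r - 1 - i) \<le> l ! (r - 1 - j)" if "i < j" "j < r" for i j
    using assms that sorted_wrt_nth_less[of "(\<ge>)" l "r - 1 - j" "r - 1 - i"] by (auto simp: partitions_def)
  then show ?thesis
    unfolding sorted_wrt_iff_nth_less exponents_def by (auto intro: add_less_le_mono)
qed

lemma b_lambda_conv_single:
  assumes "l \<in> partitions r"
  shows "b_lambda r l = Poly_Mapping.single (fset_of_list (exponents r l)) 1"
proof -
  have "b_lambda r l = wedge (map bvec (exponents r l))"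
    by (simp add: b_lambda_def exponents_def comp_def)
  then show ?thesis using wedge_bvec_sorted[OF exponents_sorted[OF assms]] by simp
qed

lemma hrow_Hfin: "hrow (Hfin r) i a = hcoef r (int a - int i)"
proof (cases "i \<le> a")
  case True
  then have "nat (int a - int i) = a - i" by simp
  then show ?thesis using True by (simp add: hrow_def hcoef_def Hfin_def)
qed (simp add: hrow_def hcoef_def)

text \<open>Row i of \<open>descend\<close> is \<open>hrow\<close> at r - 1 - i, and the column j
  has the exponent r - 1 - j + l ! j; their difference is the index l ! j - j + i of h.\<close>

lemma Delta_conv_jt:
  assumes l: "l \<in> partitions r"
  shows "Delta r l = jt (Hfin r) r (set (exponents r l))"
proof -
  let ?ys = "rev (exponents r l)"
  have len: "length ?ys = r" by (simp add: exponents_def)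
  have nth: "?ys ! j = (r - 1 - j) + l ! j" if "j < r" for j
    using that l by (simp add: exponents_def rev_nth partitions_def)
  have desc: "descend g r ! i = g (r - 1 - i)" if "i < r" for g :: "nat \<Rightarrow> nat \<Rightarrow> B" and i
    using that
  proof (induction r arbitrary: i)
    case (Suc r)
    then show ?case by (cases i) auto
  qed simp
  have "jt (Hfin r) r (set ?ys) = det (mat r r (\<lambda>(i, j). (descend (hrow (Hfin r)) r ! i) (?ys ! j)))"
    unfolding jt_def using altform_conv_det[of ?ys "descend (hrow (Hfin r)) r"] exponents_sorted[OF l] len
    by (simp add: sorted_wrt_rev)
  also have "mat r r (\<lambda>(i, j). (descend (hrow (Hfin r)) r ! i) (?ys ! j))
      = mat r r (\<lambda>(i, j). hcoef r (int (l ! j) - int j + int i))"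
    by (rule eq_matI) (auto simp: desc nth hrow_Hfin intro!: arg_cong[of _ _ "hcoef r"])
  finally show ?thesis by (simp add: Delta_def)
qed

lemma fcard_exponents:
  assumes "l \<in> partitions r"
  shows "fcard (fset_of_list (exponents r l)) = r"
proof -
  have "distinct (exponents r l)" using exponents_sorted[OF assms] by (auto simp: strict_sorted_iff)
  then have "card (set (exponents r l)) = length (exponents r l)" by (rule distinct_card)
  then show ?thesis by (simp only: fcard.rep_eq fset_of_list.rep_eq) (simp add: exponents_def)
qed

lemma exponents_inj:
  assumes "l \<in> partitions r" "l' \<in> partitions r" "fset_of_list (exponents r l) = fset_of_list (exponents r l')"
  shows "l = l'"
proof (rule nth_equalityI)
  have "set (exponents r l) = set (exponents r l')"
    using assms(3) by (metis fset_of_list.rep_eq)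
  then have eq: "exponents r l = exponents r l'"
    using strict_sorted_equal exponents_sorted assms by metis
  fix i assume "i < length l"
  then have "i < r" using assms by (simp add: partitions_def)
  then show "l ! i = l' ! i"
    using arg_cong[OF eq, of "\<lambda>xs. xs ! (r - 1 - i)"] by (simp add: exponents_def)
qed (use assms in \<open>simp add: partitions_def\<close>)

lemma exponents_surj:
  assumes "fcard S = r"
  obtains l where "l \<in> partitions r" "fset_of_list (exponents r l) = S"
proof -
  let ?zs = "sorted_list_of_fset S"
  have zs: "sorted_wrt (<) ?zs" "length ?zs = r" "set ?zs = fset S"
    using assms by (simp_all add: sorted_list_of_fset.rep_eq fcard.rep_eq)
  \<comment> \<open>Entries grow at least as fast as positions, so subtracting the staircase keeps
    the list weakly monotone.\<close>
  have gap: "?zs ! a + (b - a) \<le> ?zs ! b" if "a \<le> b" "b < r" for a b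
    using that
  proof (induction b)
    case (Suc b)
    show ?case
    proof (cases "a = Suc b")
      case False
      moreover have "?zs ! b < ?zs ! Suc b"
        using sorted_wrt_nth_less[OF zs(1), of b "Suc b"] Suc.prems zs(2) by simp
      ultimately show ?thesis using Suc by auto
    qed simp
  qed simp
  define l where "l = map (\<lambda>k. ?zs ! (r - 1 - k) - (r - 1 - k)) [0..<r]"
  have "l ! j \<le> l ! i" if "i < j" "j < r" for i j
  proof -
    have arith: "A - x \<le> B - y" if "A + (y - x) \<le> B" "x \<le> y" for A B x y :: nat
      using that by arith
    have "?zs ! (r - 1 - j) - (r - 1 - j) \<le> ?zs ! (r - 1 - i) - (r - 1 - i)"
      by (rule arith, rule gap) (use that in auto)
    moreover have "l ! j = ?zs ! (r - 1 - j) - (r - 1 - j)" "l ! i = ?zs ! (r - 1 - i) - (r - 1 - i)"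
      using that by (simp_all add: l_def)
    ultimately show ?thesis by (simp only:)
  qed
  then have "l \<in> partitions r"
    by (auto simp: partitions_def sorted_wrt_iff_nth_less l_def)
  moreover have "exponents r l = ?zs"
  proof (rule nth_equalityI)
    fix k assume "k < length (exponents r l)"
    then have k: "k < r" by (simp add: exponents_def)
    then have "k \<le> ?zs ! k" using sorted_wrt_less_idx[OF zs(1)] zs(2) by simp
    then show "exponents r l ! k = ?zs ! k" using k by (simp add: exponents_def l_def)
  qed (simp add: exponents_def zs(2))
  then have "fset_of_list (exponents r l) = S"
    using zs(3) by (simp add: fset_eq_iff fset_of_list_elem)
  ultimately show ?thesis using that by blast
qed

section \<open>Independence of the determinants\<close>

lemma subspace_ext_power: "Q.vs1.subspace (ext_power r)"
  unfolding ext_power_span[symmetric] by (rule Q.vs1.subspace_span)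

lemma independent_single: "Q.vs1.independent ((\<lambda>S. Poly_Mapping.single S 1) ` A)"
proof
  assume "Q.vs1.dependent ((\<lambda>S. Poly_Mapping.single S (1 :: rat)) ` A)"
  then obtain S where "Poly_Mapping.single S (1 :: rat)
      \<in> Q.vs1.span ((\<lambda>S. Poly_Mapping.single S 1) ` A - {Poly_Mapping.single S 1})"
    unfolding Q.vs1.dependent_def by blast
  moreover have "Q.vs1.span ((\<lambda>S. Poly_Mapping.single S 1) ` A - {Poly_Mapping.single S 1})
      \<subseteq> {p. Poly_Mapping.lookup p S = (0 :: rat)}"
    by (rule Q.vs1.span_minimal) (auto simp: Q.vs1.subspace_def lookup_add lookup_single when_def)
  ultimately show False by auto
qed

text \<open>The \<open>Delta r l\<close> are the images of distinct basis vectors under the map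
  \<open>bos (Hfin r) r\<close>, which is injective on \<open>ext_power r\<close>. Independence
  guarantees that \<open>phi r\<close> takes its prescribed values.\<close>

lemma independent_Delta: "Q.vs1.independent (Delta r ` partitions r)"
  and inj_on_Delta: "inj_on (Delta r) (partitions r)"
proof -
  let ?s = "\<lambda>S. Poly_Mapping.single S (1 :: rat)" and ?S = "\<lambda>l. fset_of_list (exponents r l)"
  have Delta: "Delta r l = bos (Hfin r) r (?s (?S l))" if "l \<in> partitions r" for l
    using that by (simp add: Delta_conv_jt bos_single qscale_conv_mult fset_of_list.rep_eq)
  have sub: "?s ` ?S ` partitions r \<subseteq> ext_power r"
    using fcard_exponents by (auto simp: ext_power_def)
  have diff: "bos (Hfin r) r (v - w) = bos (Hfin r) r v - bos (Hfin r) r w" for v w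
    using linear_bos by (rule Q.linear_diff)
  have inj: "inj_on (bos (Hfin r) r) (ext_power r)"
  proof (intro inj_onI)
    fix v w assume "v \<in> ext_power r" "w \<in> ext_power r" "bos (Hfin r) r v = bos (Hfin r) r w"
    then have "v - w = 0"
      using bos_Hfin_eq_0[OF Q.vs1.subspace_diff[OF subspace_ext_power]] by (simp add: diff)
    then show "v = w" by simp
  qed
  have "Q.vs1.independent (bos (Hfin r) r ` ?s ` ?S ` partitions r)"
  proof (rule Q.linear_independent_injective_image[OF linear_bos independent_single])
    show "inj_on (bos (Hfin r) r) (Q.vs1.span (?s ` ?S ` partitions r))"
      using Q.vs1.span_minimal[OF sub subspace_ext_power] inj by (rule inj_on_subset[rotated])
  qed
  also have "bos (Hfin r) r ` ?s ` ?S ` partitions r = Delta r ` partitions r"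
    unfolding image_image using Delta by (intro image_cong) auto
  finally show "Q.vs1.independent (Delta r ` partitions r)" .
  show "inj_on (Delta r) (partitions r)"
  proof (rule inj_onI)
    fix l l' assume l: "l \<in> partitions r" "l' \<in> partitions r" "Delta r l = Delta r l'"
    then have "?s (?S l) = ?s (?S l')"
      using inj sub by (intro inj_onD[OF inj]) (auto simp: Delta)
    then have "?S l = ?S l'" by (metis keys_single one_neq_zero singleton_inject)
    with l show "l = l'" by (intro exponents_inj)
  qed
qed

lemma phi_bos:
  assumes w: "w \<in> ext_power r"
  shows "phi r (bos (Hfin r) r w) = w"
proof -
  interpret phi: Vector_Spaces.linear qscale qscale "phi r"
    unfolding phi_def by (rule Q.linear_construct[OF independent_Delta])
  have basis: "phi r (jt (Hfin r) r (fset S)) = Poly_Mapping.single S 1" if "S \<in> Poly_Mapping.keys w" for S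
  proof -
    have "fcard S = r" using that w by (auto simp: ext_power_def)
    then obtain l where l: "l \<in> partitions r" "fset_of_list (exponents r l) = S"
      using exponents_surj by blast
    have "phi r (Delta r l) = b_lambda r (the_inv_into (partitions r) (Delta r) (Delta r l))"
      unfolding phi_def using l(1) by (intro Q.construct_basis independent_Delta) auto
    also have "\<dots> = Poly_Mapping.single S 1"
      by (simp only: the_inv_into_f_f[OF inj_on_Delta l(1)] b_lambda_conv_single[OF l(1)] l(2))
    finally show ?thesis
      unfolding Delta_conv_jt[OF l(1)] fset_of_list.rep_eq[symmetric] l(2) .
  qed
  have "phi r (bos (Hfin r) r w) = (\<Sum>S\<in>Poly_Mapping.keys w. qscale (Poly_Mapping.lookup w S) (phi r (jt (Hfin r) r (fset S))))"
    by (simp add: bos_def linext_def phi.sum phi.scale)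
  also have "\<dots> = linext qscale (\<lambda>S. Poly_Mapping.single S 1) w"
    unfolding linext_def by (intro sum.cong refl) (simp only: basis)
  finally show ?thesis by (simp only: linext_id)
qed

section \<open>Surjectivity for large \<open>r\<close>\<close>

definition bos_range :: "nat \<Rightarrow> B set"
  where "bos_range r = bos Hser r ` ext_power r"

lemma subspace_bos_range: "Q.vs1.subspace (bos_range r)"
  unfolding bos_range_def by (rule Q.linear_subspace_image[OF linear_bos subspace_ext_power])

lemmas bos_range_add = Q.vs1.subspace_add[OF subspace_bos_range]
  and bos_range_scale = Q.vs1.subspace_scale[OF subspace_bos_range]
  and bos_range_sum = Q.vs1.subspace_sum[OF subspace_bos_range]
  and bos_range_neg = Q.vs1.subspace_neg[OF subspace_bos_range]
  and bos_range_0 = Q.vs1.subspace_0[OF subspace_bos_range]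

lemma jt_in_bos_range:
  assumes "finite S" "card S = r"
  shows "jt Hser r S \<in> bos_range r"
proof -
  obtain T where T: "fset T = S" using assms(1) by (metis Abs_fset_inverse mem_Collect_eq)
  then have "Poly_Mapping.single T 1 \<in> ext_power r" using assms by (simp add: ext_power_def fcard.rep_eq)
  then have "bos Hser r (Poly_Mapping.single T 1) \<in> bos_range r" unfolding bos_range_def by blast
  then show ?thesis using T by (simp add: bos_single)
qed

lemma sgn_above_in_bos_range:
  assumes "p \<in> bos_range r"
  shows "sgn_above j S * p \<in> bos_range r"
  using bos_range_scale[OF assms, of "sgn_above j S"]
  by (simp add: qscale_conv_mult sgn_above_hom[OF comm_ring_hom_qconst])

text \<open>Differentiation turns the column k into the column k - i, or into 0 if k < i. Each term
  is therefore 0 or, up to sign, again a determinant with r exponents.\<close>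

lemma pdiff_bos_range:
  assumes i: "i \<ge> 1" and p: "p \<in> bos_range r"
  shows "pdiff i p \<in> bos_range r"
proof -
  have row: "pdiff i (hrow Hser m k) = (if i \<le> k then hrow Hser m (k - i) else 0)" for m k
    by (auto simp: hrow_def pdiff_Hser[OF i] intro!: arg_cong[of _ _ "fps_nth Hser"])
  have jt: "pdiff i (jt Hser r S) \<in> bos_range r" if S: "finite S" "card S = r" for S
  proof -
    let ?fs = "descend (hrow Hser) r"
    have "sgn_above k S * colins (map (\<lambda>f. pdiff i (f k)) ?fs) ?fs (S - {k}) \<in> bos_range r" if k: "k \<in> S" for k
    proof (cases "i \<le> k")
      case True
      have "colins (map (\<lambda>f. pdiff i (f k)) ?fs) ?fs (S - {k}) = colins (map (\<lambda>f. f (k - i)) ?fs) ?fs (S - {k})"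
        unfolding map_descend using True by (simp add: row)
      also have "\<dots> \<in> bos_range r"
      proof (cases "k - i \<in> S - {k}")
        case False
        have "r > 0" using S k by (metis card_gt_0_iff empty_iff)
        then have "card (insert (k - i) (S - {k})) = r" using S k False by simp
        then show ?thesis using False S
          by (simp add: colins_column sgn_above_in_bos_range jt_in_bos_range bos_range_0 flip: jt_def)
      qed (use S in \<open>simp add: colins_column bos_range_0\<close>)
      finally show ?thesis by (rule sgn_above_in_bos_range)
    next
      case False
      have "colins (map (\<lambda>f. pdiff i (f k)) ?fs) ?fs (S - {k}) = 0"
        by (rule colins_zero) (use False in \<open>auto simp: map_descend set_descend row\<close>)
      then show ?thesis by (simp add: bos_range_0)
    qed
    moreover have "pdiff i (jt Hser r S)
        = (\<Sum>k\<in>S. sgn_above k S * colins (map (\<lambda>f. pdiff i (f k)) ?fs) ?fs (S - {k}))"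
      unfolding jt_def by (rule altform_derivation[OF pdiff_add pdiff_mult S(1)])
    ultimately show ?thesis by (simp only: bos_range_sum)
  qed
  obtain w where w: "w \<in> ext_power r" "p = bos Hser r w" using p by (auto simp: bos_range_def)
  have "pdiff i p = (\<Sum>S\<in>Poly_Mapping.keys w. qscale (Poly_Mapping.lookup w S) (pdiff i (jt Hser r (fset S))))"
    unfolding w(2) bos_def linext_def by (simp add: qscale_conv_mult pdiff_sum pdiff_qconst_mult)
  also have "\<dots> \<in> bos_range r"
    using w(1) by (intro bos_range_sum bos_range_scale jt) (auto simp: ext_power_def fcard.rep_eq)
  finally show ?thesis .
qed

lemma exp_op_dop_bos_range:
  assumes "p \<in> bos_range r"
  shows "fps_nth (exp_op dop (fps_const p)) k \<in> bos_range r"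
proof -
  have "fps_nth ((dop ^^ n) (fps_const p)) k \<in> bos_range r" for n k
  proof (induction n arbitrary: k)
    case (Suc n)
    then show ?case unfolding funpow.simps comp_def dop_def fps_nth_Abs_fps
      by (auto intro!: bos_range_sum bos_range_scale pdiff_bos_range simp flip: qscale_conv_mult)
  qed (use assms in \<open>auto simp: bos_range_0\<close>)
  then show ?thesis unfolding exp_op_def fps_nth_Abs_fps
    by (auto intro!: bos_range_sum bos_range_scale simp flip: qscale_conv_mult)
qed

lemma Gamma_bos_range:
  assumes "p \<in> bos_range r"
  shows "fls_nth (Gamma p) n \<in> bos_range (Suc r)"
proof -
  obtain w where w: "w \<in> ext_power r" "p = bos Hser r w" using assms by (auto simp: bos_range_def)
  then show ?thesis
    using ins_in_ext_power[OF w(1)] by (simp add: Gamma_bos_nth bos_range_0) (simp add: bos_range_def)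
qed

text \<open>The operator \<open>exp(-\<Sum> z\<^sup>-\<^sup>i/i \<partial>\<^sub>i)\<close> in \<open>\<Gamma>(z)\<close> is inverted by its opposite, which exhibits
  the multiplication by \<open>h\<^sub>n\<close> as a combination of coefficients of \<open>\<Gamma>(z)\<close>.\<close>

lemma Hser_mult_conv_Gamma:
  obtains N where "\<And>n. fps_nth Hser n * p
    = (\<Sum>l\<le>N. fls_nth (Gamma (fps_nth (exp_op dop (fps_const p)) l)) (int n + int l))"
proof -
  define g where "g = exp_op dop (fps_const p)"
  have "finite {k. fps_nth g k \<noteq> 0}" unfolding g_def by (rule finite_exp_op_dop) simp
  then obtain N where "\<forall>k\<in>{k. fps_nth g k \<noteq> 0}. k \<le> N"
    unfolding finite_nat_set_iff_bounded_le by blast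
  then have N: "fps_nth g k = 0" if "k > N" for k using that by force
  let ?E = "exp_op (\<lambda>f. - dop f)"
  \<comment> \<open>g is a polynomial in w, and powers of w are constants for \<open>dop\<close>, so
    the opposite exponential acts on the coefficients of g alone.\<close>
  have "g = (\<Sum>l\<le>N. fps_X ^ l * fps_const (fps_nth g l))"
  proof (rule fps_ext)
    fix n
    have "fps_nth (\<Sum>l\<le>N. fps_X ^ l * fps_const (fps_nth g l)) n = (\<Sum>l\<le>N. if l = n then fps_nth g l else 0)"
      unfolding fps_sum_nth by (intro sum.cong refl) (auto simp: fps_X_power_mult_nth)
    then show "fps_nth g n = fps_nth (\<Sum>l\<le>N. fps_X ^ l * fps_const (fps_nth g l)) n"
      using N[of n] by auto
  qed
  then have "?E g = ?E (\<Sum>l\<le>N. fps_X ^ l * fps_const (fps_nth g l))" by simp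
  also have "\<dots> = (\<Sum>l\<le>N. fps_X ^ l * ?E (fps_const (fps_nth g l)))"
  proof -
    have "?E 0 = 0" by (rule neg_dop.exp_op_constant) simp
    then have sum: "?E (sum f A) = (\<Sum>a\<in>A. ?E (f a))" for f and A :: "nat set"
      by (induction A rule: infinite_finite_induct) (simp_all add: neg_dop.exp_op_add)
    have "?E (fps_X ^ l) = fps_X ^ l" for l
      by (rule neg_dop.exp_op_constant) (simp add: dop_X_power)
    then show ?thesis unfolding sum neg_dop.exp_op_mult by simp
  qed
  finally have p: "fps_const p = (\<Sum>l\<le>N. fps_X ^ l * ?E (fps_const (fps_nth g l)))"
    unfolding g_def dop.exp_op_inverse .
  have at: "fps_nth (fps_const p) m = (\<Sum>l\<le>N. fls_nth (zinv ^ l * shift_minus (fps_nth g l)) (- int m))" for m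
  proof -
    have "fls_nth (zinv ^ l * shift_minus (fps_nth g l)) (- int m) = fps_nth (fps_X ^ l * ?E (fps_const (fps_nth g l))) m" for l
    proof -
      have fin: "finite {k. fps_nth (?E (fps_const (fps_nth g l))) k \<noteq> 0}" by (rule finite_exp_op_dop) simp
      have "fls_nth (zinv ^ l * shift_minus (fps_nth g l)) (- int m) = fls_nth (shift_minus (fps_nth g l)) (int l - int m)"
        unfolding zinv_power fls_X_intpow_times_conv_shift by simp
      then show ?thesis unfolding shift_minus_def at_inverse_z_nth[OF fin]
        by (auto simp: fps_X_power_mult_nth intro!: arg_cong[of _ _ "fps_nth _"])
    qed
    then show ?thesis by (simp add: p fps_sum_nth)
  qed
  have "fls_nth (\<Sum>l\<le>N. zinv ^ l * shift_minus (fps_nth g l)) i = fls_nth (fls_const p) i" for i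
  proof (cases "i \<le> 0")
    case True
    then obtain m where "i = - int m" by (metis nonpos_int_cases)
    then show ?thesis using at[of m] by (auto simp: fls_sum_nth)
  next
    case False
    have "fls_nth (zinv ^ l * shift_minus (fps_nth g l)) i = 0" for l
    proof -
      have fin: "finite {k. fps_nth (?E (fps_const (fps_nth g l))) k \<noteq> 0}" by (rule finite_exp_op_dop) simp
      show ?thesis unfolding zinv_power fls_X_intpow_times_conv_shift shift_minus_def
        using False by (simp add: at_inverse_z_nth[OF fin])
    qed
    then show ?thesis using False by (simp add: fls_sum_nth)
  qed
  then have "(\<Sum>l\<le>N. zinv ^ l * shift_minus (fps_nth g l)) = fls_const p" by (rule fls_eqI)
  then have "fps_to_fls Hser * fls_const p = (\<Sum>l\<le>N. zinv ^ l * Gamma (fps_nth g l))"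
    unfolding Gamma_conv_shift by (simp add: sum_distrib_left mult.left_commute flip: \<open>_ = fls_const p\<close>)
  then have eq: "fls_nth (fls_const p * fps_to_fls Hser) (int n) = fls_nth (\<Sum>l\<le>N. zinv ^ l * Gamma (fps_nth g l)) (int n)" for n
    by (simp only: mult.commute)
  have "fps_nth Hser n * p = (\<Sum>l\<le>N. fls_nth (Gamma (fps_nth g l)) (int n + int l))" for n
    using eq[of n] unfolding zinv_power fls_X_intpow_times_conv_shift fls_sum_nth by (simp add: mult.commute)
  then show ?thesis using that unfolding g_def by blast
qed

lemma Hser_mult_bos_range:
  assumes "p \<in> bos_range r"
  shows "fps_nth Hser n * p \<in> bos_range (Suc r)"
proof -
  obtain N where N: "\<And>n. fps_nth Hser n * p
      = (\<Sum>l\<le>N. fls_nth (Gamma (fps_nth (exp_op dop (fps_const p)) l)) (int n + int l))"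
    by (rule Hser_mult_conv_Gamma[of p]) blast
  show ?thesis unfolding N by (intro bos_range_sum Gamma_bos_range exp_op_dop_bos_range assms)
qed

text \<open>Multiplication by h_0 = 1 leads from each range to the next.\<close>

lemma bos_range_mono:
  assumes "r \<le> s" "p \<in> bos_range r"
  shows "p \<in> bos_range s"
  using assms by (induction rule: dec_induct) (use Hser_mult_bos_range[where n = 0] in auto)

lemma eventually_bos_range: "\<exists>s. \<forall>r\<ge>s. \<tau> \<in> bos_range r"
proof -
  \<comment> \<open>Closure under products is not established for W, only stability under
    multiplication by constants, by each h_n and then by each x_n. Hence the final induction on q
    keeps the second factor p arbitrary.\<close>
  define W where "W = (\<Union>r. bos_range r)"
  have add: "p + q \<in> W" if pq: "p \<in> W" "q \<in> W" for p q
  proof -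
    obtain r s where "p \<in> bos_range r" "q \<in> bos_range s" using pq by (auto simp: W_def)
    then have "p + q \<in> bos_range (max r s)"
      by (intro bos_range_add bos_range_mono[OF max.cobounded1] bos_range_mono[OF max.cobounded2])
    then show ?thesis by (auto simp: W_def)
  qed
  have const: "qconst c * p \<in> W" if "p \<in> W" for c p
    using that bos_range_scale by (auto simp: W_def simp flip: qscale_conv_mult)
  have nat: "of_nat n * p \<in> W" if "p \<in> W" for n p
    using const[OF that, of "of_nat n"] by (simp add: hom_of_nat[OF comm_ring_hom_qconst])
  have neg: "- p \<in> W" if "p \<in> W" for p
    using that bos_range_neg by (auto simp: W_def)
  have zero: "0 \<in> W" using bos_range_0 by (auto simp: W_def)
  have sum: "sum f A \<in> W" if "\<And>a. a \<in> A \<Longrightarrow> f a \<in> W" for f and A :: "nat set"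
    using that by (induction A rule: infinite_finite_induct) (auto simp: zero add)
  have h: "fps_nth Hser n * p \<in> W" if "p \<in> W" for n p
    using that Hser_mult_bos_range by (auto simp: W_def)
  have x: "xvar n * p \<in> W" if "n \<ge> 1" "p \<in> W" for n p
    using that
  proof (induction n arbitrary: p rule: less_induct)
    case (less n)
    have "of_nat n * xvar n * p = of_nat n * (fps_nth Hser n * p)
        + - (\<Sum>i=1..<n. of_nat i * (xvar i * (fps_nth Hser (n - i) * p)))"
      unfolding xvar_recursion(1)[OF less.prems(1)] by (simp add: left_diff_distrib sum_distrib_right mult.assoc)
    also have "\<dots> \<in> W"
      using less.prems by (intro add neg sum nat h less.IH) auto
    finally have "qconst (1 / of_nat n) * (of_nat n * xvar n * p) \<in> W" by (rule const)
    then show ?case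
      using xvar_of_nat_mult[OF less.prems(1)] by (simp only: mult.assoc[symmetric])
  qed
  have one: "1 \<in> W"
    using jt_in_bos_range[of "{}" 0] by (auto simp: W_def)
  have "q * p \<in> W" if "p \<in> W" for p q
    using that
  proof (induction q arbitrary: p rule: B_induct)
    case (mult q q')
    then show ?case by (simp add: mult.assoc)
  qed (simp_all add: const x add distrib_right)
  from this[OF one, of \<tau>] obtain s where "\<tau> \<in> bos_range s" by (auto simp: W_def)
  then have "\<tau> \<in> bos_range r" if "r \<ge> s" for r by (rule bos_range_mono[OF that])
  then show ?thesis by blast
qed

text \<open>By Newton's identity in the e's, x_n lies in \<open>Br r\<close> as soon as r \<ge> n;
  sums and products take the larger of two bounds.\<close>

lemma eventually_Br: "\<exists>s. \<forall>r\<ge>s. \<tau> \<in> Br r"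
proof (induction \<tau> rule: B_induct)
  case (var i)
  have "xvar n \<in> Br r" if "1 \<le> n" "n \<le> r" for n r
    using that
  proof (induction n rule: less_induct)
    case (less n)
    have const: "qconst c * p \<in> Br r" if "p \<in> Br r" for c p
      using that by (intro Br_mult Br_const)
    have nat: "of_nat k * p \<in> Br r" if "p \<in> Br r" for k p
      using const[OF that, of "of_nat k"] by (simp add: hom_of_nat[OF comm_ring_hom_qconst])
    have neg: "- p \<in> Br r" if "p \<in> Br r" for p
      using const[OF that, of "- 1"] by (simp add: qconst.hom_uminus)
    have sum: "sum f A \<in> Br r" if "\<And>a. a \<in> A \<Longrightarrow> f a \<in> Br r" for f and A :: "nat set"
      using that Br_const[of 0] by (induction A rule: infinite_finite_induct) (auto intro: Br_add)
    have E: "fps_nth Eser k \<in> Br r" if "k \<le> r" for k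
    proof (cases "k = 0")
      case True
      then show ?thesis using Br_const[of 1] by simp
    next
      case False
      have "fps_nth Eser k = qconst ((-1) ^ k) * evar k"
        by (simp add: fps_nth_Eser qconst.hom_power qconst.hom_uminus)
      then show ?thesis using False that by (simp only:) (intro const Br_evar, auto)
    qed
    have "of_nat n * xvar n = - (of_nat n * fps_nth Eser n) + - (\<Sum>i=1..<n. of_nat i * xvar i * fps_nth Eser (n - i))"
      unfolding xvar_recursion(2)[OF less.prems(1)] by simp
    also have "\<dots> \<in> Br r"
      using less.prems by (intro Br_add Br_mult[of "_ * _"] neg sum nat E less.IH) auto
    finally have "qconst (1 / of_nat n) * (of_nat n * xvar n) \<in> Br r" by (rule const)
    then show ?case using xvar_of_nat_mult[OF less.prems(1)] by simp
  qed
  then show ?case using var by blast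
next
  case (add p q)
  then obtain s t where "\<forall>r\<ge>s. p \<in> Br r" "\<forall>r\<ge>t. q \<in> Br r" by blast
  then show ?case by (intro exI[of _ "max s t"]) (auto intro: Br_add)
next
  case (mult p q)
  then obtain s t where "\<forall>r\<ge>s. p \<in> Br r" "\<forall>r\<ge>t. q \<in> Br r" by blast
  then show ?case by (intro exI[of _ "max s t"]) (auto intro: Br_mult)
qed (auto intro: Br_const)

theorem corollary0p1:
  fixes \<tau> :: B
  shows "fls_residue (Gamma_star \<tau> \<otimes>\<^sub>z Gamma \<tau>) = 0 \<longleftrightarrow>
    (\<exists>s. \<forall>r\<ge>s. \<tau> \<in> Br r \<and> phi r \<tau> \<in> grassmann_cone r)"
proof -
  obtain s t where s: "\<And>r. r \<ge> s \<Longrightarrow> \<tau> \<in> Br r" and t: "\<And>r. r \<ge> t \<Longrightarrow> \<tau> \<in> bos_range r"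
    using eventually_Br eventually_bos_range by metis
  \<comment> \<open>The equivalence holds for each single large r: one direction of the theorem uses
    it for all of them, the other for just one. The bound 1 excludes r = 0, where the unit is the
    only decomposable tensor.\<close>
  have key: "fls_residue (Gamma_star \<tau> \<otimes>\<^sub>z Gamma \<tau>) = 0 \<longleftrightarrow> phi r \<tau> \<in> grassmann_cone r"
    if r: "r \<ge> max 1 (max s t)" for r
  proof -
    obtain w where w: "w \<in> ext_power r" "\<tau> = bos Hser r w"
      using t[of r] r by (auto simp: bos_range_def)
    have "phi r \<tau> = w"
      using phi_bos[OF w(1)] bos_Br[of r w] s[of r] r w(2) by simp
    moreover have "plucker w \<longleftrightarrow> w \<in> grassmann_cone r"
      using plucker_decomposable[OF w(1)] plucker_wedge r by (auto simp: grassmann_cone_def)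
    ultimately show ?thesis
      using residue_plucker[OF w(1)] r w(2) by simp
  qed
  show ?thesis
  proof
    assume "fls_residue (Gamma_star \<tau> \<otimes>\<^sub>z Gamma \<tau>) = 0"
    then show "\<exists>s. \<forall>r\<ge>s. \<tau> \<in> Br r \<and> phi r \<tau> \<in> grassmann_cone r"
      using key s by (intro exI[of _ "max 1 (max s t)"]) auto
  next
    assume "\<exists>s. \<forall>r\<ge>s. \<tau> \<in> Br r \<and> phi r \<tau> \<in> grassmann_cone r"
    then obtain u where "\<forall>r\<ge>u. phi r \<tau> \<in> grassmann_cone r" by blast
    then show "fls_residue (Gamma_star \<tau> \<otimes>\<^sub>z Gamma \<tau>) = 0"
      using key[of "max u (max 1 (max s t))"] by simp
  qed
qed

end
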